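(* Let $\bullet$ denote any one of the four versions (regular, causal $c$, anticausal $ac$, bicausal $bc$). Let $p\in[1,\infty)$ and $\mu\in\mathcal P_p(\mathcal X)$, $\nu\in\mathcal P_p(\mathcal Y)$, $P=\mu\otimes\nu$. Assume that there exist discrete (i.e. finitely supported) measures $\mu^n\in\mathcal P(\mathcal X)$, $\nu^n\in\mathcal P(\mathcal Y)$ such that $$\lim_{n\to\infty}W_{p,bc}(\mu^n,\mu)=\lim_{n\to\infty}W_{p,bc}(\nu^n,\nu)=0.$$ Let $\pi\in\Pi_\bullet(\mu,\nu)$. Then there exist $\pi^n\in\Pi_\bullet(\mu,\nu)$, $n\in\mathbb N$, such that $\lim_{n\to\infty}W_{p,c}(\pi,\pi^n)=0$ and there are constants $C_n>0$ such that $\frac{d\pi^n}{dP}\le C_n$ holds $P$-almost surely (in particular $\pi^n\ll P$).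
   Context: $N\in\mathbb N$ is the number of time steps; $\mathcal X=\mathcal X_1\times\dots\times\mathcal X_N$ and $\mathcal Y=\mathcal Y_1\times\dots\times\mathcal Y_N$ are products of Polish spaces, with metrics $d_{\mathcal X},d_{\mathcal Y}$ inducing their topologies. $\mathcal P_p(\mathcal X)$ is the set of Borel probability measures with finite $p$-th moment $\int d_{\mathcal X}(\hat x,x)^p\,\mu(dx)$. $X_t,Y_t$ are coordinate projections, $X_{1:t}=(X_1,\dots,X_t)$, etc. $\Pi(\mu,\nu)$ is the set of couplings. A measure $\pi\in\mathcal P(\mathcal X\times\mathcal Y)$ is causal if under $\pi$, for all $t=1,\dots,N-1$, $X_{t+1}$ is conditionally independent of $Y_{1:t}$ given $X_{1:t}$; anticausal if for all such $t$, $Y_{t+1}$ is conditionally independent of $X_{1:t}$ given $Y_{1:t}$; bicausal if both. $\Pi_c,\Pi_{ac},\Pi_{bc}$ are the corresponding subsets of $\Pi(\mu,\nu)$; $\Pi_\bullet$ is any of $\Pi,\Pi_c,\Pi_{ac},\Pi_{bc}$. $W_{p,bc}(\mu,\tilde\mu)^p=\inf_{\pi\in\Pi_{bc}(\mu,\tilde\mu)}\int d_{\mathcal X}^p\,d\pi$ (similarly on $\mathcal Y$); for $\pi,\tilde\pi\in\mathcal P(\mathcal X\times\mathcal Y)$, $W_{p,c}(\pi,\tilde\pi)^p=\inf_{\theta\in\Pi_c(\pi,\tilde\pi)}\int d_{\mathcal X}(x,\tilde x)^p+d_{\mathcal Y}(y,\tilde y)^p\,d\theta$, where for causality of $\theta$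 the space $\mathcal X\times\mathcal Y$ is regarded as a single path space with time-$t$ component $\mathcal X_t\times\mathcal Y_t$. *)

theory Defs
  imports "HOL-Probability.Probability"
begin

definition polish_topology :: "'a topology \<Rightarrow> bool" where
  "polish_topology T \<longleftrightarrow> completely_metrizable_space T \<and> separable_space T"

definition metrizes :: "'a topology \<Rightarrow> ('a \<Rightarrow> 'a \<Rightarrow> real) \<Rightarrow> bool" where
  "metrizes T d \<longleftrightarrow>
     Metric_space (topspace T) d \<and> Metric_space.mtopology (topspace T) d = T"

definition borel_of :: "'a topology \<Rightarrow> 'a measure" where
  "borel_of T = sigma (topspace T) {U. openin T U}"

text \<open>The factors of a path space are topologies \<open>X 1, \<dots>, X N\<close> on subsets of one common
  type; this lets them be arbitrary, pairwise different Polish spaces. A path is an extensional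
  function on \<open>{1..N}\<close>.\<close>

definition path_topology :: "nat \<Rightarrow> (nat \<Rightarrow> 'a topology) \<Rightarrow> (nat \<Rightarrow> 'a) topology" where
  "path_topology N X = product_topology X {1..N}"

definition borel_probs :: "'x topology \<Rightarrow> 'x measure set" where
  "borel_probs T = {M. prob_space M \<and> sets M = sets (borel_of T)}"

definition borel_probs_moment ::
  "real \<Rightarrow> 'x topology \<Rightarrow> ('x \<Rightarrow> 'x \<Rightarrow> real) \<Rightarrow> 'x measure set" where
  "borel_probs_moment p T d =
     {M \<in> borel_probs T. \<exists>x0\<in>topspace T. (\<integral>\<^sup>+ x. ennreal (d x0 x powr p) \<partial>M) < \<infinity>}"

definition finitely_supported :: "'x measure \<Rightarrow> bool" where
  "finitely_supported M \<longleftrightarrow> (\<exists>F. finite F \<and> F \<subseteq> space M \<and> (AE x in M. x \<in> F))"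

text \<open>\<open>A\<close> and \<open>B\<close> are conditionally independent given \<open>C\<close> under \<open>M\<close>, where \<open>A\<close>, \<open>B\<close>, \<open>C\<close> take
  values in \<open>S\<close>, \<open>T\<close>, \<open>R\<close>.\<close>

definition cond_indep_var ::
  "'w measure \<Rightarrow> 'a measure \<Rightarrow> ('w \<Rightarrow> 'a) \<Rightarrow> 'b measure \<Rightarrow> ('w \<Rightarrow> 'b) \<Rightarrow>
   'c measure \<Rightarrow> ('w \<Rightarrow> 'c) \<Rightarrow> bool" where
  "cond_indep_var M S A T B R C \<longleftrightarrow>
     A \<in> measurable M S \<and> B \<in> measurable M T \<and> C \<in> measurable M R \<and>
     (\<forall>a\<in>sets S. \<forall>b\<in>sets T.
        let G = vimage_algebra (space M) C R in
        AE w in M.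
          real_cond_exp M G (indicator (A -` a \<inter> B -` b)) w =
          real_cond_exp M G (indicator (A -` a)) w * real_cond_exp M G (indicator (B -` b)) w)"

text \<open>Causality is used both for path spaces and for \<open>\<X> \<times> \<Y>\<close> regarded as a single path space.
  To cover both, a space of paths \<open>'x\<close> is described by the topologies \<open>X t\<close> of its components
  together with the maps \<open>cX t\<close> that give the time-\<open>t\<close> component of a path.\<close>

definition past :: "(nat \<Rightarrow> 'x \<Rightarrow> 'a) \<Rightarrow> nat \<Rightarrow> 'x \<Rightarrow> (nat \<Rightarrow> 'a)" where
  "past cX t x = (\<lambda>s\<in>{1..t}. cX s x)"

definition past_space :: "(nat \<Rightarrow> 'a topology) \<Rightarrow> nat \<Rightarrow> (nat \<Rightarrow> 'a) measure" where
  "past_space X t = PiM {1..t} (\<lambda>s. borel_of (X s))"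

definition causal ::
  "nat \<Rightarrow> (nat \<Rightarrow> 'a topology) \<Rightarrow> (nat \<Rightarrow> 'x \<Rightarrow> 'a) \<Rightarrow> (nat \<Rightarrow> 'b topology) \<Rightarrow>
   (nat \<Rightarrow> 'y \<Rightarrow> 'b) \<Rightarrow> ('x \<times> 'y) measure \<Rightarrow> bool" where
  "causal N X cX Y cY \<pi> \<longleftrightarrow>
     (\<forall>t\<in>{1..<N}.
        cond_indep_var \<pi>
          (borel_of (X (t + 1))) (\<lambda>w. cX (t + 1) (fst w))
          (past_space Y t) (\<lambda>w. past cY t (snd w))
          (past_space X t) (\<lambda>w. past cX t (fst w)))"

definition anticausal ::
  "nat \<Rightarrow> (nat \<Rightarrow> 'a topology) \<Rightarrow> (nat \<Rightarrow> 'x \<Rightarrow> 'a) \<Rightarrow> (nat \<Rightarrow> 'b topology) \<Rightarrow>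
   (nat \<Rightarrow> 'y \<Rightarrow> 'b) \<Rightarrow> ('x \<times> 'y) measure \<Rightarrow> bool" where
  "anticausal N X cX Y cY \<pi> \<longleftrightarrow>
     (\<forall>t\<in>{1..<N}.
        cond_indep_var \<pi>
          (borel_of (Y (t + 1))) (\<lambda>w. cY (t + 1) (snd w))
          (past_space X t) (\<lambda>w. past cX t (fst w))
          (past_space Y t) (\<lambda>w. past cY t (snd w)))"

datatype version = Regular | Causal | Anticausal | Bicausal

fun version_constraint ::
  "version \<Rightarrow> nat \<Rightarrow> (nat \<Rightarrow> 'a topology) \<Rightarrow> (nat \<Rightarrow> 'x \<Rightarrow> 'a) \<Rightarrow> (nat \<Rightarrow> 'b topology) \<Rightarrow>
   (nat \<Rightarrow> 'y \<Rightarrow> 'b) \<Rightarrow> ('x \<times> 'y) measure \<Rightarrow> bool" where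
  "version_constraint Regular N X cX Y cY \<pi> \<longleftrightarrow> True"
| "version_constraint Causal N X cX Y cY \<pi> \<longleftrightarrow> causal N X cX Y cY \<pi>"
| "version_constraint Anticausal N X cX Y cY \<pi> \<longleftrightarrow> anticausal N X cX Y cY \<pi>"
| "version_constraint Bicausal N X cX Y cY \<pi> \<longleftrightarrow>
     causal N X cX Y cY \<pi> \<and> anticausal N X cX Y cY \<pi>"

text \<open>The product sigma-algebra is used for couplings; it is the Borel sigma-algebra of the
  product topology because all spaces involved are second countable.\<close>

definition couplings :: "'x measure \<Rightarrow> 'y measure \<Rightarrow> ('x \<times> 'y) measure set" where
  "couplings \<mu> \<nu> =
     {\<pi>. prob_space \<pi> \<and> sets \<pi> = sets (\<mu> \<Otimes>\<^sub>M \<nu>) \<and> distr \<pi> \<mu> fst = \<mu> \<and> distr \<pi> \<nu> snd = \<nu>}"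

definition couplings_version ::
  "version \<Rightarrow> nat \<Rightarrow> (nat \<Rightarrow> 'a topology) \<Rightarrow> (nat \<Rightarrow> 'x \<Rightarrow> 'a) \<Rightarrow> (nat \<Rightarrow> 'b topology) \<Rightarrow>
   (nat \<Rightarrow> 'y \<Rightarrow> 'b) \<Rightarrow> 'x measure \<Rightarrow> 'y measure \<Rightarrow> ('x \<times> 'y) measure set" where
  "couplings_version v N X cX Y cY \<mu> \<nu> =
     {\<pi> \<in> couplings \<mu> \<nu>. version_constraint v N X cX Y cY \<pi>}"

definition coord :: "nat \<Rightarrow> (nat \<Rightarrow> 'a) \<Rightarrow> 'a" where
  "coord t x = x t"

definition coord_pair :: "nat \<Rightarrow> (nat \<Rightarrow> 'a) \<times> (nat \<Rightarrow> 'b) \<Rightarrow> 'a \<times> 'b" where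
  "coord_pair t z = (fst z t, snd z t)"

definition path_couplings ::
  "version \<Rightarrow> nat \<Rightarrow> (nat \<Rightarrow> 'a topology) \<Rightarrow> (nat \<Rightarrow> 'b topology) \<Rightarrow>
   (nat \<Rightarrow> 'a) measure \<Rightarrow> (nat \<Rightarrow> 'b) measure \<Rightarrow> ((nat \<Rightarrow> 'a) \<times> (nat \<Rightarrow> 'b)) measure set" where
  "path_couplings v N X Y \<mu> \<nu> = couplings_version v N X coord Y coord \<mu> \<nu>"

definition pair_path_couplings ::
  "version \<Rightarrow> nat \<Rightarrow> (nat \<Rightarrow> 'a topology) \<Rightarrow> (nat \<Rightarrow> 'b topology) \<Rightarrow>
   ((nat \<Rightarrow> 'a) \<times> (nat \<Rightarrow> 'b)) measure \<Rightarrow> ((nat \<Rightarrow> 'a) \<times> (nat \<Rightarrow> 'b)) measure \<Rightarrow>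
   (((nat \<Rightarrow> 'a) \<times> (nat \<Rightarrow> 'b)) \<times> ((nat \<Rightarrow> 'a) \<times> (nat \<Rightarrow> 'b))) measure set" where
  "pair_path_couplings v N X Y \<pi> \<pi>' =
     couplings_version v N (\<lambda>t. prod_topology (X t) (Y t)) coord_pair
       (\<lambda>t. prod_topology (X t) (Y t)) coord_pair \<pi> \<pi>'"

definition ennreal_root :: "real \<Rightarrow> ennreal \<Rightarrow> ennreal" where
  "ennreal_root p a = (if a = \<infinity> then \<infinity> else ennreal (enn2real a powr (1 / p)))"

definition W_bc ::
  "real \<Rightarrow> nat \<Rightarrow> (nat \<Rightarrow> 'a topology) \<Rightarrow> ((nat \<Rightarrow> 'a) \<Rightarrow> (nat \<Rightarrow> 'a) \<Rightarrow> real) \<Rightarrow>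
   (nat \<Rightarrow> 'a) measure \<Rightarrow> (nat \<Rightarrow> 'a) measure \<Rightarrow> ennreal" where
  "W_bc p N X dX \<mu> \<mu>' =
     ennreal_root p
       (INF \<pi> \<in> path_couplings Bicausal N X X \<mu> \<mu>'.
          \<integral>\<^sup>+ w. ennreal (dX (fst w) (snd w) powr p) \<partial>\<pi>)"

definition W_c ::
  "real \<Rightarrow> nat \<Rightarrow> (nat \<Rightarrow> 'a topology) \<Rightarrow> ((nat \<Rightarrow> 'a) \<Rightarrow> (nat \<Rightarrow> 'a) \<Rightarrow> real) \<Rightarrow>
   (nat \<Rightarrow> 'b topology) \<Rightarrow> ((nat \<Rightarrow> 'b) \<Rightarrow> (nat \<Rightarrow> 'b) \<Rightarrow> real) \<Rightarrow>
   ((nat \<Rightarrow> 'a) \<times> (nat \<Rightarrow> 'b)) measure \<Rightarrow> ((nat \<Rightarrow> 'a) \<times> (nat \<Rightarrow> 'b)) measure \<Rightarrow> ennreal" where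
  "W_c p N X dX Y dY \<pi> \<pi>' =
     ennreal_root p
       (INF \<theta> \<in> pair_path_couplings Causal N X Y \<pi> \<pi>'.
          \<integral>\<^sup>+ w. ennreal (dX (fst (fst w)) (fst (snd w)) powr p
                       + dY (snd (fst w)) (snd (snd w)) powr p) \<partial>\<theta>)"

end

theory Submission
  imports Defs
begin

text \<open>Let \<open>\<alpha>\<close> be a bicausal coupling of a finitely supported \<open>\<mu>'\<close> with \<open>\<mu>\<close>. Going from \<open>x\<close> to a discrete path
  according to \<open>\<alpha>\<close> and back to a fresh path \<open>x'\<close> is a transition with density
  \<open>K x x' = (\<Sum>f. w f x * w f x' / \<mu>' {f})\<close> with respect to \<open>\<mu>\<close>, where \<open>w f x\<close> is the conditional probability of the
  discrete path \<open>f\<close> given \<open>x\<close>. Since the discrete path takes finitely many values, \<open>w f\<close> is a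
  Radon-Nikodym density and no disintegration is needed. The kernel \<open>K\<close> is symmetric, bounded and
  Markov, and bicausality of \<open>\<alpha>\<close> makes the induced operator map functions of the past up to time \<open>t\<close> to
  such functions. Let \<open>L\<close> be the analogous kernel for \<open>\<nu>\<close>. Moving \<open>(x, y)\<close>, distributed according to
  \<open>\<pi>\<close>, by \<open>K\<close> and \<open>L\<close> independently gives \<open>(x', y')\<close> whose law has a bounded density with respect to
  \<open>\<mu> \<otimes> \<nu>\<close>, inherits (anti)causality from \<open>\<pi>\<close>, and the joint law of \<open>(x, y)\<close> and \<open>(x', y')\<close> is a causal
  coupling. By the triangle inequality through the discrete path, its cost is at most a constant times
  the costs of the two discretisations.\<close>

section \<open>Borel sets of product topologies\<close>

text \<open>Causality is a one-step condition stated through \<open>real_cond_exp\<close>, whereas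
  the argument composes several averaging steps on whole paths. Conditional expectations are
  therefore represented by functions of the conditioning variable, characterised by integrals
  against nonnegative test functions; in this form they compose by Tonelli. The two halves of
  bicausality do different work. Causality of \<alpha> makes the mean of a function of the past of
  x, given the discrete path, depend on the past of that path only. Anticausality makes the
  probability of a discrete past, given x, depend on the past of x only. Symmetry of K transfers
  causality from \<pi>: an event in the past of y' becomes a function of the past of y by L, then of
  the past of x by causality of \<pi>, and finally of the past of x', because K can be moved from
  the test function to the weight. Symmetry and the Markov property together make \<mu> invariant,
  so the marginals survive. The joint law is causal because, given (x, y), the moves to x' and y'
  are independent, and the probability of a rectangle in their pasts is a function of the past of x
  times a function of the past of y.\<close>

lemma space_borel_of [simp]: "space (borel_of T) = topspace T"
  by (simp add: borel_of_def space_measure_of_conv)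

lemma sets_borel_of: "sets (borel_of T) = sigma_sets (topspace T) {U. openin T U}"
  unfolding borel_of_def by (rule sets_measure_of) (auto dest: openin_subset)

lemma openin_in_sets_borel_of: "openin T U \<Longrightarrow> U \<in> sets (borel_of T)"
  by (simp add: sets_borel_of sigma_sets.Basic)

lemma closedin_in_sets_borel_of:
  assumes "closedin T U"
  shows "U \<in> sets (borel_of T)"
proof -
  have "topspace T - (topspace T - U) \<in> sets (borel_of T)"
    using assms sets.compl_sets[OF openin_in_sets_borel_of, of T "topspace T - U"]
    by (simp add: openin_diff)
  then show ?thesis
    using assms by (simp add: closedin_subset double_diff)
qed

lemma continuous_map_measurable_borel_of:
  assumes "continuous_map S T f"
  shows "f \<in> borel_of S \<rightarrow>\<^sub>M borel_of T"
proof (rule measurable_sigma_sets[OF sets_borel_of])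
  show "{U. openin T U} \<subseteq> Pow (topspace T)"
    by (auto dest: openin_subset)
  show "f \<in> space (borel_of S) \<rightarrow> topspace T"
    using assms by (simp add: continuous_map_def)
  show "f -` U \<inter> space (borel_of S) \<in> sets (borel_of S)" if "U \<in> {U. openin T U}" for U
  proof -
    have "f -` U \<inter> topspace S = {x \<in> topspace S. f x \<in> U}"
      by auto
    then show ?thesis
      using that openin_continuous_map_preimage[OF assms] by (auto intro: openin_in_sets_borel_of)
  qed
qed

lemma borel_of_euclideanreal: "borel_of euclideanreal = borel"
  by (simp add: borel_of_def borel_def)

text \<open>An open set is the union of the members of \<open>\<B>\<close> inside it, and
  countability keeps this union in \<open>M\<close>. Members need only be measurable for
  \<open>M\<close>, so \<open>\<B>\<close> may consist of boxes.\<close>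

lemma sets_borel_of_subset_of_countable_base:
  assumes "countable \<B>" "\<And>V. V \<in> \<B> \<Longrightarrow> V \<in> sets M" "space M = topspace T"
    and base: "\<And>U x. openin T U \<Longrightarrow> x \<in> U \<Longrightarrow> \<exists>V\<in>\<B>. x \<in> V \<and> V \<subseteq> U"
  shows "sets (borel_of T) \<subseteq> sets M"
proof -
  have "U \<in> sets M" if "openin T U" for U
  proof -
    have "U = \<Union>{V \<in> \<B>. V \<subseteq> U}"
      using base[OF that] by blast
    moreover have "\<Union>{V \<in> \<B>. V \<subseteq> U} \<in> sets M"
      using assms(1,2) by (intro sets.countable_Union) auto
    ultimately show ?thesis by simp
  qed
  then show ?thesis
    unfolding sets_borel_of assms(3)[symmetric] by (intro sets.sigma_sets_subset) auto
qed

lemma sets_subset_of_measurable_ident: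
  assumes "(\<lambda>x. x) \<in> M \<rightarrow>\<^sub>M N" "space M = space N"
  shows "sets N \<subseteq> sets M"
proof
  fix A assume "A \<in> sets N"
  then show "A \<in> sets M"
    using measurable_sets[OF assms(1), of A] assms(2) by (simp add: sets.sets_into_space Int_absorb2)
qed

section \<open>Second countability of Polish spaces and Borel sets of their finite products\<close>

lemma metrizable_separable_imp_second_countable:
  assumes "metrizable_space T" "separable_space T"
  shows "second_countable T"
proof -
  obtain M d where Md: "Metric_space M d" and T: "T = Metric_space.mtopology M d"
    using assms(1) by (auto simp: metrizable_space_def)
  interpret Metric_space M d by fact
  obtain C where C: "countable C" "C \<subseteq> M" "mtopology closure_of C = M"
    using assms(2) by (auto simp: separable_space_def T)
  define \<B> where "\<B> = (\<lambda>(c, n::nat). mball c (inverse (Suc n))) ` (C \<times> UNIV)"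
  have "\<exists>V\<in>\<B>. x \<in> V \<and> V \<subseteq> U" if U: "openin mtopology U" "x \<in> U" for U x
  proof -
    obtain r where r: "r > 0" "mball x r \<subseteq> U" and xM: "x \<in> M"
      using U unfolding openin_mtopology by blast
    \<comment> \<open>With radius below \<open>r / 2\<close>, a ball around \<open>c\<close> that
      contains \<open>x\<close> has all its points within distance \<open>r\<close> of
      \<open>x\<close>.\<close>
    obtain n where n: "inverse (real (Suc n)) < r / 2"
      using reals_Archimedean[of "r / 2"] r by auto
    have "x \<in> mtopology closure_of C"
      using C(3) xM by simp
    then have "\<forall>r>0. \<exists>y\<in>C. y \<in> mball x r"
      unfolding metric_closure_of by blast
    moreover have "0 < inverse (real (Suc n))"
      by simp
    ultimately obtain c where c: "c \<in> C" "c \<in> mball x (inverse (Suc n))"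
      by blast
    have "x \<in> mball c (inverse (Suc n))"
      using c(2) by (auto simp: in_mball commute)
    moreover have "mball c (inverse (Suc n)) \<subseteq> mball x r"
    proof
      fix y assume "y \<in> mball c (inverse (Suc n))"
      then have "y \<in> M" "c \<in> M" "d c y < r / 2" using n by (auto simp: in_mball)
      moreover have "d x c < r / 2" using c n by (auto simp: in_mball)
      ultimately show "y \<in> mball x r"
        using triangle[of x c y] xM by (auto simp: in_mball)
    qed
    ultimately show ?thesis
      using c(1) r(2) unfolding \<B>_def by (intro bexI[of _ "mball c (inverse (Suc n))"]) auto
  qed
  moreover have "countable \<B>"
    unfolding \<B>_def using C(1) by auto
  moreover have "\<forall>V\<in>\<B>. openin mtopology V"
    unfolding \<B>_def by auto
  ultimately show ?thesis
    unfolding second_countable_def T by blast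
qed

lemma polish_topology_imp_second_countable: "polish_topology T \<Longrightarrow> second_countable T"
  by (simp add: polish_topology_def completely_metrizable_imp_metrizable_space
      metrizable_separable_imp_second_countable)

lemma closedin_singleton_of_polish_topology:
  "polish_topology T \<Longrightarrow> x \<in> topspace T \<Longrightarrow> closedin T {x}"
  by (meson closedin_Hausdorff_singleton completely_metrizable_imp_metrizable_space
      metrizable_imp_Hausdorff_space polish_topology_def)

text \<open>Continuity of the projections gives one inclusion for all spaces. The other uses
  countable bases, since an open set must be a countable union of rectangles.\<close>

lemma sets_borel_of_prod_topology:
  assumes "second_countable S" "second_countable T"
  shows "sets (borel_of (prod_topology S T)) = sets (borel_of S \<Otimes>\<^sub>M borel_of T)"
proof
  obtain \<A> where \<A>: "countable \<A>" "\<forall>V\<in>\<A>. openin S V"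
    "\<And>U x. openin S U \<Longrightarrow> x \<in> U \<Longrightarrow> \<exists>V\<in>\<A>. x \<in> V \<and> V \<subseteq> U"
    using assms(1) unfolding second_countable_def by auto
  obtain \<B> where \<B>: "countable \<B>" "\<forall>V\<in>\<B>. openin T V"
    "\<And>U x. openin T U \<Longrightarrow> x \<in> U \<Longrightarrow> \<exists>V\<in>\<B>. x \<in> V \<and> V \<subseteq> U"
    using assms(2) unfolding second_countable_def by auto
  show "sets (borel_of (prod_topology S T)) \<subseteq> sets (borel_of S \<Otimes>\<^sub>M borel_of T)"
  proof (rule sets_borel_of_subset_of_countable_base)
    show "countable ((\<lambda>(A, B). A \<times> B) ` (\<A> \<times> \<B>))"
      using \<A>(1) \<B>(1) by auto
    show "\<And>V. V \<in> (\<lambda>(A, B). A \<times> B) ` (\<A> \<times> \<B>) \<Longrightarrow> V \<in> sets (borel_of S \<Otimes>\<^sub>M borel_of T)"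
      using \<A>(2) \<B>(2) by (auto intro!: pair_measureI openin_in_sets_borel_of)
    show "space (borel_of S \<Otimes>\<^sub>M borel_of T) = topspace (prod_topology S T)"
      by (simp add: space_pair_measure)
    show "\<exists>V\<in>(\<lambda>(A, B). A \<times> B) ` (\<A> \<times> \<B>). x \<in> V \<and> V \<subseteq> U"
      if U: "openin (prod_topology S T) U" "x \<in> U" for U x
    proof -
      obtain V W where VW: "openin S V" "openin T W" "fst x \<in> V" "snd x \<in> W" "V \<times> W \<subseteq> U"
        using U unfolding openin_prod_topology_alt by (metis prod.collapse)
      obtain A B where "A \<in> \<A>" "fst x \<in> A" "A \<subseteq> V" "B \<in> \<B>" "snd x \<in> B" "B \<subseteq> W"
        using \<A>(3)[OF VW(1,3)] \<B>(3)[OF VW(2,4)] by blast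
      then show ?thesis
        using VW(5) by (intro bexI[of _ "A \<times> B"]) (auto simp: mem_Times_iff)
    qed
  qed
  have "(\<lambda>z. z) \<in> borel_of (prod_topology S T) \<rightarrow>\<^sub>M borel_of S \<Otimes>\<^sub>M borel_of T"
    by (intro measurable_pair)
       (auto simp: comp_def intro!: continuous_map_measurable_borel_of continuous_map_fst continuous_map_snd)
  then show "sets (borel_of S \<Otimes>\<^sub>M borel_of T) \<subseteq> sets (borel_of (prod_topology S T))"
    by (rule sets_subset_of_measurable_ident) (simp add: space_pair_measure)
qed

text \<open>Choosing in every coordinate a member of a countable base leaves countably many boxes
  because \<open>I\<close> is finite. The shape of the members is recorded since it makes them both
  open and measurable.\<close>

lemma countable_base_product_topology:
  assumes "finite I" "\<And>i. i \<in> I \<Longrightarrow> second_countable (X i)"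
  obtains \<B> where "countable \<B>"
    "\<And>V. V \<in> \<B> \<Longrightarrow> \<exists>W. V = Pi\<^sub>E I W \<and> (\<forall>i\<in>I. openin (X i) (W i))"
    "\<And>U x. openin (product_topology X I) U \<Longrightarrow> x \<in> U \<Longrightarrow> \<exists>V\<in>\<B>. x \<in> V \<and> V \<subseteq> U"
proof -
  have "\<forall>i\<in>I. \<exists>\<A>. countable \<A> \<and> (\<forall>V\<in>\<A>. openin (X i) V) \<and>
      (\<forall>U x. openin (X i) U \<and> x \<in> U \<longrightarrow> (\<exists>V\<in>\<A>. x \<in> V \<and> V \<subseteq> U))"
    using assms(2) unfolding second_countable_def by simp
  then obtain \<A> where \<A>: "\<And>i. i \<in> I \<Longrightarrow> countable (\<A> i)" "\<And>i V. i \<in> I \<Longrightarrow> V \<in> \<A> i \<Longrightarrow> openin (X i) V"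
    "\<And>i U x. i \<in> I \<Longrightarrow> openin (X i) U \<Longrightarrow> x \<in> U \<Longrightarrow> \<exists>V\<in>\<A> i. x \<in> V \<and> V \<subseteq> U"
    unfolding bchoice_iff by metis
  show ?thesis
  proof (rule that[of "Pi\<^sub>E I ` (Pi\<^sub>E I \<A>)"])
    show "countable (Pi\<^sub>E I ` Pi\<^sub>E I \<A>)"
      using assms(1) \<A>(1) by (intro countable_image countable_PiE)
    show "\<exists>W. V = Pi\<^sub>E I W \<and> (\<forall>i\<in>I. openin (X i) (W i))" if "V \<in> Pi\<^sub>E I ` Pi\<^sub>E I \<A>" for V
      using that \<A>(2) by (auto simp: PiE_iff)
    show "\<exists>V\<in>Pi\<^sub>E I ` Pi\<^sub>E I \<A>. x \<in> V \<and> V \<subseteq> U"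
      if U: "openin (product_topology X I) U" "x \<in> U" for U x
    proof -
      obtain V where V: "\<forall>i\<in>I. openin (X i) (V i)" "x \<in> Pi\<^sub>E I V" "Pi\<^sub>E I V \<subseteq> U"
        using U unfolding openin_product_topology_alt by blast
      have "\<forall>i\<in>I. \<exists>W\<in>\<A> i. x i \<in> W \<and> W \<subseteq> V i"
        using V \<A>(3) by (simp add: PiE_mem)
      then obtain W where W: "\<And>i. i \<in> I \<Longrightarrow> W i \<in> \<A> i" "\<And>i. i \<in> I \<Longrightarrow> x i \<in> W i"
        "\<And>i. i \<in> I \<Longrightarrow> W i \<subseteq> V i"
        unfolding bchoice_iff by metis
      have eq: "Pi\<^sub>E I W = Pi\<^sub>E I (restrict W I)"
        by (intro PiE_cong) simp
      have "restrict W I \<in> Pi\<^sub>E I \<A>"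
        using W(1) by simp
      with eq have "Pi\<^sub>E I W \<in> Pi\<^sub>E I ` (Pi\<^sub>E I \<A>)"
        by (rule image_eqI)
      moreover have "x \<in> Pi\<^sub>E I W"
        using W(2) V(2) by (simp add: PiE_iff)
      moreover have "Pi\<^sub>E I W \<subseteq> U"
        using PiE_mono[of I W V, OF W(3)] V(3) by (rule order_trans)
      ultimately show ?thesis by (intro bexI conjI)
    qed
  qed
qed

lemma second_countable_product_topology:
  assumes "finite I" "\<And>i. i \<in> I \<Longrightarrow> second_countable (X i)"
  shows "second_countable (product_topology X I)"
proof -
  obtain \<B> where \<B>: "countable \<B>"
    "\<And>V. V \<in> \<B> \<Longrightarrow> \<exists>W. V = Pi\<^sub>E I W \<and> (\<forall>i\<in>I. openin (X i) (W i))"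
    "\<And>U x. openin (product_topology X I) U \<Longrightarrow> x \<in> U \<Longrightarrow> \<exists>V\<in>\<B>. x \<in> V \<and> V \<subseteq> U"
    by (rule countable_base_product_topology[where I=I and X=X, OF assms]) auto
  have "openin (product_topology X I) V" if "V \<in> \<B>" for V
    using \<B>(2)[OF that] assms(1) by (auto simp: openin_PiE_gen)
  with \<B>(1,3) show ?thesis
    unfolding second_countable_def by blast
qed

lemma sets_borel_of_product_topology:
  assumes "finite I" "\<And>i. i \<in> I \<Longrightarrow> second_countable (X i)"
  shows "sets (borel_of (product_topology X I)) = sets (PiM I (\<lambda>i. borel_of (X i)))"
proof
  obtain \<B> where \<B>: "countable \<B>"
    "\<And>V. V \<in> \<B> \<Longrightarrow> \<exists>W. V = Pi\<^sub>E I W \<and> (\<forall>i\<in>I. openin (X i) (W i))"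
    "\<And>U x. openin (product_topology X I) U \<Longrightarrow> x \<in> U \<Longrightarrow> \<exists>V\<in>\<B>. x \<in> V \<and> V \<subseteq> U"
    by (rule countable_base_product_topology[where I=I and X=X, OF assms]) auto
  have "V \<in> sets (PiM I (\<lambda>i. borel_of (X i)))" if "V \<in> \<B>" for V
    using \<B>(2)[OF that] assms(1) by (auto intro!: sets_PiM_I_finite openin_in_sets_borel_of)
  then show "sets (borel_of (product_topology X I)) \<subseteq> sets (PiM I (\<lambda>i. borel_of (X i)))"
    using \<B>(1,3) by (intro sets_borel_of_subset_of_countable_base[of \<B>]) (auto simp: space_PiM)
  have "(\<lambda>x. x) \<in> borel_of (product_topology X I) \<rightarrow>\<^sub>M PiM I (\<lambda>i. borel_of (X i))"
  proof (rule measurable_PiM_single)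
    show "(\<lambda>x. x) \<in> space (borel_of (product_topology X I)) \<rightarrow> (\<Pi>\<^sub>E i\<in>I. space (borel_of (X i)))"
      by simp
    fix A i assume i: "i \<in> I" and A: "A \<in> sets (borel_of (X i))"
    have "(\<lambda>x. x i) \<in> borel_of (product_topology X I) \<rightarrow>\<^sub>M borel_of (X i)"
      using i by (intro continuous_map_measurable_borel_of continuous_map_product_projection)
    from measurable_sets[OF this A]
    show "{x \<in> space (borel_of (product_topology X I)). x i \<in> A} \<in> sets (borel_of (product_topology X I))"
      by (simp add: vimage_def Int_def conj_commute)
  qed
  then show "sets (PiM I (\<lambda>i. borel_of (X i))) \<subseteq> sets (borel_of (product_topology X I))"
    by (rule sets_subset_of_measurable_ident) (simp add: space_PiM)
qed

lemma (in Metric_space) continuous_map_dist: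
  "continuous_map (prod_topology mtopology mtopology) euclideanreal (\<lambda>z. d (fst z) (snd z))"
proof -
  have "continuous_map (mtopology_of (prod_metric (metric (M,d)) (metric (M,d))))
          (mtopology_of euclidean_metric) (\<lambda>(x,y). mdist (metric (M,d)) x y)"
    by (intro Lipschitz_continuous_imp_continuous_map Lipschitz_continuous_map_metric)
  then show ?thesis
    by (simp add: case_prod_beta')
qed

lemma metrizes_borel_measurable:
  assumes "metrizes T d" "second_countable T"
  shows "(\<lambda>z. d (fst z) (snd z)) \<in> borel_measurable (borel_of T \<Otimes>\<^sub>M borel_of T)"
proof -
  interpret Metric_space "topspace T" d
    using assms(1) by (simp add: metrizes_def)
  have "continuous_map (prod_topology mtopology mtopology) euclideanreal (\<lambda>z. d (fst z) (snd z))"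
    using continuous_map_dist .
  then show ?thesis
    using assms continuous_map_measurable_borel_of[of "prod_topology T T" euclideanreal]
    by (simp add: metrizes_def borel_of_euclideanreal
        measurable_cong_sets[OF sets_borel_of_prod_topology[OF assms(2) assms(2)] refl])
qed

section \<open>Conditional independence\<close>

text \<open>\<open>h\<close> is the Radon-Nikodym derivative of the image of
  \<open>density M f\<close> under \<open>C\<close> with respect to the image of \<open>M\<close>.
  Working on \<open>R\<close> gives the conditional expectation directly as a function of
  \<open>C\<close>, without factorising a function measurable for the generated
  sigma-algebra.\<close>

lemma nn_cond_exp_given_map:
  fixes f :: "'a \<Rightarrow> ennreal"
  assumes "finite_measure M" and [measurable]: "C \<in> M \<rightarrow>\<^sub>M R" "f \<in> borel_measurable M"
  obtains h where "h \<in> borel_measurable R"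
    "\<And>k. k \<in> borel_measurable R \<Longrightarrow> (\<integral>\<^sup>+ w. f w * k (C w) \<partial>M) = (\<integral>\<^sup>+ w. h (C w) * k (C w) \<partial>M)"
proof -
  interpret M: finite_measure M by fact
  interpret D: finite_measure "distr M R C"
    by (rule M.finite_measure_distr) simp
  have "absolutely_continuous (distr M R C) (distr (density M f) R C)"
    unfolding absolutely_continuous_def
  proof
    fix c assume c: "c \<in> null_sets (distr M R C)"
    then have "C -` c \<inter> space M \<in> null_sets M"
      by (auto simp: null_sets_def emeasure_distr)
    then have "C -` c \<inter> space M \<in> null_sets (density M f)"
      using absolutely_continuousI_density[of f M] by (auto simp: absolutely_continuous_def)
    then show "c \<in> null_sets (distr (density M f) R C)"
      using c by (auto simp: null_sets_def emeasure_distr)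
  qed
  from D.Radon_Nikodym[OF this] obtain h where h: "h \<in> borel_measurable R"
    and eq: "density (distr M R C) h = distr (density M f) R C"
    by auto
  show ?thesis
  proof (rule that[OF h])
    fix k :: "_ \<Rightarrow> ennreal" assume [measurable]: "k \<in> borel_measurable R"
    have "(\<integral>\<^sup>+ w. f w * k (C w) \<partial>M) = (\<integral>\<^sup>+ c. k c \<partial>distr (density M f) R C)"
      by (simp add: nn_integral_distr nn_integral_density)
    also have "\<dots> = (\<integral>\<^sup>+ w. h (C w) * k (C w) \<partial>M)"
      using h by (simp add: eq[symmetric] nn_integral_distr nn_integral_density)
    finally show "(\<integral>\<^sup>+ w. f w * k (C w) \<partial>M) = (\<integral>\<^sup>+ w. h (C w) * k (C w) \<partial>M)" .
  qed
qed

lemma finite_measure_pair_eqI: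
  assumes "finite_measure P" "sets P = sets (S \<Otimes>\<^sub>M T)" "sets Q = sets (S \<Otimes>\<^sub>M T)"
    and eq: "\<And>a b. a \<in> sets S \<Longrightarrow> b \<in> sets T \<Longrightarrow> emeasure P (a \<times> b) = emeasure Q (a \<times> b)"
  shows "P = Q"
proof (rule measure_eqI_generator_eq[OF Int_stable_pair_measure_generator pair_measure_closed])
  show "range (\<lambda>i. space S \<times> space T) \<subseteq> {a \<times> b |a b. a \<in> sets S \<and> b \<in> sets T}"
    by auto
  show "emeasure P (space S \<times> space T) \<noteq> \<infinity>"
    using finite_measure.emeasure_finite[OF assms(1)] by simp
qed (use assms in \<open>auto simp: sets_pair_measure\<close>)

text \<open>Weighting \<open>M\<close> by \<open>f\<close> or \<open>g\<close> and projecting by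
  \<open>(B, C)\<close> gives two measures that agree on rectangles. Rectangles are stable under
  intersection and generate, and \<open>fin\<close> supplies the finiteness that uniqueness
  needs.\<close>

lemma nn_integral_eq_of_rectangles:
  fixes f g :: "'a \<Rightarrow> ennreal"
  assumes [measurable]: "f \<in> borel_measurable M" "g \<in> borel_measurable M" "B \<in> M \<rightarrow>\<^sub>M T" "C \<in> M \<rightarrow>\<^sub>M R"
    and fin: "(\<integral>\<^sup>+ w. f w \<partial>M) < \<infinity>"
    and eq: "\<And>b c. b \<in> sets T \<Longrightarrow> c \<in> sets R \<Longrightarrow>
      (\<integral>\<^sup>+ w. f w * indicator b (B w) * indicator c (C w) \<partial>M) =
      (\<integral>\<^sup>+ w. g w * indicator b (B w) * indicator c (C w) \<partial>M)"
    and k: "k \<in> borel_measurable (T \<Otimes>\<^sub>M R)"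
  shows "(\<integral>\<^sup>+ w. f w * k (B w, C w) \<partial>M) = (\<integral>\<^sup>+ w. g w * k (B w, C w) \<partial>M)"
proof -
  let ?D = "\<lambda>f. distr (density M f) (T \<Otimes>\<^sub>M R) (\<lambda>w. (B w, C w))"
  have rect: "emeasure (?D f) (b \<times> c) = (\<integral>\<^sup>+ w. f w * indicator b (B w) * indicator c (C w) \<partial>M)"
    if "f \<in> borel_measurable M" "b \<in> sets T" "c \<in> sets R" for f b c
  proof -
    have [measurable]: "f \<in> borel_measurable M" "b \<in> sets T" "c \<in> sets R" by fact+
    have "emeasure (?D f) (b \<times> c) = (\<integral>\<^sup>+ z. indicator (b \<times> c) z \<partial>?D f)"
      by simp
    also have "\<dots> = (\<integral>\<^sup>+ w. f w * indicator (b \<times> c) (B w, C w) \<partial>M)"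
      by (subst nn_integral_distr) (auto simp: nn_integral_density)
    finally show ?thesis
      by (simp add: indicator_times mult.assoc)
  qed
  have "?D f = ?D g"
  proof (rule finite_measure_pair_eqI)
    have "finite_measure (density M f)"
      using fin by (intro finite_measureI) (simp add: emeasure_density cong: nn_integral_cong_simp)
    then show "finite_measure (?D f)"
      by (rule finite_measure.finite_measure_distr) simp
  qed (auto simp: rect eq)
  then have "(\<integral>\<^sup>+ z. k z \<partial>?D f) = (\<integral>\<^sup>+ z. k z \<partial>?D g)"
    by simp
  then show ?thesis
    using k by (simp add: nn_integral_distr nn_integral_density)
qed

text \<open>The same uniqueness argument on a finite product space, with boxes as the
  generator.\<close>

lemma nn_integral_eq_of_boxes:
  fixes f g :: "'a \<Rightarrow> ennreal"
  assumes [measurable]: "f \<in> borel_measurable M" "g \<in> borel_measurable M" "C \<in> M \<rightarrow>\<^sub>M PiM I S"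
    and "finite I" and fin: "(\<integral>\<^sup>+ w. f w \<partial>M) < \<infinity>"
    and eq: "\<And>A. (\<And>i. i \<in> I \<Longrightarrow> A i \<in> sets (S i)) \<Longrightarrow>
      (\<integral>\<^sup>+ w. f w * indicator (Pi\<^sub>E I A) (C w) \<partial>M) = (\<integral>\<^sup>+ w. g w * indicator (Pi\<^sub>E I A) (C w) \<partial>M)"
    and k: "k \<in> borel_measurable (PiM I S)"
  shows "(\<integral>\<^sup>+ w. f w * k (C w) \<partial>M) = (\<integral>\<^sup>+ w. g w * k (C w) \<partial>M)"
proof -
  let ?D = "\<lambda>f. distr (density M f) (PiM I S) C"
  have box: "emeasure (?D f) c = (\<integral>\<^sup>+ w. f w * indicator c (C w) \<partial>M)"
    if "f \<in> borel_measurable M" "c \<in> sets (PiM I S)" for f c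
  proof -
    have [measurable]: "f \<in> borel_measurable M" "c \<in> sets (PiM I S)" by fact+
    have "emeasure (?D f) c = (\<integral>\<^sup>+ z. indicator c z \<partial>?D f)"
      by simp
    also have "\<dots> = (\<integral>\<^sup>+ w. f w * indicator c (C w) \<partial>M)"
      by (subst nn_integral_distr) (auto simp: nn_integral_density)
    finally show ?thesis .
  qed
  have "?D f = ?D g"
  proof (rule measure_eqI_PiM_finite[OF \<open>finite I\<close>])
    show "emeasure (?D f) (Pi\<^sub>E I A) = emeasure (?D g) (Pi\<^sub>E I A)" if "\<And>i. i \<in> I \<Longrightarrow> A i \<in> sets (S i)" for A
      using that \<open>finite I\<close> by (simp add: box eq sets_PiM_I_finite)
    show "range (\<lambda>_::nat. space (PiM I S)) \<subseteq> prod_algebra I S"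
      using \<open>finite I\<close> by (auto simp: space_PiM intro!: prod_algebraI_finite)
    have "emeasure (?D f) (space (PiM I S)) \<le> (\<integral>\<^sup>+ w. f w \<partial>M)"
      by (subst box) (auto intro!: nn_integral_mono simp: indicator_def)
    then show "emeasure (?D f) (space (PiM I S)) \<noteq> \<infinity>"
      using fin by auto
  qed auto
  then have "(\<integral>\<^sup>+ z. k z \<partial>?D f) = (\<integral>\<^sup>+ z. k z \<partial>?D g)"
    by simp
  then show ?thesis
    using k by (simp add: nn_integral_distr nn_integral_density)
qed

section \<open>Conditional independence expressed by integrals\<close>

lemma cond_indep_var_sym:
  assumes "cond_indep_var M S A T B R C"
  shows "cond_indep_var M T B S A R C"
  using assms unfolding cond_indep_var_def by (auto simp: Let_def Int_commute mult.commute)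

lemma indicator_vimage_comp: "indicator (A -` a) = (\<lambda>w. indicator a (A w))"
  by (auto simp: fun_eq_iff indicator_def)

text \<open>The hypothesis says that \<open>h (C w)\<close> is a conditional probability of
  \<open>b\<close> given \<open>A\<close> and \<open>C\<close> together. As it depends on
  \<open>C\<close> alone, it is also the one given \<open>C\<close>, and it can be pulled out of the
  conditional expectation of the indicator of \<open>a\<close>, which yields the product
  formula.\<close>

lemma cond_indep_varI:
  assumes "prob_space M"
    and [measurable]: "A \<in> M \<rightarrow>\<^sub>M S" "B \<in> M \<rightarrow>\<^sub>M T" "C \<in> M \<rightarrow>\<^sub>M R"
    and ex: "\<And>b. b \<in> sets T \<Longrightarrow> \<exists>h\<in>borel_measurable R. \<forall>a\<in>sets S. \<forall>c\<in>sets R.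
      (\<integral>\<^sup>+ w. indicator a (A w) * indicator b (B w) * indicator c (C w) \<partial>M) =
      (\<integral>\<^sup>+ w. indicator a (A w) * h (C w) * indicator c (C w) \<partial>M)"
  shows "cond_indep_var M S A T B R C"
proof -
  interpret prob_space M by fact
  define G where "G = vimage_algebra (space M) C R"
  have sub: "subalgebra M G"
    unfolding subalgebra_def G_def by (simp add: sets_image_in_sets)
  interpret G: finite_measure_subalgebra M G
    by (standard) fact
  have CG [measurable]: "C \<in> G \<rightarrow>\<^sub>M R"
    unfolding G_def by (rule measurable_vimage_algebra1) (auto dest: measurable_space[OF assms(4)])
  have setsG: "\<exists>c\<in>sets R. D = C -` c \<inter> space M" if "D \<in> sets G" for D
    using that measurable_space[OF assms(4)] by (auto simp: G_def sets_vimage_algebra2)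
  have "AE w in M. real_cond_exp M G (indicator (A -` a \<inter> B -` b)) w =
      real_cond_exp M G (indicator (A -` a)) w * real_cond_exp M G (indicator (B -` b)) w"
    if ab [measurable]: "a \<in> sets S" "b \<in> sets T" for a b
  proof -
    obtain h where h [measurable]: "h \<in> borel_measurable R"
      and eq: "\<And>a c. a \<in> sets S \<Longrightarrow> c \<in> sets R \<Longrightarrow>
        (\<integral>\<^sup>+ w. indicator a (A w) * indicator b (B w) * indicator c (C w) \<partial>M) =
        (\<integral>\<^sup>+ w. indicator a (A w) * h (C w) * indicator c (C w) \<partial>M)"
      using ex[OF ab(2)] by blast
    have "(\<integral>\<^sup>+ w. h (C w) \<partial>M) = (\<integral>\<^sup>+ w. indicator (space S) (A w) * h (C w) * indicator (space R) (C w) \<partial>M)"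
      by (intro nn_integral_cong) (simp add: measurable_space[OF assms(2)] measurable_space[OF assms(4)])
    also have "\<dots> = (\<integral>\<^sup>+ w. indicator (space S) (A w) * indicator b (B w) * indicator (space R) (C w) \<partial>M)"
      by (rule eq[symmetric]) auto
    also have "\<dots> \<le> (\<integral>\<^sup>+ w. 1 \<partial>M)"
      by (intro nn_integral_mono) (auto simp: indicator_def)
    also have "\<dots> = 1"
      by (simp add: emeasure_space_1)
    finally have h1: "(\<integral>\<^sup>+ w. h (C w) \<partial>M) \<le> 1" .
    then have "AE w in M. h (C w) \<noteq> \<infinity>"
      by (intro nn_integral_PInf_AE) (auto simp: top_unique)
    \<comment> \<open>\<open>real_cond_exp\<close> concerns real functions. Since
      \<open>h (C w)\<close> has integral at most 1, it is almost everywhere finite and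
      \<open>r\<close> loses nothing.\<close>
    define r where "r c = enn2real (h c)" for c
    have [measurable]: "r \<in> borel_measurable R"
      unfolding r_def by measurable
    have r0: "r c \<ge> 0" for c by (simp add: r_def)
    have hr: "AE w in M. h (C w) = ennreal (r (C w))"
      using \<open>AE w in M. h (C w) \<noteq> \<infinity>\<close> by eventually_elim (simp add: r_def ennreal_enn2real less_top)
    have int_r: "integrable M (\<lambda>w. r (C w))"
    proof (rule integrableI_nonneg)
      have "(\<integral>\<^sup>+ w. ennreal (r (C w)) \<partial>M) = (\<integral>\<^sup>+ w. h (C w) \<partial>M)"
        using hr by (intro nn_integral_cong_AE) auto
      then show "(\<integral>\<^sup>+ w. ennreal (r (C w)) \<partial>M) < \<infinity>"
        using h1 by (simp add: le_less_trans)
    qed (auto simp: r0)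
    have int_ind: "integrable M (\<lambda>w. r (C w) * indicator c (C w) * indicator a (A w))"
      if [measurable]: "a \<in> sets S" "c \<in> sets R" for a c
      by (rule Bochner_Integration.integrable_bound[OF int_r]) (auto simp: indicator_def r0)
    have eq_real: "(\<integral> w. indicator a (A w) * indicator b (B w) * indicator c (C w) \<partial>M) =
        (\<integral> w. r (C w) * indicator c (C w) * indicator a (A w) \<partial>M)"
      if [measurable]: "a \<in> sets S" "c \<in> sets R" for a c
    proof -
      have "ennreal (\<integral> w. indicator a (A w) * indicator b (B w) * indicator c (C w) \<partial>M) =
          (\<integral>\<^sup>+ w. ennreal (indicator a (A w) * indicator b (B w) * indicator c (C w)) \<partial>M)"
        by (intro nn_integral_eq_integral[symmetric] integrable_const_bound[where B=1])
           (auto simp: indicator_def)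
      also have "\<dots> = (\<integral>\<^sup>+ w. indicator a (A w) * indicator b (B w) * indicator c (C w) \<partial>M)"
        by (intro nn_integral_cong) (auto simp: indicator_def)
      also have "\<dots> = (\<integral>\<^sup>+ w. indicator a (A w) * h (C w) * indicator c (C w) \<partial>M)"
        by (rule eq) fact+
      also have "\<dots> = (\<integral>\<^sup>+ w. ennreal (r (C w) * indicator c (C w) * indicator a (A w)) \<partial>M)"
        using hr by (intro nn_integral_cong_AE) (auto simp: indicator_def elim!: eventually_mono)
      also have "\<dots> = ennreal (\<integral> w. r (C w) * indicator c (C w) * indicator a (A w) \<partial>M)"
        by (intro nn_integral_eq_integral int_ind that) (auto simp: r0)
      finally show ?thesis
        by (subst (asm) ennreal_inj) (auto intro!: integral_nonneg_AE simp: r0)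
    qed
    have int_b: "integrable M (\<lambda>w. indicator b (B w) :: real)"
      by (intro integrable_const_bound[where B=1]) (auto simp: indicator_def)
    have int_ab: "integrable M (\<lambda>w. indicator a (A w) * indicator b (B w) :: real)"
      by (intro integrable_const_bound[where B=1]) (auto simp: indicator_def)
    \<comment> \<open>The case \<open>a = space S\<close>, in which the indicator of
      \<open>A\<close> disappears.\<close>
    have b: "AE w in M. real_cond_exp M G (indicator (B -` b)) w = r (C w)"
      unfolding indicator_vimage_comp
    proof (rule G.real_cond_exp_charact)
      fix D assume "D \<in> sets G"
      then obtain c where c: "c \<in> sets R" and D: "D = C -` c \<inter> space M"
        using setsG by blast
      have "(LINT w:D|M. indicator b (B w) :: real) =
          (\<integral> w. indicator (space S) (A w) * indicator b (B w) * indicator c (C w) \<partial>M)"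
        unfolding set_lebesgue_integral_def D
        by (intro Bochner_Integration.integral_cong) (auto simp: indicator_def measurable_space[OF assms(2)])
      also have "\<dots> = (\<integral> w. r (C w) * indicator c (C w) * indicator (space S) (A w) \<partial>M)"
        by (rule eq_real) (use c in auto)
      also have "\<dots> = (LINT w:D|M. r (C w))"
        unfolding set_lebesgue_integral_def D
        by (intro Bochner_Integration.integral_cong) (auto simp: indicator_def measurable_space[OF assms(2)])
      finally show "(LINT w:D|M. indicator b (B w)) = (LINT w:D|M. r (C w))" .
    qed (auto intro: int_b int_r)
    have int_ra: "integrable M (\<lambda>w. r (C w) * indicator a (A w))"
      by (rule Bochner_Integration.integrable_bound[OF int_r]) (auto simp: indicator_def r0)
    have ab: "AE w in M. real_cond_exp M G (indicator (A -` a \<inter> B -` b)) w =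
        r (C w) * real_cond_exp M G (\<lambda>w. indicator a (A w)) w"
    proof (rule G.real_cond_exp_charact)
      fix D assume "D \<in> sets G"
      then obtain c where c [measurable]: "c \<in> sets R" and D: "D = C -` c \<inter> space M"
        using setsG by blast
      have "(LINT w:D|M. indicator (A -` a \<inter> B -` b) w :: real) =
          (\<integral> w. indicator a (A w) * indicator b (B w) * indicator c (C w) \<partial>M)"
        unfolding set_lebesgue_integral_def D
        by (intro Bochner_Integration.integral_cong) (auto simp: indicator_def)
      also have "\<dots> = (\<integral> w. r (C w) * indicator c (C w) * indicator a (A w) \<partial>M)"
        by (rule eq_real) fact+
      also have "\<dots> = (\<integral> w. r (C w) * indicator c (C w) * real_cond_exp M G (\<lambda>w. indicator a (A w)) w \<partial>M)"
        by (intro G.real_cond_exp_intg(2)[symmetric] int_ind) measurable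
      also have "\<dots> = (LINT w:D|M. r (C w) * real_cond_exp M G (\<lambda>w. indicator a (A w)) w)"
        unfolding set_lebesgue_integral_def D
        by (intro Bochner_Integration.integral_cong) (auto simp: indicator_def)
      finally show "(LINT w:D|M. indicator (A -` a \<inter> B -` b) w) =
          (LINT w:D|M. r (C w) * real_cond_exp M G (\<lambda>w. indicator a (A w)) w)" .
    next
      show "integrable M (indicator (A -` a \<inter> B -` b) :: _ \<Rightarrow> real)"
        using int_ab by (simp add: indicator_inter_arith[abs_def] indicator_vimage_comp)
      show "integrable M (\<lambda>w. r (C w) * real_cond_exp M G (\<lambda>w. indicator a (A w)) w)"
        by (intro G.real_cond_exp_intg(1) int_ra) measurable
    qed measurable
    show ?thesis
      using ab b unfolding indicator_vimage_comp by eventually_elim simp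
  qed
  then show ?thesis
    using assms(2-4) by (auto simp: cond_indep_var_def Let_def G_def)
qed

text \<open>A converse to \<open>cond_indep_varI\<close> with the roles of \<open>A\<close> and
  \<open>B\<close> exchanged: once \<open>h (C w)\<close> replaces the indicator of \<open>a\<close>
  against functions of \<open>C\<close>, conditional independence lets it do so against functions of
  \<open>B\<close> and \<open>C\<close>.\<close>

lemma cond_indep_var_rectangles:
  assumes "prob_space M" "cond_indep_var M S A T B R C"
    and [measurable]: "a \<in> sets S" "b \<in> sets T" "c \<in> sets R" "h \<in> borel_measurable R"
    and h: "\<And>c. c \<in> sets R \<Longrightarrow> (\<integral>\<^sup>+ w. indicator a (A w) * indicator c (C w) \<partial>M) =
      (\<integral>\<^sup>+ w. h (C w) * indicator c (C w) \<partial>M)"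
  shows "(\<integral>\<^sup>+ w. indicator a (A w) * indicator b (B w) * indicator c (C w) \<partial>M) =
      (\<integral>\<^sup>+ w. h (C w) * indicator b (B w) * indicator c (C w) \<partial>M)"
proof -
  interpret prob_space M by fact
  have [measurable]: "A \<in> M \<rightarrow>\<^sub>M S" "B \<in> M \<rightarrow>\<^sub>M T" and C [measurable]: "C \<in> M \<rightarrow>\<^sub>M R"
    using assms(2) by (auto simp: cond_indep_var_def)
  define G where "G = vimage_algebra (space M) C R"
  have sub: "subalgebra M G"
    unfolding subalgebra_def G_def by (simp add: sets_image_in_sets)
  interpret G: finite_measure_subalgebra M G
    by (standard) fact
  have CG [measurable]: "C \<in> G \<rightarrow>\<^sub>M R"
    unfolding G_def by (rule measurable_vimage_algebra1) (auto dest: measurable_space[OF C])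
  have setsG: "\<exists>c\<in>sets R. D = C -` c \<inter> space M" if "D \<in> sets G" for D
    using that measurable_space[OF C] by (auto simp: G_def sets_vimage_algebra2)
  have ci: "AE w in M. real_cond_exp M G (\<lambda>w. indicator a (A w) * indicator b (B w)) w =
      real_cond_exp M G (\<lambda>w. indicator a (A w)) w * real_cond_exp M G (\<lambda>w. indicator b (B w)) w"
    using assms(2-4)
    by (auto simp: cond_indep_var_def Let_def G_def indicator_inter_arith[abs_def] indicator_vimage_comp)
  have "(\<integral>\<^sup>+ w. h (C w) \<partial>M) = (\<integral>\<^sup>+ w. h (C w) * indicator (space R) (C w) \<partial>M)"
    by (intro nn_integral_cong) (simp add: measurable_space[OF C])
  also have "\<dots> = (\<integral>\<^sup>+ w. indicator a (A w) * indicator (space R) (C w) \<partial>M)"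
    by (rule h[symmetric]) auto
  also have "\<dots> \<le> (\<integral>\<^sup>+ w. 1 \<partial>M)"
    by (intro nn_integral_mono) (auto simp: indicator_def)
  also have "\<dots> = 1"
    by (simp add: emeasure_space_1)
  finally have h1: "(\<integral>\<^sup>+ w. h (C w) \<partial>M) \<le> 1" .
  then have "AE w in M. h (C w) \<noteq> \<infinity>"
    by (intro nn_integral_PInf_AE) (auto simp: top_unique)
  define r where "r c = enn2real (h c)" for c
  have [measurable]: "r \<in> borel_measurable R"
    unfolding r_def by measurable
  have r0: "r c \<ge> 0" for c by (simp add: r_def)
  have hr: "AE w in M. h (C w) = ennreal (r (C w))"
    using \<open>AE w in M. h (C w) \<noteq> \<infinity>\<close> by eventually_elim (simp add: r_def ennreal_enn2real less_top)
  have int_r: "integrable M (\<lambda>w. r (C w))"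
  proof (rule integrableI_nonneg)
    have "(\<integral>\<^sup>+ w. ennreal (r (C w)) \<partial>M) = (\<integral>\<^sup>+ w. h (C w) \<partial>M)"
      using hr by (intro nn_integral_cong_AE) auto
    then show "(\<integral>\<^sup>+ w. ennreal (r (C w)) \<partial>M) < \<infinity>"
      using h1 by (simp add: le_less_trans)
  qed (auto simp: r0)
  have int_c: "integrable M (\<lambda>w. r (C w) * indicator c (C w))" if [measurable]: "c \<in> sets R" for c
    by (rule Bochner_Integration.integrable_bound[OF int_r]) (auto simp: indicator_def r0)
  have int_bc: "integrable M (\<lambda>w. r (C w) * indicator c (C w) * indicator b (B w))"
    by (rule Bochner_Integration.integrable_bound[OF int_r]) (auto simp: indicator_def r0)
  have int_ind: "integrable M (\<lambda>w. indicator a (A w) * f w)"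
    if "f \<in> borel_measurable M" "\<And>w. f w = 0 \<or> f w = 1" for f :: "_ \<Rightarrow> real"
  proof (rule integrable_const_bound[where B=1])
    show "AE w in M. norm (indicator a (A w) * f w) \<le> 1"
    proof (rule AE_I2)
      fix w show "norm (indicator a (A w) * f w) \<le> 1"
        using that(2)[of w] by (auto simp: indicator_def)
    qed
  qed (use that(1) in measurable)
  have int_a: "integrable M (\<lambda>w. indicator a (A w) :: real)"
    using int_ind[of "\<lambda>_. 1"] by simp
  have a: "AE w in M. real_cond_exp M G (\<lambda>w. indicator a (A w)) w = r (C w)"
  proof (rule G.real_cond_exp_charact)
    fix D assume "D \<in> sets G"
    then obtain c where [measurable]: "c \<in> sets R" and D: "D = C -` c \<inter> space M"
      using setsG by blast
    have "ennreal (LINT w:D|M. indicator a (A w)) =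
        ennreal (\<integral> w. indicator a (A w) * indicator c (C w) \<partial>M)"
      unfolding set_lebesgue_integral_def D
      by (intro arg_cong[where f=ennreal] Bochner_Integration.integral_cong) (auto simp: indicator_def)
    also have "\<dots> = (\<integral>\<^sup>+ w. ennreal (indicator a (A w) * indicator c (C w)) \<partial>M)"
      by (intro nn_integral_eq_integral[symmetric] int_ind) (auto simp: indicator_def)
    also have "\<dots> = (\<integral>\<^sup>+ w. indicator a (A w) * indicator c (C w) \<partial>M)"
      by (intro nn_integral_cong) (auto simp: indicator_def)
    also have "\<dots> = (\<integral>\<^sup>+ w. h (C w) * indicator c (C w) \<partial>M)"
      by (rule h) fact
    also have "\<dots> = (\<integral>\<^sup>+ w. ennreal (r (C w) * indicator c (C w)) \<partial>M)"
      using hr by (intro nn_integral_cong_AE) (auto simp: indicator_def elim!: eventually_mono)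
    also have "\<dots> = ennreal (\<integral> w. r (C w) * indicator c (C w) \<partial>M)"
      by (intro nn_integral_eq_integral int_c) (auto simp: r0)
    also have "(\<integral> w. r (C w) * indicator c (C w) \<partial>M) = (LINT w:D|M. r (C w))"
      unfolding set_lebesgue_integral_def D
      by (intro Bochner_Integration.integral_cong) (auto simp: indicator_def)
    finally show "(LINT w:D|M. indicator a (A w)) = (LINT w:D|M. r (C w))"
      unfolding set_lebesgue_integral_def
      by (subst (asm) ennreal_inj) (auto intro!: integral_nonneg_AE simp: r0)
  qed (auto intro: int_a int_r)
  have "(\<integral>\<^sup>+ w. indicator a (A w) * indicator b (B w) * indicator c (C w) \<partial>M) =
      (\<integral>\<^sup>+ w. ennreal (indicator a (A w) * (indicator b (B w) * indicator c (C w))) \<partial>M)"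
    by (intro nn_integral_cong) (auto simp: indicator_def)
  also have "\<dots> = ennreal (\<integral> w. indicator a (A w) * (indicator b (B w) * indicator c (C w)) \<partial>M)"
    by (intro nn_integral_eq_integral int_ind) (auto simp: indicator_def)
  also have "(\<integral> w. (indicator a (A w) * (indicator b (B w) * indicator c (C w)) :: real) \<partial>M) =
      (\<integral> w. indicator c (C w) * (indicator a (A w) * indicator b (B w)) \<partial>M)"
    by (intro Bochner_Integration.integral_cong) (auto simp: indicator_def)
  also have "\<dots> = (\<integral> w. indicator c (C w) *
      real_cond_exp M G (\<lambda>w. indicator a (A w) * indicator b (B w)) w \<partial>M)"
    by (intro G.real_cond_exp_intg(2)[symmetric] integrable_const_bound[where B=1])
       (auto simp: indicator_def)
  also have "\<dots> = (\<integral> w. r (C w) * indicator c (C w) * real_cond_exp M G (\<lambda>w. indicator b (B w)) w \<partial>M)"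
    using ci a by (intro integral_cong_AE) (auto elim!: eventually_elim2)
  also have "\<dots> = (\<integral> w. r (C w) * indicator c (C w) * indicator b (B w) \<partial>M)"
    by (intro G.real_cond_exp_intg(2) int_bc) measurable
  also have "ennreal \<dots> = (\<integral>\<^sup>+ w. ennreal (r (C w) * indicator c (C w) * indicator b (B w)) \<partial>M)"
    by (intro nn_integral_eq_integral[symmetric] int_bc) (auto simp: r0)
  also have "\<dots> = (\<integral>\<^sup>+ w. h (C w) * indicator b (B w) * indicator c (C w) \<partial>M)"
    using hr by (intro nn_integral_cong_AE) (auto simp: indicator_def elim!: eventually_mono)
  finally show ?thesis .
qed

text \<open>The indicator of \<open>a\<close> is first traded for its conditional expectation
  \<open>r (C w)\<close>; then only functions of \<open>C\<close> multiply \<open>g (B w)\<close>,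
  so \<open>h (C w)\<close> may replace it, and \<open>r\<close> is traded back. In this order
  finiteness is asked only of the indicator, and \<open>g\<close> may be unbounded.\<close>

lemma cond_indep_var_nn_integral:
  fixes g :: "'b \<Rightarrow> ennreal"
  assumes "prob_space M" "cond_indep_var M S A T B R C"
    and [measurable]: "a \<in> sets S" "g \<in> borel_measurable T" "h \<in> borel_measurable R" "k \<in> borel_measurable R"
    and h: "\<And>k. k \<in> borel_measurable R \<Longrightarrow>
      (\<integral>\<^sup>+ w. g (B w) * k (C w) \<partial>M) = (\<integral>\<^sup>+ w. h (C w) * k (C w) \<partial>M)"
  shows "(\<integral>\<^sup>+ w. g (B w) * (indicator a (A w) * k (C w)) \<partial>M) =
      (\<integral>\<^sup>+ w. h (C w) * (indicator a (A w) * k (C w)) \<partial>M)"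
proof -
  interpret prob_space M by fact
  have [measurable]: "A \<in> M \<rightarrow>\<^sub>M S" "B \<in> M \<rightarrow>\<^sub>M T" "C \<in> M \<rightarrow>\<^sub>M R"
    using assms(2) by (auto simp: cond_indep_var_def)
  obtain r where r [measurable]: "r \<in> borel_measurable R" and
    eq: "\<And>k. k \<in> borel_measurable R \<Longrightarrow>
      (\<integral>\<^sup>+ w. indicator a (A w) * k (C w) \<partial>M) = (\<integral>\<^sup>+ w. r (C w) * k (C w) \<partial>M)"
    by (rule nn_cond_exp_given_map[of M C R "\<lambda>w. indicator a (A w)"])
       (auto simp: finite_measure_axioms)
  have fin: "(\<integral>\<^sup>+ w. indicator a (A w) \<partial>M) < \<infinity>"
  proof -
    have "(\<integral>\<^sup>+ w. indicator a (A w) \<partial>M) \<le> (\<integral>\<^sup>+ w. 1 \<partial>M)"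
      by (intro nn_integral_mono) (auto simp: indicator_def)
    then show ?thesis
      by (simp add: emeasure_space_1 le_less_trans)
  qed
  have "(\<integral>\<^sup>+ w. indicator a (A w) * (case (B w, C w) of (y, c) \<Rightarrow> g y * k c) \<partial>M) =
      (\<integral>\<^sup>+ w. r (C w) * (case (B w, C w) of (y, c) \<Rightarrow> g y * k c) \<partial>M)"
  proof (rule nn_integral_eq_of_rectangles[where T=T and R=R])
    show "(\<integral>\<^sup>+ w. indicator a (A w) * indicator b (B w) * indicator c (C w) \<partial>M) =
        (\<integral>\<^sup>+ w. r (C w) * indicator b (B w) * indicator c (C w) \<partial>M)"
      if "b \<in> sets T" "c \<in> sets R" for b c
      by (rule cond_indep_var_rectangles[OF assms(1,2,3) that r]) (simp add: eq)
  qed (use fin in auto)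
  also have "\<dots> = (\<integral>\<^sup>+ w. g (B w) * (r (C w) * k (C w)) \<partial>M)"
    by (simp add: mult_ac)
  also have "\<dots> = (\<integral>\<^sup>+ w. h (C w) * (r (C w) * k (C w)) \<partial>M)"
    by (rule h) measurable
  also have "\<dots> = (\<integral>\<^sup>+ w. r (C w) * (h (C w) * k (C w)) \<partial>M)"
    by (simp add: mult_ac)
  also have "\<dots> = (\<integral>\<^sup>+ w. indicator a (A w) * (h (C w) * k (C w)) \<partial>M)"
    by (rule eq[symmetric]) measurable
  finally show ?thesis
    by (simp add: mult_ac)
qed

text \<open>Passes from one step ahead to the whole path: the conditional expectation of
  \<open>g\<close> given the first \<open>t\<close> coordinates remains valid as further coordinates
  of \<xi> are revealed. By \<open>ex\<close>, \<open>g\<close> is a function of every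
  \<open>\<eta> s\<close>, so the condition at each time \<open>s\<close> applies to it.\<close>

lemma cond_indep_var_chain:
  fixes \<xi> :: "'w \<Rightarrow> nat \<Rightarrow> 'a" and g :: "'w \<Rightarrow> ennreal"
  assumes "prob_space M" "t \<le> n"
    and \<xi> [measurable]: "\<And>i. i \<in> {1..n} \<Longrightarrow> (\<lambda>w. \<xi> w i) \<in> M \<rightarrow>\<^sub>M S i"
    and ci: "\<And>s. s \<in> {t..<n} \<Longrightarrow> cond_indep_var M (S (Suc s)) (\<lambda>w. \<xi> w (Suc s)) (T s) (\<eta> s)
      (PiM {1..s} S) (\<lambda>w. restrict (\<xi> w) {1..s})"
    and g [measurable]: "g \<in> borel_measurable M" and fin: "(\<integral>\<^sup>+ w. g w \<partial>M) < \<infinity>"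
    and ex: "\<And>s. s \<in> {t..<n} \<Longrightarrow> \<exists>g'\<in>borel_measurable (T s). \<forall>w\<in>space M. g w = g' (\<eta> s w)"
    and h [measurable]: "h \<in> borel_measurable (PiM {1..t} S)"
    and eq: "\<And>k. k \<in> borel_measurable (PiM {1..t} S) \<Longrightarrow>
      (\<integral>\<^sup>+ w. g w * k (restrict (\<xi> w) {1..t}) \<partial>M) =
      (\<integral>\<^sup>+ w. h (restrict (\<xi> w) {1..t}) * k (restrict (\<xi> w) {1..t}) \<partial>M)"
    and "k \<in> borel_measurable (PiM {1..n} S)"
  shows "(\<integral>\<^sup>+ w. g w * k (restrict (\<xi> w) {1..n}) \<partial>M) =
      (\<integral>\<^sup>+ w. h (restrict (\<xi> w) {1..t}) * k (restrict (\<xi> w) {1..n}) \<partial>M)"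
  using \<open>t \<le> n\<close> \<xi> ci ex \<open>k \<in> _\<close>
proof (induction n arbitrary: k rule: dec_induct)
  case base
  then show ?case by (intro eq) simp
next
  case (step n)
  note [measurable] = step.prems(1)
  have restr_meas [measurable]: "(\<lambda>w. restrict (\<xi> w) {1..s}) \<in> M \<rightarrow>\<^sub>M PiM {1..s} S" if "s \<le> Suc n" for s
    using that by (intro measurable_restrict step.prems(1)) auto
  have restr: "restrict (restrict (\<xi> w) {1..n}) {1..t} = restrict (\<xi> w) {1..t}" for w
    using \<open>t \<le> n\<close> by (auto simp: restrict_def fun_eq_iff)
  let ?C = "\<lambda>w. restrict (\<xi> w) {1..n}"
  define h' where "h' c = h (restrict c {1..t})" for c
  have h' [measurable]: "h' \<in> borel_measurable (PiM {1..n} S)"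
    unfolding h'_def
    by (rule measurable_compose[OF measurable_restrict_subset h]) (use \<open>t \<le> n\<close> in auto)
  have h'_eq: "h' (?C w) = h (restrict (\<xi> w) {1..t})" for w
    unfolding h'_def restr ..
  have IH: "(\<integral>\<^sup>+ w. g w * k (?C w) \<partial>M) = (\<integral>\<^sup>+ w. h' (?C w) * k (?C w) \<partial>M)"
    if "k \<in> borel_measurable (PiM {1..n} S)" for k
    unfolding h'_eq
    by (rule step.IH) (use step.prems(1-3) that in auto)
  obtain g' where g' [measurable]: "g' \<in> borel_measurable (T n)" and g'_eq: "\<And>w. w \<in> space M \<Longrightarrow> g w = g' (\<eta> n w)"
    using step.prems(3)[of n] step.hyps by auto
  have "(\<integral>\<^sup>+ w. g w * k (restrict (\<xi> w) {1..Suc n}) \<partial>M) = (\<integral>\<^sup>+ w. h' (?C w) * k (restrict (\<xi> w) {1..Suc n}) \<partial>M)"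
  proof (rule nn_integral_eq_of_boxes[where S=S and I="{1..Suc n}"])
    show "(\<integral>\<^sup>+ w. g w * indicator (Pi\<^sub>E {1..Suc n} A) (restrict (\<xi> w) {1..Suc n}) \<partial>M) =
        (\<integral>\<^sup>+ w. h' (?C w) * indicator (Pi\<^sub>E {1..Suc n} A) (restrict (\<xi> w) {1..Suc n}) \<partial>M)"
      if A: "\<And>i. i \<in> {1..Suc n} \<Longrightarrow> A i \<in> sets (S i)" for A
    proof -
      have ind: "indicator (Pi\<^sub>E {1..Suc n} A) (restrict (\<xi> w) {1..Suc n}) =
          (indicator (A (Suc n)) (\<xi> w (Suc n)) * indicator (Pi\<^sub>E {1..n} A) (?C w) :: ennreal)" for w
        by (auto simp: indicator_def PiE_iff atLeastAtMostSuc_conv)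
      have box: "Pi\<^sub>E {1..n} A \<in> sets (PiM {1..n} S)"
        using A by (intro sets_PiM_I_finite) auto
      have "(\<integral>\<^sup>+ w. g' (\<eta> n w) * (indicator (A (Suc n)) (\<xi> w (Suc n)) * indicator (Pi\<^sub>E {1..n} A) (?C w)) \<partial>M) =
          (\<integral>\<^sup>+ w. h' (?C w) * (indicator (A (Suc n)) (\<xi> w (Suc n)) * indicator (Pi\<^sub>E {1..n} A) (?C w)) \<partial>M)"
      \<comment> \<open>The last side of the box is the one-step future, and the remaining sides are
        a test function of the conditioning variable. The induction hypothesis says that
        \<open>h'\<close> is the conditional expectation of \<open>g\<close> given the first
        \<open>n\<close> coordinates.\<close>
      proof (rule cond_indep_var_nn_integral[OF \<open>prob_space M\<close> step.prems(2)[of n]])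
        show "(\<integral>\<^sup>+ w. g' (\<eta> n w) * k (?C w) \<partial>M) = (\<integral>\<^sup>+ w. h' (?C w) * k (?C w) \<partial>M)"
          if "k \<in> borel_measurable (PiM {1..n} S)" for k
          using IH[OF that] by (simp add: g'_eq cong: nn_integral_cong)
      qed (use A box step.hyps h' in auto)
      then show ?thesis
        unfolding ind by (simp add: g'_eq cong: nn_integral_cong)
    qed
    show "(\<lambda>w. restrict (\<xi> w) {1..Suc n}) \<in> M \<rightarrow>\<^sub>M PiM {1..Suc n} S"
      by (rule restr_meas) simp
    show "(\<lambda>w. h' (?C w)) \<in> borel_measurable M"
      by (rule measurable_compose[OF restr_meas h']) simp
  qed (use g fin step.prems(4) in auto)
  then show ?case
    by (simp only: h'_eq)
qed

section \<open>Causality over whole paths\<close>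

locale polish_path_space =
  fixes N :: nat and X :: "nat \<Rightarrow> 'a topology"
  assumes polish: "\<And>t. t \<in> {1..N} \<Longrightarrow> polish_topology (X t)"
begin

abbreviation paths :: "(nat \<Rightarrow> 'a) measure" where
  "paths \<equiv> borel_of (path_topology N X)"

lemma sets_paths: "sets paths = sets (PiM {1..N} (\<lambda>t. borel_of (X t)))"
  unfolding path_topology_def
  by (intro sets_borel_of_product_topology finite_atLeastAtMost polish_topology_imp_second_countable polish)

lemma space_paths: "space paths = (\<Pi>\<^sub>E t\<in>{1..N}. topspace (X t))"
  by (simp add: path_topology_def)

lemma second_countable_paths: "second_countable (path_topology N X)"
  unfolding path_topology_def
  by (intro second_countable_product_topology finite_atLeastAtMost polish_topology_imp_second_countable polish)

lemma coord_measurable [measurable]: "t \<in> {1..N} \<Longrightarrow> coord t \<in> paths \<rightarrow>\<^sub>M borel_of (X t)"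
  unfolding coord_def measurable_cong_sets[OF sets_paths refl]
  by (rule measurable_component_singleton)

lemma past_coord_eq: "past coord t x = restrict x {1..t}"
  by (simp add: past_def coord_def)

lemma past_measurable [measurable]: "t \<le> N \<Longrightarrow> past coord t \<in> paths \<rightarrow>\<^sub>M past_space X t"
  unfolding past_def[abs_def] past_space_def by (intro measurable_restrict coord_measurable) auto

lemma restrict_path: "x \<in> space paths \<Longrightarrow> restrict x {1..N} = x"
  unfolding space_paths by (rule PiE_restrict)

lemma singleton_in_PiM:
  assumes "x \<in> (\<Pi>\<^sub>E s\<in>{1..t}. topspace (X s))" "t \<le> N"
  shows "{x} \<in> sets (PiM {1..t} (\<lambda>s. borel_of (X s)))"
proof -
  have "{x} = (\<Pi>\<^sub>E s\<in>{1..t}. {x s})"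
    using assms(1) by (intro PiE_singleton[symmetric]) (auto simp: PiE_iff)
  moreover have "{x s} \<in> sets (borel_of (X s))" if "s \<in> {1..t}" for s
    using that assms by (intro closedin_in_sets_borel_of closedin_singleton_of_polish_topology polish) (auto simp: PiE_iff)
  ultimately show ?thesis
    by (metis (no_types, lifting) finite_atLeastAtMost sets_PiM_I_finite)
qed

text \<open>The form in which causality is used: given all of \<xi>, a function of the past of
  \<eta> has a conditional expectation that depends on the past of \<xi> only. It comes from
  \<open>nn_cond_exp_given_map\<close> for the past of \<xi> and \<open>cond_indep_var_chain\<close>
  from \<open>t\<close> to \<open>N\<close>.\<close>

lemma cond_indep_path:
  fixes g :: "(nat \<Rightarrow> 'b) \<Rightarrow> ennreal"
  assumes "prob_space M" and \<xi> [measurable]: "\<xi> \<in> M \<rightarrow>\<^sub>M paths"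
    and ci: "\<And>t. t \<in> {1..<N} \<Longrightarrow> cond_indep_var M (borel_of (X (t + 1))) (\<lambda>w. coord (t + 1) (\<xi> w))
      (past_space Y t) (\<lambda>w. past coord t (\<eta> w)) (past_space X t) (\<lambda>w. past coord t (\<xi> w))"
    and t: "t \<in> {1..<N}" and g [measurable]: "g \<in> borel_measurable (past_space Y t)"
    and fin: "(\<integral>\<^sup>+ w. g (past coord t (\<eta> w)) \<partial>M) < \<infinity>"
  obtains h where "h \<in> borel_measurable (past_space X t)"
    "\<And>k. k \<in> borel_measurable paths \<Longrightarrow>
      (\<integral>\<^sup>+ w. g (past coord t (\<eta> w)) * k (\<xi> w) \<partial>M) = (\<integral>\<^sup>+ w. h (past coord t (\<xi> w)) * k (\<xi> w) \<partial>M)"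
proof -
  have \<eta> [measurable]: "(\<lambda>w. past coord t (\<eta> w)) \<in> M \<rightarrow>\<^sub>M past_space Y t"
    using ci[OF t] by (auto simp: cond_indep_var_def)
  have pt [measurable]: "past coord t \<in> paths \<rightarrow>\<^sub>M past_space X t"
    using t by simp
  obtain h where h: "h \<in> borel_measurable (past_space X t)"
    and eq: "\<And>k. k \<in> borel_measurable (past_space X t) \<Longrightarrow>
      (\<integral>\<^sup>+ w. g (past coord t (\<eta> w)) * k (past coord t (\<xi> w)) \<partial>M) =
      (\<integral>\<^sup>+ w. h (past coord t (\<xi> w)) * k (past coord t (\<xi> w)) \<partial>M)"
    using nn_cond_exp_given_map[of M "\<lambda>w. past coord t (\<xi> w)" "past_space X t" "\<lambda>w. g (past coord t (\<eta> w))"]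
      \<open>prob_space M\<close> by (auto simp: prob_space.finite_measure)
  show ?thesis
  proof (rule that[OF h])
    fix k :: "_ \<Rightarrow> ennreal" assume k: "k \<in> borel_measurable paths"
    have "(\<integral>\<^sup>+ w. g (past coord t (\<eta> w)) * k (restrict (\<xi> w) {1..N}) \<partial>M) =
        (\<integral>\<^sup>+ w. h (restrict (\<xi> w) {1..t}) * k (restrict (\<xi> w) {1..N}) \<partial>M)"
    proof (rule cond_indep_var_chain[where S="\<lambda>t. borel_of (X t)" and T="past_space Y" and \<eta>="\<lambda>s w. past coord s (\<eta> w)"])
      show "(\<lambda>w. \<xi> w i) \<in> M \<rightarrow>\<^sub>M borel_of (X i)" if "i \<in> {1..N}" for i
        using measurable_compose[OF \<xi> coord_measurable[OF that]] by (simp add: coord_def)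
      show "cond_indep_var M (borel_of (X (Suc s))) (\<lambda>w. \<xi> w (Suc s)) (past_space Y s) (\<lambda>w. past coord s (\<eta> w))
          (PiM {1..s} (\<lambda>t. borel_of (X t))) (\<lambda>w. restrict (\<xi> w) {1..s})" if "s \<in> {t..<N}" for s
        using ci[of s] that t by (simp add: past_space_def past_coord_eq) (simp add: coord_def)
      show "\<exists>g'\<in>borel_measurable (past_space Y s). \<forall>w\<in>space M. g (past coord t (\<eta> w)) = g' (past coord s (\<eta> w))"
        if s: "s \<in> {t..<N}" for s
      \<comment> \<open>The past up to \<open>s\<close> determines the past up to \<open>t\<close>
        by restriction, as \<open>t \<le> s\<close>.\<close>
      proof (intro bexI ballI)
        show "g (past coord t (\<eta> w)) = g (restrict (past coord s (\<eta> w)) {1..t})" for w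
          using s by (intro arg_cong[where f=g]) (auto simp: past_def fun_eq_iff restrict_def)
        have "(\<lambda>y. restrict y {1..t}) \<in> past_space Y s \<rightarrow>\<^sub>M past_space Y t"
          unfolding past_space_def using s by (intro measurable_restrict_subset) auto
        then show "(\<lambda>y. g (restrict y {1..t})) \<in> borel_measurable (past_space Y s)"
          by measurable
      qed
      show "k \<in> borel_measurable (PiM {1..N} (\<lambda>t. borel_of (X t)))"
        using k by (simp add: measurable_cong_sets[OF sets_paths refl])
      show "(\<lambda>w. g (past coord t (\<eta> w))) \<in> borel_measurable M"
        by measurable
      show "(\<integral>\<^sup>+ w. g (past coord t (\<eta> w)) * k (restrict (\<xi> w) {1..t}) \<partial>M) =
          (\<integral>\<^sup>+ w. h (restrict (\<xi> w) {1..t}) * k (restrict (\<xi> w) {1..t}) \<partial>M)"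
        if "k \<in> borel_measurable (PiM {1..t} (\<lambda>t. borel_of (X t)))" for k
        using eq[of k] that by (simp only: past_space_def past_coord_eq)
      show "h \<in> borel_measurable (PiM {1..t} (\<lambda>t. borel_of (X t)))"
        using h by (simp only: past_space_def)
    qed (use t fin \<open>prob_space M\<close> in auto)
    then show "(\<integral>\<^sup>+ w. g (past coord t (\<eta> w)) * k (\<xi> w) \<partial>M) = (\<integral>\<^sup>+ w. h (past coord t (\<xi> w)) * k (\<xi> w) \<partial>M)"
      unfolding past_coord_eq using restrict_path[OF measurable_space[OF \<xi>]] by (simp cong: nn_integral_cong)
  qed
qed

end

section \<open>Bicausal kernels from discrete couplings\<close>

text \<open>\<open>K x y\<close> is the density, with respect to \<open>\<mu>(dy)\<close>, of the transition from \<open>x\<close> to a discretised path and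
  back to an independent path \<open>y\<close>.\<close>

locale bicausal_kernel = polish_path_space N X + prob_space \<mu>
  for N :: nat and X :: "nat \<Rightarrow> 'a topology" and \<mu> :: "(nat \<Rightarrow> 'a) measure" +
  fixes K :: "(nat \<Rightarrow> 'a) \<Rightarrow> (nat \<Rightarrow> 'a) \<Rightarrow> ennreal" and c :: ennreal
  assumes sets_eq [measurable_cong]: "sets \<mu> = sets paths"
    and kernel_measurable [measurable]: "(\<lambda>(x, y). K x y) \<in> borel_measurable (\<mu> \<Otimes>\<^sub>M \<mu>)"
    and kernel_sym: "K x y = K y x"
    and kernel_le: "K x y \<le> c"
    and bound_finite: "c < \<infinity>"
    and kernel_markov: "AE x in \<mu>. (\<integral>\<^sup>+ y. K x y \<partial>\<mu>) = 1"
    and kernel_causal: "t \<in> {1..<N} \<Longrightarrow> k \<in> borel_measurable (past_space X t) \<Longrightarrow>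
      (\<integral>\<^sup>+ y. k (past coord t y) \<partial>\<mu>) < \<infinity> \<Longrightarrow>
      \<exists>u\<in>borel_measurable (past_space X t).
        AE x in \<mu>. (\<integral>\<^sup>+ y. K x y * k (past coord t y) \<partial>\<mu>) = u (past coord t x)"

lemma couplingsD:
  assumes "\<pi> \<in> couplings \<mu> \<nu>"
  shows "prob_space \<pi>" "sets \<pi> = sets (\<mu> \<Otimes>\<^sub>M \<nu>)"
    and "\<And>f. f \<in> borel_measurable \<mu> \<Longrightarrow> (\<integral>\<^sup>+ z. f (fst z) \<partial>\<pi>) = (\<integral>\<^sup>+ x. f x \<partial>\<mu>)"
    and "\<And>f. f \<in> borel_measurable \<nu> \<Longrightarrow> (\<integral>\<^sup>+ z. f (snd z) \<partial>\<pi>) = (\<integral>\<^sup>+ x. f x \<partial>\<nu>)"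
    and "\<And>P. (AE x in \<mu>. P x) \<Longrightarrow> AE z in \<pi>. P (fst z)"
    and "\<And>P. (AE x in \<nu>. P x) \<Longrightarrow> AE z in \<pi>. P (snd z)"
proof -
  show 1: "prob_space \<pi>" and 2: "sets \<pi> = sets (\<mu> \<Otimes>\<^sub>M \<nu>)"
    using assms by (auto simp: couplings_def)
  have d: "distr \<pi> \<mu> fst = \<mu>" "distr \<pi> \<nu> snd = \<nu>"
    using assms by (auto simp: couplings_def)
  have m [measurable]: "fst \<in> \<pi> \<rightarrow>\<^sub>M \<mu>" "snd \<in> \<pi> \<rightarrow>\<^sub>M \<nu>"
    by (auto simp: measurable_cong_sets[OF 2 refl])
  show "(\<integral>\<^sup>+ z. f (fst z) \<partial>\<pi>) = (\<integral>\<^sup>+ x. f x \<partial>\<mu>)" if "f \<in> borel_measurable \<mu>" for f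
    using nn_integral_distr[OF m(1), of f] that by (simp add: d)
  show "(\<integral>\<^sup>+ z. f (snd z) \<partial>\<pi>) = (\<integral>\<^sup>+ x. f x \<partial>\<nu>)" if "f \<in> borel_measurable \<nu>" for f
    using nn_integral_distr[OF m(2), of f] that by (simp add: d)
  show "AE z in \<pi>. P (fst z)" if "AE x in \<mu>. P x" for P
    using AE_distrD[OF m(1), of P, unfolded d(1)] that by blast
  show "AE z in \<pi>. P (snd z)" if "AE x in \<nu>. P x" for P
    using AE_distrD[OF m(2), of P, unfolded d(2)] that by blast
qed

text \<open>Coarser than the convexity constant \<open>2 powr (p - 1)\<close>, but it follows from
  bounding \<open>a + b\<close> by twice the maximum and is valid for every nonnegative
  \<open>p\<close>.\<close>

lemma powr_add_le:
  fixes a b p :: real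
  assumes "0 \<le> a" "0 \<le> b" "0 \<le> p"
  shows "(a + b) powr p \<le> 2 powr p * (a powr p + b powr p)"
proof -
  have "(a + b) powr p \<le> (2 * max a b) powr p"
    using assms by (intro powr_mono2) auto
  also have "\<dots> = 2 powr p * (max a b) powr p"
    using assms by (simp add: powr_mult)
  also have "\<dots> \<le> 2 powr p * (a powr p + b powr p)"
    by (intro mult_left_mono) (auto simp: max_def)
  finally show ?thesis .
qed

context polish_path_space
begin

text \<open>Support points of zero mass are discarded, so that the kernel may divide by each
  \<open>emeasure \<mu>' {f}\<close>.\<close>

lemma finitely_supported_atoms:
  assumes sets: "sets \<mu>' = sets paths" and "finitely_supported \<mu>'"
  obtains F where "finite F" "F \<subseteq> space paths" "AE x in \<mu>'. x \<in> F"
    "\<And>f. f \<in> F \<Longrightarrow> {f} \<in> sets \<mu>'" "\<And>f. f \<in> F \<Longrightarrow> emeasure \<mu>' {f} \<noteq> 0"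
proof -
  have space: "space \<mu>' = space paths"
    by (rule sets_eq_imp_space_eq) fact
  obtain F where F: "finite F" "F \<subseteq> space paths" "AE x in \<mu>'. x \<in> F"
    using assms(2) by (auto simp: finitely_supported_def space)
  have sing: "{f} \<in> sets \<mu>'" if "f \<in> F" for f
    using singleton_in_PiM[of f N] that F(2) unfolding sets sets_paths space_paths by blast
  define F' where "F' = {f \<in> F. emeasure \<mu>' {f} \<noteq> 0}"
  have "AE x in \<mu>'. x \<notin> {f}" if "f \<in> F - F'" for f
    using that sing[of f] by (intro AE_not_in) (auto simp: F'_def null_sets_def)
  then have "AE x in \<mu>'. \<forall>f\<in>F - F'. x \<notin> {f}"
    using F(1) by (intro AE_finite_allI) auto
  then have "AE x in \<mu>'. x \<in> F'"
    using F(3) by eventually_elim auto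
  then show ?thesis
    using F sing by (intro that[of F']) (auto simp: F'_def)
qed

text \<open>Given the discrete path f, the start x and the end y of a \<open>K\<close>-move are
  independent draws from the conditional law of the second coordinate of \<alpha>. Hence each leg of
  the triangle inequality through f costs as much as \<alpha>: this is the factor 2, and
  \<open>2 powr p\<close> comes from \<open>powr_add_le\<close>.\<close>

lemma ex_bicausal_kernel:
  fixes d :: "(nat \<Rightarrow> 'a) \<Rightarrow> (nat \<Rightarrow> 'a) \<Rightarrow> real"
  assumes \<alpha>: "\<alpha> \<in> path_couplings Bicausal N X X \<mu>' \<mu>"
    and \<mu>': "\<mu>' \<in> borel_probs (path_topology N X)" "finitely_supported \<mu>'"
    and \<mu>: "\<mu> \<in> borel_probs (path_topology N X)"
    and d: "metrizes (path_topology N X) d" and p: "0 \<le> p"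
  obtains K c where "bicausal_kernel N X \<mu> K c"
    "(\<integral>\<^sup>+ x. \<integral>\<^sup>+ y. K x y * ennreal (d x y powr p) \<partial>\<mu> \<partial>\<mu>) \<le>
       ennreal (2 * 2 powr p) * (\<integral>\<^sup>+ w. ennreal (d (fst w) (snd w) powr p) \<partial>\<alpha>)"
proof -
  have sets': "sets \<mu>' = sets paths" and sets [measurable_cong]: "sets \<mu> = sets paths"
    using \<mu>' \<mu> by (auto simp: borel_probs_def)
  have space: "space \<mu>' = space paths" "space \<mu> = space paths"
    using sets sets' by (auto dest: sets_eq_imp_space_eq)
  interpret \<mu>': prob_space \<mu>' using \<mu>' by (simp add: borel_probs_def)
  interpret \<mu>: prob_space \<mu> using \<mu> by (simp add: borel_probs_def)
  have cpl: "\<alpha> \<in> couplings \<mu>' \<mu>"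
    using \<alpha> by (simp add: path_couplings_def couplings_version_def)
  note \<alpha>D = couplingsD[OF cpl]
  interpret \<alpha>: prob_space \<alpha> by (rule \<alpha>D)
  have fst\<alpha> [measurable]: "fst \<in> \<alpha> \<rightarrow>\<^sub>M \<mu>'" and snd\<alpha> [measurable]: "snd \<in> \<alpha> \<rightarrow>\<^sub>M \<mu>"
    by (auto simp: measurable_cong_sets[OF \<alpha>D(2) refl])
  have ca: "causal N X coord X coord \<alpha>" and aca: "anticausal N X coord X coord \<alpha>"
    using \<alpha> by (auto simp: path_couplings_def couplings_version_def)
  obtain F where F: "finite F" "F \<subseteq> space paths" "AE x in \<mu>'. x \<in> F"
    and sing: "\<And>f. f \<in> F \<Longrightarrow> {f} \<in> sets \<mu>'" and pos: "\<And>f. f \<in> F \<Longrightarrow> emeasure \<mu>' {f} \<noteq> 0"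
    using finitely_supported_atoms[OF sets' \<mu>'(2)] by blast
  have cancel: "a / emeasure \<mu>' {f} * emeasure \<mu>' {f} = a" if "f \<in> F" for a f
    using pos[OF that] \<mu>'.emeasure_finite[of "{f}"]
    by (simp add: ennreal_divide_times ennreal_divide_self less_top[symmetric])
  have cancel': "a / emeasure \<mu>' {f} * (b * emeasure \<mu>' {f}) = a * b" if "f \<in> F" for a b f
  proof -
    have "a / emeasure \<mu>' {f} * (b * emeasure \<mu>' {f}) = (a / emeasure \<mu>' {f} * emeasure \<mu>' {f}) * b"
      by (simp only: mult_ac)
    then show ?thesis
      by (simp only: cancel[OF that])
  qed
  have "\<forall>f\<in>F. \<exists>w. w \<in> borel_measurable \<mu> \<and> (\<forall>k\<in>borel_measurable \<mu>.
      (\<integral>\<^sup>+ z. indicator {f} (fst z) * k (snd z) \<partial>\<alpha>) = (\<integral>\<^sup>+ x. w x * k x \<partial>\<mu>))"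
  proof
    fix f assume "f \<in> F"
    then have [measurable]: "{f} \<in> sets \<mu>'" by (rule sing)
    obtain w where w: "w \<in> borel_measurable \<mu>" "\<And>k. k \<in> borel_measurable \<mu> \<Longrightarrow>
        (\<integral>\<^sup>+ z. indicator {f} (fst z) * k (snd z) \<partial>\<alpha>) = (\<integral>\<^sup>+ z. w (snd z) * k (snd z) \<partial>\<alpha>)"
      by (rule nn_cond_exp_given_map[of \<alpha> snd \<mu> "\<lambda>z. indicator {f} (fst z)"])
         (auto simp: \<alpha>.finite_measure_axioms)
    show "\<exists>w. w \<in> borel_measurable \<mu> \<and> (\<forall>k\<in>borel_measurable \<mu>.
      (\<integral>\<^sup>+ z. indicator {f} (fst z) * k (snd z) \<partial>\<alpha>) = (\<integral>\<^sup>+ x. w x * k x \<partial>\<mu>))"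
      using w \<alpha>D(4)[of "\<lambda>x. w x * _ x"] by (intro exI[of _ w]) auto
  qed
  from bchoice[OF this] obtain w0 where w0_all: "\<forall>f\<in>F. w0 f \<in> borel_measurable \<mu> \<and>
      (\<forall>k\<in>borel_measurable \<mu>.
        (\<integral>\<^sup>+ z. indicator {f} (fst z) * k (snd z) \<partial>\<alpha>) = (\<integral>\<^sup>+ x. w0 f x * k x \<partial>\<mu>))"
    by (rule exE)
  then have w0 [measurable]: "\<And>f. f \<in> F \<Longrightarrow> w0 f \<in> borel_measurable \<mu>"
    and w0_eq: "\<And>f k. f \<in> F \<Longrightarrow> k \<in> borel_measurable \<mu> \<Longrightarrow>
      (\<integral>\<^sup>+ z. indicator {f} (fst z) * k (snd z) \<partial>\<alpha>) = (\<integral>\<^sup>+ x. w0 f x * k x \<partial>\<mu>)"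
    by auto
  have sum_w0_eq: "(\<integral>\<^sup>+ z. (\<Sum>f\<in>G. indicator {f} (fst z)) * k (snd z) \<partial>\<alpha>) = (\<integral>\<^sup>+ x. (\<Sum>f\<in>G. w0 f x) * k x \<partial>\<mu>)"
    if "G \<subseteq> F" and [measurable]: "k \<in> borel_measurable \<mu>" for k G
  proof -
    have GF: "f \<in> G \<Longrightarrow> f \<in> F" for f using that by auto
    note [measurable] = sing[OF GF] w0[OF GF]
    show ?thesis
      by (simp add: sum_distrib_right nn_integral_sum w0_eq GF)
  qed
  have w0_sum: "AE x in \<mu>. (\<Sum>f\<in>F. w0 f x) = 1"
  proof (rule \<mu>.density_unique_finite_measure)
    fix A assume [measurable]: "A \<in> sets \<mu>"
    have "(\<integral>\<^sup>+ x. (\<Sum>f\<in>F. w0 f x) * indicator A x \<partial>\<mu>) =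
        (\<integral>\<^sup>+ z. (\<Sum>f\<in>F. indicator {f} (fst z)) * indicator A (snd z) \<partial>\<alpha>)"
      by (intro sum_w0_eq[symmetric]) auto
    also have "\<dots> = (\<integral>\<^sup>+ z. indicator A (snd z) \<partial>\<alpha>)"
    proof (rule nn_integral_cong_AE)
      have "(\<Sum>f\<in>F. indicator {f} x) = (1::ennreal)" if "x \<in> F" for x
        using F(1) that by (simp add: indicator_def)
      then show "AE z in \<alpha>. (\<Sum>f\<in>F. indicator {f} (fst z)) * indicator A (snd z) = (indicator A (snd z) :: ennreal)"
        using \<alpha>D(5)[OF F(3)] by (auto elim!: eventually_mono)
    qed
    also have "\<dots> = (\<integral>\<^sup>+ x. 1 * indicator A x \<partial>\<mu>)"
      by (subst \<alpha>D(4)) auto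
    finally show "(\<integral>\<^sup>+ x. (\<Sum>f\<in>F. w0 f x) * indicator A x \<partial>\<mu>) = (\<integral>\<^sup>+ x. 1 * indicator A x \<partial>\<mu>)" .
  qed auto
  \<comment> \<open>Truncating at 1 changes \<open>w0\<close> on a null set only and makes the bound on \<open>K\<close> hold everywhere.\<close>
  define w where "w f x = min 1 (w0 f x)" for f x
  have w_meas [measurable]: "w f \<in> borel_measurable \<mu>" if "f \<in> F" for f
    using w0[OF that] unfolding w_def[abs_def] by measurable
  have w_le: "w f x \<le> 1" for f x
    by (simp add: w_def)
  have w_w0: "AE x in \<mu>. \<forall>f\<in>F. w f x = w0 f x"
    using w0_sum
  proof eventually_elim
    case (elim x)
    then have "w0 f x \<le> 1" if "f \<in> F" for f
      using member_le_sum[of f F "\<lambda>f. w0 f x"] that F(1) by simp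
    then show ?case by (simp add: w_def min_absorb2)
  qed
  have w_eq: "(\<integral>\<^sup>+ z. indicator {f} (fst z) * k (snd z) \<partial>\<alpha>) = (\<integral>\<^sup>+ x. w f x * k x \<partial>\<mu>)"
    if "f \<in> F" "k \<in> borel_measurable \<mu>" for f k
    unfolding w0_eq[OF that] using w_w0 that by (intro nn_integral_cong_AE) (auto elim!: eventually_mono)
  have sum_w_eq: "(\<integral>\<^sup>+ z. (\<Sum>f\<in>G. indicator {f} (fst z)) * k (snd z) \<partial>\<alpha>) = (\<integral>\<^sup>+ x. (\<Sum>f\<in>G. w f x) * k x \<partial>\<mu>)"
    if "G \<subseteq> F" "k \<in> borel_measurable \<mu>" for k G
    unfolding sum_w0_eq[OF that] using w_w0 that
    by (intro nn_integral_cong_AE) (auto elim!: eventually_mono intro!: arg_cong2[where f="(*)"] sum.cong)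
  have w_sum: "AE x in \<mu>. (\<Sum>f\<in>F. w f x) = 1"
    using w0_sum w_w0 by eventually_elim simp
  have w_int: "(\<integral>\<^sup>+ x. w f x \<partial>\<mu>) = emeasure \<mu>' {f}" if "f \<in> F" for f
    using w_eq[OF that, of "\<lambda>_. 1"] \<alpha>D(3)[of "indicator {f}"] sing[OF that] by simp

  \<comment> \<open>\<open>w f y / emeasure \<mu>' {f}\<close> is the density of the second
    coordinate of \<alpha> given the discrete path \<open>f\<close>, by Bayes' rule;
    \<open>w f x\<close> is the probability of moving from \<open>x\<close> to
    \<open>f\<close>.\<close>
  define K where "K x y = (\<Sum>f\<in>F. w f x * w f y / emeasure \<mu>' {f})" for x y
  define c where "c = (\<Sum>f\<in>F. 1 / emeasure \<mu>' {f})"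
  have K_int: "(\<integral>\<^sup>+ y. K x y * k y \<partial>\<mu>) = (\<Sum>f\<in>F. w f x / emeasure \<mu>' {f} * (\<integral>\<^sup>+ y. w f y * k y \<partial>\<mu>))"
    if [measurable]: "k \<in> borel_measurable \<mu>" for k x
  proof -
    have "K x y * k y = (\<Sum>f\<in>F. w f x / emeasure \<mu>' {f} * (w f y * k y))" for y
      unfolding K_def sum_distrib_right by (intro sum.cong refl) (simp add: divide_ennreal_def mult_ac)
    then show ?thesis
      by (simp add: nn_integral_sum nn_integral_cmult)
  qed
  have ker: "bicausal_kernel N X \<mu> K c"
  proof unfold_locales
    show "sets \<mu> = sets paths" by (rule sets)
    show "(\<lambda>(x, y). K x y) \<in> borel_measurable (\<mu> \<Otimes>\<^sub>M \<mu>)"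
      unfolding K_def by measurable
    show "K x y = K y x" for x y
      by (simp add: K_def mult.commute)
    show "K x y \<le> c" for x y
      unfolding K_def c_def using w_le[of _ x] w_le[of _ y]
      by (intro sum_mono divide_right_mono_ennreal) (metis mult_mono mult_1 zero_le)
    show "c < \<infinity>"
      unfolding c_def using F(1) pos by (auto simp: less_top[symmetric] ennreal_divide_eq_top_iff)
    show "AE x in \<mu>. (\<integral>\<^sup>+ y. K x y \<partial>\<mu>) = 1"
      using w_sum
    proof eventually_elim
      case (elim x)
      have "(\<integral>\<^sup>+ y. K x y * 1 \<partial>\<mu>) = (\<Sum>f\<in>F. w f x / emeasure \<mu>' {f} * emeasure \<mu>' {f})"
        unfolding K_int[OF borel_measurable_const] by (intro sum.cong refl) (simp add: w_int)
      also have "\<dots> = (\<Sum>f\<in>F. w f x)"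
        by (intro sum.cong refl cancel)
      finally show ?case by (simp add: elim)
    qed
    fix t and k :: "_ \<Rightarrow> ennreal"
    assume t: "t \<in> {1..<N}" and k [measurable]: "k \<in> borel_measurable (past_space X t)"
      and fin_k: "(\<integral>\<^sup>+ y. k (past coord t y) \<partial>\<mu>) < \<infinity>"
    have pt [measurable]: "past coord t \<in> paths \<rightarrow>\<^sub>M past_space X t"
      using t by simp
    have kpt [measurable]: "(\<lambda>y. k (past coord t y)) \<in> borel_measurable \<mu>"
      by measurable
    \<comment> \<open>The causal half of bicausality: averaging a function of the past of the second
      coordinate, given the discrete path, leaves a function of the past of the discrete
      path.\<close>
    obtain h where h: "h \<in> borel_measurable (past_space X t)"
      and h_eq: "\<And>j. j \<in> borel_measurable paths \<Longrightarrow>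
        (\<integral>\<^sup>+ z. k (past coord t (snd z)) * j (fst z) \<partial>\<alpha>) = (\<integral>\<^sup>+ z. h (past coord t (fst z)) * j (fst z) \<partial>\<alpha>)"
    proof (rule cond_indep_path[OF \<open>prob_space \<alpha>\<close>, of fst X snd t k])
      show "fst \<in> \<alpha> \<rightarrow>\<^sub>M paths"
        using fst\<alpha> by (simp add: measurable_cong_sets[OF refl sets'])
      show "(\<integral>\<^sup>+ z. k (past coord t (snd z)) \<partial>\<alpha>) < \<infinity>"
        using fin_k \<alpha>D(4)[OF kpt] by simp
    qed (use ca t k in \<open>auto simp: causal_def\<close>)
    \<comment> \<open>Testing with the indicator of the atom \<open>f\<close> evaluates the
      conditional mean there; the mass of \<open>f\<close> will cancel the denominator in
      \<open>K\<close>.\<close>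
    have w_k: "(\<integral>\<^sup>+ y. w f y * k (past coord t y) \<partial>\<mu>) = h (past coord t f) * emeasure \<mu>' {f}" if f: "f \<in> F" for f
    proof -
      have [measurable]: "{f} \<in> sets \<mu>'" "{f} \<in> sets paths"
        using sing[OF f] by (simp_all add: sets')
      have "(\<integral>\<^sup>+ y. w f y * k (past coord t y) \<partial>\<mu>) = (\<integral>\<^sup>+ z. k (past coord t (snd z)) * indicator {f} (fst z) \<partial>\<alpha>)"
        unfolding w_eq[OF f kpt, symmetric] by (simp add: mult.commute)
      also have "\<dots> = (\<integral>\<^sup>+ z. h (past coord t (fst z)) * indicator {f} (fst z) \<partial>\<alpha>)"
        by (rule h_eq) simp
      also have "\<dots> = (\<integral>\<^sup>+ z. h (past coord t f) * indicator {f} (fst z) \<partial>\<alpha>)"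
        by (intro nn_integral_cong) (auto simp: indicator_def)
      also have "\<dots> = h (past coord t f) * emeasure \<mu>' {f}"
        using \<alpha>D(3)[of "indicator {f}"] by (simp add: nn_integral_cmult)
      finally show ?thesis .
    qed
    \<comment> \<open>The anticausal half. A single \<open>w f x\<close> may depend on all of
      \<open>x\<close>, but the sum over the discrete paths with common past \<open>a\<close> is the
      probability of that past given \<open>x\<close>, which depends on the past of \<open>x\<close>
      only.\<close>
    have "\<forall>a\<in>past coord t ` F. \<exists>u. u \<in> borel_measurable (past_space X t) \<and>
        (AE x in \<mu>. (\<Sum>f\<in>{f\<in>F. past coord t f = a}. w f x) = u (past coord t x))"
    proof
      fix a assume "a \<in> past coord t ` F"
      then obtain f0 where f0: "f0 \<in> F" "a = past coord t f0" by auto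
      have "f0 \<in> (\<Pi>\<^sub>E s\<in>{1..N}. topspace (X s))"
        using f0(1) F(2) space_paths by blast
      then have "a \<in> (\<Pi>\<^sub>E s\<in>{1..t}. topspace (X s))"
        using f0(2) t by (auto simp: past_coord_eq)
      then have a_sets [measurable]: "{a} \<in> sets (past_space X t)"
        using t unfolding past_space_def by (intro singleton_in_PiM) auto
      obtain u where u [measurable]: "u \<in> borel_measurable (past_space X t)"
        and u_eq: "\<And>j. j \<in> borel_measurable paths \<Longrightarrow>
          (\<integral>\<^sup>+ z. indicator {a} (past coord t (fst z)) * j (snd z) \<partial>\<alpha>) =
          (\<integral>\<^sup>+ z. u (past coord t (snd z)) * j (snd z) \<partial>\<alpha>)"
      proof (rule cond_indep_path[OF \<open>prob_space \<alpha>\<close>, of snd X fst t "indicator {a}"])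
        show "snd \<in> \<alpha> \<rightarrow>\<^sub>M paths"
          using snd\<alpha> by (simp add: measurable_cong_sets[OF refl sets])
        have "(\<integral>\<^sup>+ z. indicator {a} (past coord t (fst z)) \<partial>\<alpha>) \<le> (\<integral>\<^sup>+ z. 1 \<partial>\<alpha>)"
          by (intro nn_integral_mono) (auto simp: indicator_def)
        then show "(\<integral>\<^sup>+ z. indicator {a} (past coord t (fst z)) \<partial>\<alpha>) < \<infinity>"
          by (simp add: \<alpha>.emeasure_space_1 le_less_trans)
      qed (use aca t in \<open>auto simp: anticausal_def\<close>)
      have "AE x in \<mu>. (\<Sum>f\<in>{f\<in>F. past coord t f = a}. w f x) = u (past coord t x)"
      proof (rule \<mu>.density_unique_finite_measure)
        fix A assume A [measurable]: "A \<in> sets \<mu>"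
        have "(\<integral>\<^sup>+ x. (\<Sum>f\<in>{f\<in>F. past coord t f = a}. w f x) * indicator A x \<partial>\<mu>) =
            (\<integral>\<^sup>+ z. (\<Sum>f\<in>{f\<in>F. past coord t f = a}. indicator {f} (fst z)) * indicator A (snd z) \<partial>\<alpha>)"
          by (intro sum_w_eq[symmetric]) auto
        also have "\<dots> = (\<integral>\<^sup>+ z. indicator {a} (past coord t (fst z)) * indicator A (snd z) \<partial>\<alpha>)"
        proof (rule nn_integral_cong_AE)
          have "(\<Sum>f\<in>{f\<in>F. past coord t f = a}. indicator {f} x) = (indicator {a} (past coord t x) :: ennreal)"
            if "x \<in> F" for x
            using F(1) that by (simp add: indicator_def)
          then show "AE z in \<alpha>. (\<Sum>f\<in>{f\<in>F. past coord t f = a}. indicator {f} (fst z)) * indicator A (snd z) =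
              (indicator {a} (past coord t (fst z)) * indicator A (snd z) :: ennreal)"
            using \<alpha>D(5)[OF F(3)] by (auto elim!: eventually_mono)
        qed
        also have "\<dots> = (\<integral>\<^sup>+ z. u (past coord t (snd z)) * indicator A (snd z) \<partial>\<alpha>)"
          by (rule u_eq) (use A in \<open>simp add: sets\<close>)
        also have "\<dots> = (\<integral>\<^sup>+ x. u (past coord t x) * indicator A x \<partial>\<mu>)"
          by (rule \<alpha>D(4)) measurable
        finally show "(\<integral>\<^sup>+ x. (\<Sum>f\<in>{f\<in>F. past coord t f = a}. w f x) * indicator A x \<partial>\<mu>) =
            (\<integral>\<^sup>+ x. u (past coord t x) * indicator A x \<partial>\<mu>)" .
      qed auto
      with u show "\<exists>u. u \<in> borel_measurable (past_space X t) \<and>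
        (AE x in \<mu>. (\<Sum>f\<in>{f\<in>F. past coord t f = a}. w f x) = u (past coord t x))" by blast
    qed
    from bchoice[OF this] obtain u where "\<forall>a\<in>past coord t ` F. u a \<in> borel_measurable (past_space X t) \<and>
        (AE x in \<mu>. (\<Sum>f\<in>{f\<in>F. past coord t f = a}. w f x) = u a (past coord t x))"
      by (rule exE)
    then have u: "\<And>a. a \<in> past coord t ` F \<Longrightarrow> u a \<in> borel_measurable (past_space X t)"
      and u_eq: "\<And>a. a \<in> past coord t ` F \<Longrightarrow>
        AE x in \<mu>. (\<Sum>f\<in>{f\<in>F. past coord t f = a}. w f x) = u a (past coord t x)"
      by auto
    \<comment> \<open>There are finitely many discrete pasts, so one null set serves all of
      them.\<close>
    have u_eq': "AE x in \<mu>. \<forall>a\<in>past coord t ` F. (\<Sum>f\<in>{f\<in>F. past coord t f = a}. w f x) = u a (past coord t x)"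
      using u_eq F(1) by (intro AE_finite_allI) auto
    show "\<exists>u\<in>borel_measurable (past_space X t).
        AE x in \<mu>. (\<integral>\<^sup>+ y. K x y * k (past coord t y) \<partial>\<mu>) = u (past coord t x)"
    proof (intro bexI)
      show "(\<lambda>x. \<Sum>a\<in>past coord t ` F. u a x * h a) \<in> borel_measurable (past_space X t)"
        using u by measurable
      show "AE x in \<mu>. (\<integral>\<^sup>+ y. K x y * k (past coord t y) \<partial>\<mu>) = (\<Sum>a\<in>past coord t ` F. u a (past coord t x) * h a)"
        using u_eq'
      proof eventually_elim
        case (elim x)
        have "(\<integral>\<^sup>+ y. K x y * k (past coord t y) \<partial>\<mu>) =
            (\<Sum>f\<in>F. w f x / emeasure \<mu>' {f} * (h (past coord t f) * emeasure \<mu>' {f}))"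
          unfolding K_int[OF kpt] by (intro sum.cong refl) (simp add: w_k)
        also have "\<dots> = (\<Sum>f\<in>F. w f x * h (past coord t f))"
          by (intro sum.cong refl cancel')
        \<comment> \<open>\<open>h (past coord t f)\<close> is constant on each group of discrete
          paths with the same past, so only the group sums of \<open>w f x\<close> matter.\<close>
        also have "\<dots> = (\<Sum>a\<in>past coord t ` F. \<Sum>f\<in>{f\<in>F. past coord t f = a}. w f x * h (past coord t f))"
          using F(1) by (intro sum.group[symmetric]) auto
        also have "\<dots> = (\<Sum>a\<in>past coord t ` F. (\<Sum>f\<in>{f\<in>F. past coord t f = a}. w f x) * h a)"
          by (simp add: sum_distrib_right)
        also have "\<dots> = (\<Sum>a\<in>past coord t ` F. u a (past coord t x) * h a)"
          by (intro sum.cong refl) (use elim in auto)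
        finally show ?case .
      qed
    qed
  qed
  let ?d = "\<lambda>x y. ennreal (d x y powr p)"
  have d_meas [measurable]: "(\<lambda>z. d (fst z) (snd z)) \<in> borel_measurable (paths \<Otimes>\<^sub>M paths)"
    by (rule metrizes_borel_measurable[OF d second_countable_paths])
  have d_f [measurable]: "(\<lambda>y. ?d f y) \<in> borel_measurable \<mu>" if "f \<in> F" for f
  proof -
    have "(\<lambda>y. d (fst (f, y)) (snd (f, y))) \<in> borel_measurable paths"
      using that F(2) by (intro measurable_compose[OF _ d_meas]) auto
    then show ?thesis by simp
  qed
  interpret Metric_space "topspace (path_topology N X)" d
    using d by (simp add: metrizes_def)
  have d_le: "?d x y \<le> ennreal (2 powr p) * (?d f x + ?d f y)"
    if "f \<in> F" "x \<in> space \<mu>" "y \<in> space \<mu>" for f x y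
  proof -
    have in_top: "f \<in> topspace (path_topology N X)" "x \<in> topspace (path_topology N X)" "y \<in> topspace (path_topology N X)"
      using that F(2) by (auto simp: space)
    have "d x y powr p \<le> (d f x + d f y) powr p"
      using triangle[of x f y] in_top commute[of x f] p by (intro powr_mono2) auto
    also have "\<dots> \<le> 2 powr p * (d f x powr p + d f y powr p)"
      using p by (intro powr_add_le) auto
    finally show ?thesis
      by (simp add: ennreal_mult[symmetric] ennreal_plus[symmetric] ennreal_leI del: ennreal_plus)
  qed
  \<comment> \<open>The first coordinate of \<alpha> almost surely lies in \<open>F\<close>, so its
    cost splits over the atoms into the integrals that also arise from either leg of a
    \<open>K\<close>-move.\<close>
  have cost: "(\<integral>\<^sup>+ w. ?d (fst w) (snd w) \<partial>\<alpha>) = (\<Sum>f\<in>F. \<integral>\<^sup>+ x. w f x * ?d f x \<partial>\<mu>)"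
  proof -
    have "(\<integral>\<^sup>+ w. ?d (fst w) (snd w) \<partial>\<alpha>) = (\<integral>\<^sup>+ w. (\<Sum>f\<in>F. indicator {f} (fst w) * ?d f (snd w)) \<partial>\<alpha>)"
    proof (rule nn_integral_cong_AE)
      have "?d x y = (\<Sum>f\<in>F. indicator {f} x * ?d f y)" if "x \<in> F" for x y
        using F(1) that by (simp add: indicator_def if_distrib if_distribR cong: if_cong)
      then show "AE w in \<alpha>. ?d (fst w) (snd w) = (\<Sum>f\<in>F. indicator {f} (fst w) * ?d f (snd w))"
        using \<alpha>D(5)[OF F(3)] by (auto elim!: eventually_mono)
    qed
    also have "\<dots> = (\<Sum>f\<in>F. \<integral>\<^sup>+ w. indicator {f} (fst w) * ?d f (snd w) \<partial>\<alpha>)"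
    proof (rule nn_integral_sum)
      fix f assume f: "f \<in> F"
      note [measurable] = sing[OF f] d_f[OF f]
      show "(\<lambda>w. indicator {f} (fst w) * ?d f (snd w)) \<in> borel_measurable \<alpha>"
        by measurable
    qed
    also have "\<dots> = (\<Sum>f\<in>F. \<integral>\<^sup>+ x. w f x * ?d f x \<partial>\<mu>)"
      by (intro sum.cong refl w_eq d_f)
    finally show ?thesis .
  qed
  have "(\<integral>\<^sup>+ x. \<integral>\<^sup>+ y. K x y * ?d x y \<partial>\<mu> \<partial>\<mu>) \<le>
      (\<integral>\<^sup>+ x. \<integral>\<^sup>+ y. (\<Sum>f\<in>F. w f x / emeasure \<mu>' {f} * w f y * (ennreal (2 powr p) * (?d f x + ?d f y))) \<partial>\<mu> \<partial>\<mu>)"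
  proof (intro nn_integral_mono)
    fix x y assume xy: "x \<in> space \<mu>" "y \<in> space \<mu>"
    have "K x y * ?d x y = (\<Sum>f\<in>F. w f x / emeasure \<mu>' {f} * w f y * ?d x y)"
      unfolding K_def sum_distrib_right by (intro sum.cong refl) (simp add: divide_ennreal_def mult_ac)
    also have "\<dots> \<le> (\<Sum>f\<in>F. w f x / emeasure \<mu>' {f} * w f y * (ennreal (2 powr p) * (?d f x + ?d f y)))"
      using xy by (intro sum_mono mult_left_mono d_le) auto
    finally show "K x y * ?d x y \<le>
        (\<Sum>f\<in>F. w f x / emeasure \<mu>' {f} * w f y * (ennreal (2 powr p) * (?d f x + ?d f y)))" .
  qed
  also have "\<dots> = (\<integral>\<^sup>+ x. (\<Sum>f\<in>F. w f x / emeasure \<mu>' {f} * ennreal (2 powr p) *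
      (?d f x * emeasure \<mu>' {f} + (\<integral>\<^sup>+ y. w f y * ?d f y \<partial>\<mu>))) \<partial>\<mu>)"
  proof (rule nn_integral_cong)
    fix x
    have "(\<integral>\<^sup>+ y. (\<Sum>f\<in>F. w f x / emeasure \<mu>' {f} * w f y * (ennreal (2 powr p) * (?d f x + ?d f y))) \<partial>\<mu>) =
        (\<Sum>f\<in>F. \<integral>\<^sup>+ y. w f x / emeasure \<mu>' {f} * w f y * (ennreal (2 powr p) * (?d f x + ?d f y)) \<partial>\<mu>)"
    proof (rule nn_integral_sum)
      fix f assume f: "f \<in> F"
      note [measurable] = w_meas[OF f] d_f[OF f]
      show "(\<lambda>y. w f x / emeasure \<mu>' {f} * w f y * (ennreal (2 powr p) * (?d f x + ?d f y))) \<in> borel_measurable \<mu>"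
        by measurable
    qed
    also have "\<dots> = (\<Sum>f\<in>F. w f x / emeasure \<mu>' {f} * ennreal (2 powr p) *
        (?d f x * emeasure \<mu>' {f} + (\<integral>\<^sup>+ y. w f y * ?d f y \<partial>\<mu>)))"
    proof (rule sum.cong[OF refl])
      fix f assume f: "f \<in> F"
      note [measurable] = w_meas[OF f] d_f[OF f]
      have "(\<integral>\<^sup>+ y. w f x / emeasure \<mu>' {f} * w f y * (ennreal (2 powr p) * (?d f x + ?d f y)) \<partial>\<mu>) =
          (\<integral>\<^sup>+ y. w f x / emeasure \<mu>' {f} * ennreal (2 powr p) * (?d f x * w f y + w f y * ?d f y) \<partial>\<mu>)"
        by (intro nn_integral_cong) (simp add: ring_distribs mult_ac)
      also have "\<dots> = w f x / emeasure \<mu>' {f} * ennreal (2 powr p) *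
          (?d f x * emeasure \<mu>' {f} + (\<integral>\<^sup>+ y. w f y * ?d f y \<partial>\<mu>))"
        by (simp add: nn_integral_cmult nn_integral_add w_int[OF f])
      finally show "(\<integral>\<^sup>+ y. w f x / emeasure \<mu>' {f} * w f y * (ennreal (2 powr p) * (?d f x + ?d f y)) \<partial>\<mu>) =
          w f x / emeasure \<mu>' {f} * ennreal (2 powr p) *
          (?d f x * emeasure \<mu>' {f} + (\<integral>\<^sup>+ y. w f y * ?d f y \<partial>\<mu>))" .
    qed
    finally show "(\<integral>\<^sup>+ y. (\<Sum>f\<in>F. w f x / emeasure \<mu>' {f} * w f y * (ennreal (2 powr p) * (?d f x + ?d f y))) \<partial>\<mu>) =
      (\<Sum>f\<in>F. w f x / emeasure \<mu>' {f} * ennreal (2 powr p) *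
        (?d f x * emeasure \<mu>' {f} + (\<integral>\<^sup>+ y. w f y * ?d f y \<partial>\<mu>)))" .
  qed
  also have "\<dots> = (\<integral>\<^sup>+ x. (\<Sum>f\<in>F. ennreal (2 powr p) * (w f x * ?d f x +
      w f x * ((\<integral>\<^sup>+ y. w f y * ?d f y \<partial>\<mu>) / emeasure \<mu>' {f}))) \<partial>\<mu>)"
  \<comment> \<open>In the leg from \<open>f\<close> to \<open>x\<close> the mass of
    \<open>f\<close> cancels at once. In the other leg the quotient is kept until integrating
    \<open>w f x\<close> over \<open>x\<close> produces that mass.\<close>
  proof (intro nn_integral_cong sum.cong refl)
    fix x f assume f: "f \<in> F"
    have "w f x / emeasure \<mu>' {f} * ennreal (2 powr p) * (?d f x * emeasure \<mu>' {f} + I) =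
        ennreal (2 powr p) * (w f x / emeasure \<mu>' {f} * emeasure \<mu>' {f} * ?d f x + w f x * (I / emeasure \<mu>' {f}))" for I
      by (simp add: divide_ennreal_def ring_distribs mult_ac)
    then show "w f x / emeasure \<mu>' {f} * ennreal (2 powr p) * (?d f x * emeasure \<mu>' {f} + (\<integral>\<^sup>+ y. w f y * ?d f y \<partial>\<mu>)) =
        ennreal (2 powr p) * (w f x * ?d f x + w f x * ((\<integral>\<^sup>+ y. w f y * ?d f y \<partial>\<mu>) / emeasure \<mu>' {f}))"
      unfolding cancel[OF f] .
  qed
  also have "\<dots> = (\<Sum>f\<in>F. ennreal (2 powr p) * ((\<integral>\<^sup>+ x. w f x * ?d f x \<partial>\<mu>) + (\<integral>\<^sup>+ x. w f x * ?d f x \<partial>\<mu>)))"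
  proof -
    have meas: "(\<lambda>x. ennreal (2 powr p) * (w f x * ?d f x + w f x * (I / emeasure \<mu>' {f}))) \<in> borel_measurable \<mu>"
      and int: "(\<integral>\<^sup>+ x. ennreal (2 powr p) * (w f x * ?d f x + w f x * (I / emeasure \<mu>' {f})) \<partial>\<mu>) =
        ennreal (2 powr p) * ((\<integral>\<^sup>+ x. w f x * ?d f x \<partial>\<mu>) + I)" if f: "f \<in> F" for f I
    proof -
      note [measurable] = w_meas[OF f] d_f[OF f]
      show "(\<lambda>x. ennreal (2 powr p) * (w f x * ?d f x + w f x * (I / emeasure \<mu>' {f}))) \<in> borel_measurable \<mu>"
        by measurable
      show "(\<integral>\<^sup>+ x. ennreal (2 powr p) * (w f x * ?d f x + w f x * (I / emeasure \<mu>' {f})) \<partial>\<mu>) =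
          ennreal (2 powr p) * ((\<integral>\<^sup>+ x. w f x * ?d f x \<partial>\<mu>) + I)"
        using cancel[OF f, of I]
        by (simp add: nn_integral_cmult nn_integral_add nn_integral_multc w_int[OF f] mult.commute)
    qed
    show ?thesis
      by (subst nn_integral_sum[OF meas]) (auto intro!: sum.cong int)
  qed
  also have "\<dots> = ennreal (2 * 2 powr p) * (\<integral>\<^sup>+ w. ?d (fst w) (snd w) \<partial>\<alpha>)"
    by (simp add: cost sum_distrib_left ennreal_mult mult_2[symmetric] mult_ac)
  finally show ?thesis
    using ker by (intro that) auto
qed

end

section \<open>Smoothing a coupling\<close>

context bicausal_kernel
begin

lemma kernel_measurable' [measurable (raw)]:
  assumes "f \<in> M \<rightarrow>\<^sub>M \<mu>" "g \<in> M \<rightarrow>\<^sub>M \<mu>"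
  shows "(\<lambda>w. K (f w) (g w)) \<in> borel_measurable M"
  using measurable_compose[OF measurable_Pair[OF assms] kernel_measurable] by simp

text \<open>The operator induced by \<open>K\<close> is self-adjoint with respect to \<mu>: Tonelli
  combined with symmetry of \<open>K\<close>.\<close>

lemma kernel_nn_integral_sym:
  assumes [measurable]: "f \<in> borel_measurable \<mu>" "g \<in> borel_measurable \<mu>"
  shows "(\<integral>\<^sup>+ x. g x * (\<integral>\<^sup>+ y. K x y * f y \<partial>\<mu>) \<partial>\<mu>) = (\<integral>\<^sup>+ x. (\<integral>\<^sup>+ y. K x y * g y \<partial>\<mu>) * f x \<partial>\<mu>)"
proof -
  interpret P: pair_sigma_finite \<mu> \<mu> ..
  have "(\<integral>\<^sup>+ x. g x * (\<integral>\<^sup>+ y. K x y * f y \<partial>\<mu>) \<partial>\<mu>) = (\<integral>\<^sup>+ x. \<integral>\<^sup>+ y. g x * (K x y * f y) \<partial>\<mu> \<partial>\<mu>)"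
    by (intro nn_integral_cong) (simp add: nn_integral_cmult)
  also have "\<dots> = (\<integral>\<^sup>+ y. \<integral>\<^sup>+ x. g x * (K x y * f y) \<partial>\<mu> \<partial>\<mu>)"
    by (rule P.Fubini') measurable
  also have "\<dots> = (\<integral>\<^sup>+ y. \<integral>\<^sup>+ x. K y x * g x * f y \<partial>\<mu> \<partial>\<mu>)"
    by (intro nn_integral_cong) (simp add: kernel_sym mult_ac)
  also have "\<dots> = (\<integral>\<^sup>+ x. (\<integral>\<^sup>+ y. K x y * g y \<partial>\<mu>) * f x \<partial>\<mu>)"
    by (intro nn_integral_cong) (simp add: nn_integral_multc)
  finally show ?thesis .
qed

text \<open>Invariance of \<mu>: self-adjointness tested with the constant 1, which the Markov
  property leaves fixed almost everywhere.\<close>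

lemma kernel_nn_integral:
  assumes [measurable]: "f \<in> borel_measurable \<mu>"
  shows "(\<integral>\<^sup>+ x. \<integral>\<^sup>+ y. K x y * f y \<partial>\<mu> \<partial>\<mu>) = (\<integral>\<^sup>+ x. f x \<partial>\<mu>)"
proof -
  have "(\<integral>\<^sup>+ x. \<integral>\<^sup>+ y. K x y * f y \<partial>\<mu> \<partial>\<mu>) = (\<integral>\<^sup>+ x. (\<integral>\<^sup>+ y. K x y \<partial>\<mu>) * f x \<partial>\<mu>)"
    using kernel_nn_integral_sym[of f "\<lambda>_. 1"] by simp
  also have "\<dots> = (\<integral>\<^sup>+ x. f x \<partial>\<mu>)"
    using kernel_markov by (intro nn_integral_cong_AE) (auto elim!: eventually_mono)
  finally show ?thesis .
qed

lemma past_measurable_\<mu> [measurable]: "t \<le> N \<Longrightarrow> past coord t \<in> \<mu> \<rightarrow>\<^sub>M past_space X t"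
  using past_measurable by (simp add: measurable_cong_sets[OF sets_eq refl])

lemma coord_measurable_\<mu> [measurable]: "t \<in> {1..N} \<Longrightarrow> coord t \<in> \<mu> \<rightarrow>\<^sub>M borel_of (X t)"
  using coord_measurable by (simp add: measurable_cong_sets[OF sets_eq refl])

end

lemma emeasure_distr_nn_integral:
  assumes "f \<in> M \<rightarrow>\<^sub>M M'" "A \<in> sets M'"
  shows "emeasure (distr M M' f) A = (\<integral>\<^sup>+ w. indicator A (f w) \<partial>M)"
  using nn_integral_distr[OF assms(1), of "indicator A"] assms(2) by simp

text \<open>Stated for abstract maps so that exchanging the two coordinates yields the anticausal
  case. An indicator in the past of \<eta>' is carried along a chain: \<open>L\<close> turns it into
  \<open>v\<close> of the past of \<eta>, causality under \<open>M\<close> into \<open>h\<close> of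
  the past of \<xi>, and \<open>K\<close> into \<open>u\<close> of the past of \<xi>'. This
  \<open>u\<close> is the function that \<open>cond_indep_varI\<close> asks for.\<close>

lemma cond_indep_kernel_smoothing:
  fixes N :: nat and X :: "nat \<Rightarrow> 'a topology" and Y :: "nat \<Rightarrow> 'b topology"
  assumes KX: "bicausal_kernel N X \<mu> K c" and LY: "bicausal_kernel N Y \<nu> L c'"
    and M: "prob_space M" and \<xi>: "\<xi> \<in> M \<rightarrow>\<^sub>M \<mu>" "distr M \<mu> \<xi> = \<mu>" and \<eta>: "\<eta> \<in> M \<rightarrow>\<^sub>M \<nu>" "distr M \<nu> \<eta> = \<nu>"
    and M': "prob_space M'" and \<xi>': "\<xi>' \<in> M' \<rightarrow>\<^sub>M \<mu>" "distr M' \<mu> \<xi>' = \<mu>" and \<eta>': "\<eta>' \<in> M' \<rightarrow>\<^sub>M \<nu>"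
    and smooth: "\<And>f g. f \<in> borel_measurable \<mu> \<Longrightarrow> g \<in> borel_measurable \<nu> \<Longrightarrow>
      (\<integral>\<^sup>+ w. f (\<xi>' w) * g (\<eta>' w) \<partial>M') =
      (\<integral>\<^sup>+ w. (\<integral>\<^sup>+ x. K (\<xi> w) x * f x \<partial>\<mu>) * (\<integral>\<^sup>+ y. L (\<eta> w) y * g y \<partial>\<nu>) \<partial>M)"
    and ci: "\<And>t. t \<in> {1..<N} \<Longrightarrow> cond_indep_var M (borel_of (X (t + 1))) (\<lambda>w. coord (t + 1) (\<xi> w))
      (past_space Y t) (\<lambda>w. past coord t (\<eta> w)) (past_space X t) (\<lambda>w. past coord t (\<xi> w))"
    and t: "t \<in> {1..<N}"
  shows "cond_indep_var M' (borel_of (X (t + 1))) (\<lambda>w. coord (t + 1) (\<xi>' w))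
      (past_space Y t) (\<lambda>w. past coord t (\<eta>' w)) (past_space X t) (\<lambda>w. past coord t (\<xi>' w))"
proof -
  interpret X: bicausal_kernel N X \<mu> K c by fact
  interpret Y: bicausal_kernel N Y \<nu> L c' by fact
  note [measurable] = \<xi>(1) \<eta>(1) \<xi>'(1) \<eta>'
  have pt [measurable]: "past coord t \<in> \<mu> \<rightarrow>\<^sub>M past_space X t" "past coord t \<in> \<nu> \<rightarrow>\<^sub>M past_space Y t"
    and ct [measurable]: "coord (t + 1) \<in> \<mu> \<rightarrow>\<^sub>M borel_of (X (t + 1))"
    using t by auto
  have int_\<xi>: "(\<integral>\<^sup>+ w. f (\<xi> w) \<partial>M) = (\<integral>\<^sup>+ x. f x \<partial>\<mu>)" if "f \<in> borel_measurable \<mu>" for f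
    using nn_integral_distr[OF \<xi>(1), of f] that by (simp add: \<xi>(2))
  have int_\<xi>': "(\<integral>\<^sup>+ w. f (\<xi>' w) \<partial>M') = (\<integral>\<^sup>+ x. f x \<partial>\<mu>)" if "f \<in> borel_measurable \<mu>" for f
    using nn_integral_distr[OF \<xi>'(1), of f] that by (simp add: \<xi>'(2))
  have int_\<eta>: "(\<integral>\<^sup>+ w. f (\<eta> w) \<partial>M) = (\<integral>\<^sup>+ x. f x \<partial>\<nu>)" if "f \<in> borel_measurable \<nu>" for f
    using nn_integral_distr[OF \<eta>(1), of f] that by (simp add: \<eta>(2))
  have AE_\<eta>: "AE w in M. P (\<eta> w)" if "AE y in \<nu>. P y" for P
    using AE_distrD[OF \<eta>(1), of P, unfolded \<eta>(2)] that by blast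
  show ?thesis
  proof (rule cond_indep_varI[OF M'])
    fix b assume [measurable]: "b \<in> sets (past_space Y t)"
    have fin_b: "(\<integral>\<^sup>+ y. indicator b (past coord t y) \<partial>\<nu>) < \<infinity>"
    proof -
      have "(\<integral>\<^sup>+ y. indicator b (past coord t y) \<partial>\<nu>) \<le> (\<integral>\<^sup>+ y. 1 \<partial>\<nu>)"
        by (intro nn_integral_mono) (auto simp: indicator_def)
      then show ?thesis
        by (simp add: Y.emeasure_space_1 le_less_trans)
    qed
    obtain v where v [measurable]: "v \<in> borel_measurable (past_space Y t)"
      and v_eq: "AE y in \<nu>. (\<integral>\<^sup>+ y'. L y y' * indicator b (past coord t y') \<partial>\<nu>) = v (past coord t y)"
      using Y.kernel_causal[OF t, of "indicator b"] fin_b by auto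
    \<comment> \<open>Finiteness is needed at every link of the chain; it persists because
      \<open>L\<close> leaves \<nu> invariant.\<close>
    have fin_v: "(\<integral>\<^sup>+ w. v (past coord t (\<eta> w)) \<partial>M) < \<infinity>"
    proof -
      have "(\<integral>\<^sup>+ w. v (past coord t (\<eta> w)) \<partial>M) = (\<integral>\<^sup>+ y. v (past coord t y) \<partial>\<nu>)"
        by (rule int_\<eta>) measurable
      also have "\<dots> = (\<integral>\<^sup>+ y. \<integral>\<^sup>+ y'. L y y' * indicator b (past coord t y') \<partial>\<nu> \<partial>\<nu>)"
        using v_eq by (intro nn_integral_cong_AE) (auto elim!: eventually_mono)
      also have "\<dots> < \<infinity>"
        using fin_b by (subst Y.kernel_nn_integral) auto
      finally show ?thesis .
    qed
    obtain h where h [measurable]: "h \<in> borel_measurable (past_space X t)"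
      and h_eq: "\<And>k. k \<in> borel_measurable \<mu> \<Longrightarrow>
        (\<integral>\<^sup>+ w. v (past coord t (\<eta> w)) * k (\<xi> w) \<partial>M) = (\<integral>\<^sup>+ w. h (past coord t (\<xi> w)) * k (\<xi> w) \<partial>M)"
    proof (rule X.cond_indep_path[OF M _ ci t v fin_v])
      show "\<xi> \<in> M \<rightarrow>\<^sub>M X.paths"
        using \<xi>(1) by (simp add: measurable_cong_sets[OF refl X.sets_eq])
    qed (auto simp: measurable_cong_sets[OF X.sets_eq refl])
    have fin_h: "(\<integral>\<^sup>+ x. h (past coord t x) \<partial>\<mu>) < \<infinity>"
    proof -
      have "(\<integral>\<^sup>+ x. h (past coord t x) \<partial>\<mu>) = (\<integral>\<^sup>+ w. h (past coord t (\<xi> w)) \<partial>M)"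
        by (rule int_\<xi>[symmetric]) measurable
      also have "\<dots> = (\<integral>\<^sup>+ w. v (past coord t (\<eta> w)) \<partial>M)"
        using h_eq[of "\<lambda>_. 1"] by simp
      finally show ?thesis
        using fin_v by simp
    qed
    \<comment> \<open>Applying \<open>K\<close> to \<open>h\<close> anticipates self-adjointness:
      below, \<open>K\<close> acts on the test function \<open>f\<close> and has to be moved onto
      \<open>h\<close>.\<close>
    obtain u where u [measurable]: "u \<in> borel_measurable (past_space X t)"
      and u_eq: "AE x in \<mu>. (\<integral>\<^sup>+ x'. K x x' * h (past coord t x') \<partial>\<mu>) = u (past coord t x)"
      using X.kernel_causal[OF t h fin_h] by auto
    show "\<exists>h\<in>borel_measurable (past_space X t). \<forall>a\<in>sets (borel_of (X (t + 1))). \<forall>c\<in>sets (past_space X t).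
      (\<integral>\<^sup>+ w. indicator a (coord (t + 1) (\<xi>' w)) * indicator b (past coord t (\<eta>' w)) *
          indicator c (past coord t (\<xi>' w)) \<partial>M') =
      (\<integral>\<^sup>+ w. indicator a (coord (t + 1) (\<xi>' w)) * h (past coord t (\<xi>' w)) *
          indicator c (past coord t (\<xi>' w)) \<partial>M')"
    proof (intro bexI[OF _ u] ballI)
      fix a c assume [measurable]: "a \<in> sets (borel_of (X (t + 1)))" "c \<in> sets (past_space X t)"
      define f :: "_ \<Rightarrow> ennreal" where "f x = indicator a (coord (t + 1) x) * indicator c (past coord t x)" for x
      have f [measurable]: "f \<in> borel_measurable \<mu>"
        unfolding f_def by measurable
      have "(\<integral>\<^sup>+ w. indicator a (coord (t + 1) (\<xi>' w)) * indicator b (past coord t (\<eta>' w)) *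
          indicator c (past coord t (\<xi>' w)) \<partial>M') = (\<integral>\<^sup>+ w. f (\<xi>' w) * indicator b (past coord t (\<eta>' w)) \<partial>M')"
        by (simp add: f_def mult_ac)
      also have "\<dots> = (\<integral>\<^sup>+ w. (\<integral>\<^sup>+ x. K (\<xi> w) x * f x \<partial>\<mu>) *
          (\<integral>\<^sup>+ y. L (\<eta> w) y * indicator b (past coord t y) \<partial>\<nu>) \<partial>M)"
        by (rule smooth) measurable
      \<comment> \<open>From here on the factor involving \<open>K\<close> is a function of the
        whole path \<xi>, future included. This is why causality is needed with test functions of
        the entire path.\<close>
      also have "\<dots> = (\<integral>\<^sup>+ w. v (past coord t (\<eta> w)) * (\<integral>\<^sup>+ x. K (\<xi> w) x * f x \<partial>\<mu>) \<partial>M)"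
        using AE_\<eta>[OF v_eq] by (intro nn_integral_cong_AE) (auto simp: mult.commute elim!: eventually_mono)
      also have "\<dots> = (\<integral>\<^sup>+ w. h (past coord t (\<xi> w)) * (\<integral>\<^sup>+ x. K (\<xi> w) x * f x \<partial>\<mu>) \<partial>M)"
        by (rule h_eq) measurable
      also have "\<dots> = (\<integral>\<^sup>+ x. h (past coord t x) * (\<integral>\<^sup>+ x'. K x x' * f x' \<partial>\<mu>) \<partial>\<mu>)"
        by (rule int_\<xi>) measurable
      also have "\<dots> = (\<integral>\<^sup>+ x. (\<integral>\<^sup>+ x'. K x x' * h (past coord t x') \<partial>\<mu>) * f x \<partial>\<mu>)"
        by (rule X.kernel_nn_integral_sym) measurable
      also have "\<dots> = (\<integral>\<^sup>+ x. u (past coord t x) * f x \<partial>\<mu>)"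
        using u_eq by (intro nn_integral_cong_AE) (auto elim!: eventually_mono)
      also have "\<dots> = (\<integral>\<^sup>+ w. u (past coord t (\<xi>' w)) * f (\<xi>' w) \<partial>M')"
        by (rule int_\<xi>'[symmetric]) measurable
      also have "\<dots> = (\<integral>\<^sup>+ w. indicator a (coord (t + 1) (\<xi>' w)) * u (past coord t (\<xi>' w)) *
          indicator c (past coord t (\<xi>' w)) \<partial>M')"
        by (simp add: f_def mult_ac)
      finally show "(\<integral>\<^sup>+ w. indicator a (coord (t + 1) (\<xi>' w)) * indicator b (past coord t (\<eta>' w)) *
          indicator c (past coord t (\<xi>' w)) \<partial>M') =
        (\<integral>\<^sup>+ w. indicator a (coord (t + 1) (\<xi>' w)) * u (past coord t (\<xi>' w)) *
          indicator c (past coord t (\<xi>' w)) \<partial>M')" .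
    qed
  qed measurable
qed

section \<open>The moved pair: its law, its marginals and its joint law with the original
  pair\<close>

locale kernel_smoothing =
  X: bicausal_kernel N X \<mu> K c + Y: bicausal_kernel N Y \<nu> L c'
  for N :: nat and X :: "nat \<Rightarrow> 'a topology" and \<mu> K c
    and Y :: "nat \<Rightarrow> 'b topology" and \<nu> L c' +
  fixes \<pi> :: "((nat \<Rightarrow> 'a) \<times> (nat \<Rightarrow> 'b)) measure"
  assumes coupling: "\<pi> \<in> couplings \<mu> \<nu>"
begin

sublocale prob_space \<pi>
  by (rule couplingsD[OF coupling])

sublocale XY: pair_prob_space \<mu> \<nu> ..

sublocale Z: pair_prob_space \<pi> "\<mu> \<Otimes>\<^sub>M \<nu>" ..

lemma sets_\<pi> [measurable_cong]: "sets \<pi> = sets (\<mu> \<Otimes>\<^sub>M \<nu>)"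
  by (rule couplingsD[OF coupling])

lemma proj_measurable [measurable]: "fst \<in> \<pi> \<rightarrow>\<^sub>M \<mu>" "snd \<in> \<pi> \<rightarrow>\<^sub>M \<nu>"
  by measurable

text \<open>Density of the law of the moved pair with respect to the product measure: the densities
  of the moves from \<open>z\<close> to \<open>z'\<close>, averaged over the starting point
  \<open>z\<close>. It inherits the bound \<open>c * c'\<close> pointwise.\<close>

definition smooth_density :: "(nat \<Rightarrow> 'a) \<times> (nat \<Rightarrow> 'b) \<Rightarrow> ennreal" where
  "smooth_density z' = (\<integral>\<^sup>+ z. K (fst z) (fst z') * L (snd z) (snd z') \<partial>\<pi>)"

definition smooth :: "((nat \<Rightarrow> 'a) \<times> (nat \<Rightarrow> 'b)) measure" where
  "smooth = density (\<mu> \<Otimes>\<^sub>M \<nu>) smooth_density"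

text \<open>Law of the original pair together with the moved one, given by its density on the
  product of \<pi> with the reference measure; it serves as the competitor in
  \<open>W_c\<close>.\<close>

definition joint :: "(((nat \<Rightarrow> 'a) \<times> (nat \<Rightarrow> 'b)) \<times> ((nat \<Rightarrow> 'a) \<times> (nat \<Rightarrow> 'b))) measure" where
  "joint = density (\<pi> \<Otimes>\<^sub>M (\<mu> \<Otimes>\<^sub>M \<nu>)) (\<lambda>(z, z'). K (fst z) (fst z') * L (snd z) (snd z'))"

lemma sets_smooth [measurable_cong, simp]: "sets smooth = sets (\<mu> \<Otimes>\<^sub>M \<nu>)"
  by (simp add: smooth_def)

lemma sets_joint [measurable_cong, simp]: "sets joint = sets (\<pi> \<Otimes>\<^sub>M (\<mu> \<Otimes>\<^sub>M \<nu>))"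
  by (simp add: joint_def)

lemma smooth_density_measurable [measurable]: "smooth_density \<in> borel_measurable (\<mu> \<Otimes>\<^sub>M \<nu>)"
  unfolding smooth_density_def by measurable

lemma smooth_density_le: "smooth_density z' \<le> c * c'"
proof -
  have "smooth_density z' \<le> (\<integral>\<^sup>+ z. c * c' \<partial>\<pi>)"
    unfolding smooth_density_def by (intro nn_integral_mono mult_mono X.kernel_le Y.kernel_le) auto
  then show ?thesis
    by (simp add: emeasure_space_1)
qed

lemma nn_integral_joint:
  assumes [measurable]: "f \<in> borel_measurable (\<pi> \<Otimes>\<^sub>M (\<mu> \<Otimes>\<^sub>M \<nu>))"
  shows "(\<integral>\<^sup>+ w. f w \<partial>joint) =
    (\<integral>\<^sup>+ z. \<integral>\<^sup>+ z'. K (fst z) (fst z') * L (snd z) (snd z') * f (z, z') \<partial>(\<mu> \<Otimes>\<^sub>M \<nu>) \<partial>\<pi>)"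
proof -
  have "(\<integral>\<^sup>+ w. f w \<partial>joint) =
      (\<integral>\<^sup>+ w. K (fst (fst w)) (fst (snd w)) * L (snd (fst w)) (snd (snd w)) * f w \<partial>(\<pi> \<Otimes>\<^sub>M (\<mu> \<Otimes>\<^sub>M \<nu>)))"
    unfolding joint_def by (subst nn_integral_density) (auto simp: case_prod_beta')
  also have "\<dots> = (\<integral>\<^sup>+ z. \<integral>\<^sup>+ z'. K (fst z) (fst z') * L (snd z) (snd z') * f (z, z') \<partial>(\<mu> \<Otimes>\<^sub>M \<nu>) \<partial>\<pi>)"
    by (subst XY.nn_integral_fst[symmetric]) auto
  finally show ?thesis .
qed

text \<open>Expresses that, given the starting point, the two coordinates move
  independently.\<close>

lemma nn_integral_joint_prod:
  assumes [measurable]: "f \<in> borel_measurable (\<pi> \<Otimes>\<^sub>M \<mu>)" "g \<in> borel_measurable (\<pi> \<Otimes>\<^sub>M \<nu>)"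
  shows "(\<integral>\<^sup>+ w. f (fst w, fst (snd w)) * g (fst w, snd (snd w)) \<partial>joint) =
    (\<integral>\<^sup>+ z. (\<integral>\<^sup>+ x. K (fst z) x * f (z, x) \<partial>\<mu>) * (\<integral>\<^sup>+ y. L (snd z) y * g (z, y) \<partial>\<nu>) \<partial>\<pi>)"
proof (subst nn_integral_joint)
  show "(\<integral>\<^sup>+ z. \<integral>\<^sup>+ z'. K (fst z) (fst z') * L (snd z) (snd z') *
        (f (fst (z, z'), fst (snd (z, z'))) * g (fst (z, z'), snd (snd (z, z')))) \<partial>(\<mu> \<Otimes>\<^sub>M \<nu>) \<partial>\<pi>) =
    (\<integral>\<^sup>+ z. (\<integral>\<^sup>+ x. K (fst z) x * f (z, x) \<partial>\<mu>) * (\<integral>\<^sup>+ y. L (snd z) y * g (z, y) \<partial>\<nu>) \<partial>\<pi>)"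
  proof (rule nn_integral_cong)
    fix z assume [measurable]: "z \<in> space \<pi>"
    have [measurable]: "fst z \<in> space \<mu>" "snd z \<in> space \<nu>"
      using measurable_space[OF proj_measurable(1)] measurable_space[OF proj_measurable(2)] \<open>z \<in> space \<pi>\<close> by auto
    have "(\<integral>\<^sup>+ z'. K (fst z) (fst z') * L (snd z) (snd z') *
        (f (fst (z, z'), fst (snd (z, z'))) * g (fst (z, z'), snd (snd (z, z')))) \<partial>(\<mu> \<Otimes>\<^sub>M \<nu>)) =
        (\<integral>\<^sup>+ z'. (K (fst z) (fst z') * f (z, fst z')) * (L (snd z) (snd z') * g (z, snd z')) \<partial>(\<mu> \<Otimes>\<^sub>M \<nu>))"
      by (simp add: mult_ac)
    also have "\<dots> = (\<integral>\<^sup>+ x. \<integral>\<^sup>+ y. (K (fst z) x * f (z, x)) * (L (snd z) y * g (z, y)) \<partial>\<nu> \<partial>\<mu>)"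
      by (subst Y.nn_integral_fst[symmetric]) auto
    also have "\<dots> = (\<integral>\<^sup>+ x. K (fst z) x * f (z, x) \<partial>\<mu>) * (\<integral>\<^sup>+ y. L (snd z) y * g (z, y) \<partial>\<nu>)"
      by (simp add: nn_integral_cmult nn_integral_multc)
    finally show "(\<integral>\<^sup>+ z'. K (fst z) (fst z') * L (snd z) (snd z') *
        (f (fst (z, z'), fst (snd (z, z'))) * g (fst (z, z'), snd (snd (z, z')))) \<partial>(\<mu> \<Otimes>\<^sub>M \<nu>)) =
      (\<integral>\<^sup>+ x. K (fst z) x * f (z, x) \<partial>\<mu>) * (\<integral>\<^sup>+ y. L (snd z) y * g (z, y) \<partial>\<nu>)" .
  qed
qed measurable

lemma nn_integral_smooth:
  assumes [measurable]: "f \<in> borel_measurable (\<mu> \<Otimes>\<^sub>M \<nu>)"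
  shows "(\<integral>\<^sup>+ z'. f z' \<partial>smooth) = (\<integral>\<^sup>+ w. f (snd w) \<partial>joint)"
proof -
  have "(\<integral>\<^sup>+ z'. f z' \<partial>smooth) = (\<integral>\<^sup>+ z'. \<integral>\<^sup>+ z. K (fst z) (fst z') * L (snd z) (snd z') * f z' \<partial>\<pi> \<partial>(\<mu> \<Otimes>\<^sub>M \<nu>))"
  proof -
    have "(\<integral>\<^sup>+ z. K (fst z) (fst z') * L (snd z) (snd z') * f z' \<partial>\<pi>) = smooth_density z' * f z'"
      if z': "z' \<in> space (\<mu> \<Otimes>\<^sub>M \<nu>)" for z'
    proof -
      have [measurable]: "fst z' \<in> space \<mu>" "snd z' \<in> space \<nu>"
        using z' by (auto simp: space_pair_measure)
      show ?thesis
        unfolding smooth_density_def by (rule nn_integral_multc) measurable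
    qed
    then show ?thesis
      unfolding smooth_def by (subst nn_integral_density) (auto intro!: nn_integral_cong)
  qed
  also have "\<dots> = (\<integral>\<^sup>+ z. \<integral>\<^sup>+ z'. K (fst z) (fst z') * L (snd z) (snd z') * f z' \<partial>(\<mu> \<Otimes>\<^sub>M \<nu>) \<partial>\<pi>)"
    by (rule Z.Fubini') measurable
  also have "\<dots> = (\<integral>\<^sup>+ w. f (snd w) \<partial>joint)"
    by (subst nn_integral_joint) auto
  finally show ?thesis .
qed

lemma AE_kernels: "AE z in \<pi>. (\<integral>\<^sup>+ x. K (fst z) x \<partial>\<mu>) = 1" "AE z in \<pi>. (\<integral>\<^sup>+ y. L (snd z) y \<partial>\<nu>) = 1"
  using couplingsD(5)[OF coupling X.kernel_markov] couplingsD(6)[OF coupling Y.kernel_markov] by auto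

text \<open>The move of the other coordinate integrates out by the Markov property of
  \<open>L\<close>.\<close>

lemma nn_integral_joint_fst:
  assumes [measurable]: "f \<in> borel_measurable (\<pi> \<Otimes>\<^sub>M \<mu>)"
  shows "(\<integral>\<^sup>+ w. f (fst w, fst (snd w)) \<partial>joint) = (\<integral>\<^sup>+ z. \<integral>\<^sup>+ x. K (fst z) x * f (z, x) \<partial>\<mu> \<partial>\<pi>)"
  using nn_integral_joint_prod[of f "\<lambda>_. 1"] AE_kernels(2)
  by (auto intro!: nn_integral_cong_AE elim!: eventually_mono)

lemma nn_integral_joint_snd:
  assumes [measurable]: "g \<in> borel_measurable (\<pi> \<Otimes>\<^sub>M \<nu>)"
  shows "(\<integral>\<^sup>+ w. g (fst w, snd (snd w)) \<partial>joint) = (\<integral>\<^sup>+ z. \<integral>\<^sup>+ y. L (snd z) y * g (z, y) \<partial>\<nu> \<partial>\<pi>)"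
  using nn_integral_joint_prod[of "\<lambda>_. 1" g] AE_kernels(1)
  by (auto intro!: nn_integral_cong_AE elim!: eventually_mono)

lemma nn_integral_smooth_prod:
  assumes [measurable]: "f \<in> borel_measurable \<mu>" "g \<in> borel_measurable \<nu>"
  shows "(\<integral>\<^sup>+ z. f (fst z) * g (snd z) \<partial>smooth) =
    (\<integral>\<^sup>+ z. (\<integral>\<^sup>+ x. K (fst z) x * f x \<partial>\<mu>) * (\<integral>\<^sup>+ y. L (snd z) y * g y \<partial>\<nu>) \<partial>\<pi>)"
  using nn_integral_joint_prod[of "\<lambda>w. f (snd w)" "\<lambda>w. g (snd w)"]
    nn_integral_smooth[of "\<lambda>z. f (fst z) * g (snd z)"] by simp

text \<open>Each coordinate moves by its own kernel, which leaves its marginal invariant.\<close>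

lemma smooth_marginals: "distr smooth \<mu> fst = \<mu>" "distr smooth \<nu> snd = \<nu>"
proof -
  show "distr smooth \<mu> fst = \<mu>"
  proof (rule measure_eqI)
    fix A assume "A \<in> sets (distr smooth \<mu> fst)"
    then have [measurable]: "A \<in> sets \<mu>" by simp
    have "emeasure (distr smooth \<mu> fst) A = (\<integral>\<^sup>+ z. indicator A (fst z) \<partial>smooth)"
      by (rule emeasure_distr_nn_integral) measurable
    also have "\<dots> = (\<integral>\<^sup>+ z. \<integral>\<^sup>+ x. K (fst z) x * indicator A x \<partial>\<mu> \<partial>\<pi>)"
      using nn_integral_smooth[of "\<lambda>z. indicator A (fst z)"] nn_integral_joint_fst[of "\<lambda>w. indicator A (snd w)"]
      by simp
    also have "\<dots> = (\<integral>\<^sup>+ x. \<integral>\<^sup>+ x'. K x x' * indicator A x' \<partial>\<mu> \<partial>\<mu>)"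
      by (rule couplingsD(3)[OF coupling]) measurable
    also have "\<dots> = emeasure \<mu> A"
      by (subst X.kernel_nn_integral) auto
    finally show "emeasure (distr smooth \<mu> fst) A = emeasure \<mu> A" .
  qed simp
  show "distr smooth \<nu> snd = \<nu>"
  proof (rule measure_eqI)
    fix A assume "A \<in> sets (distr smooth \<nu> snd)"
    then have [measurable]: "A \<in> sets \<nu>" by simp
    have "emeasure (distr smooth \<nu> snd) A = (\<integral>\<^sup>+ z. indicator A (snd z) \<partial>smooth)"
      by (rule emeasure_distr_nn_integral) measurable
    also have "\<dots> = (\<integral>\<^sup>+ z. \<integral>\<^sup>+ y. L (snd z) y * indicator A y \<partial>\<nu> \<partial>\<pi>)"
      using nn_integral_smooth[of "\<lambda>z. indicator A (snd z)"] nn_integral_joint_snd[of "\<lambda>w. indicator A (snd w)"]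
      by simp
    also have "\<dots> = (\<integral>\<^sup>+ y. \<integral>\<^sup>+ y'. L y y' * indicator A y' \<partial>\<nu> \<partial>\<nu>)"
      by (rule couplingsD(4)[OF coupling]) measurable
    also have "\<dots> = emeasure \<nu> A"
      by (subst Y.kernel_nn_integral) auto
    finally show "emeasure (distr smooth \<nu> snd) A = emeasure \<nu> A" .
  qed simp
qed

lemma smooth_in_couplings: "smooth \<in> couplings \<mu> \<nu>"
proof -
  \<comment> \<open>The total mass is read off from a marginal, since projecting preserves
    it.\<close>
  have "prob_space (distr smooth \<mu> fst)"
    unfolding smooth_marginals by (rule X.prob_space_axioms)
  then have "prob_space smooth"
    by (rule prob_space_distrD[rotated]) measurable
  then show ?thesis
    by (simp add: couplings_def smooth_marginals)
qed

lemma joint_in_couplings: "joint \<in> couplings \<pi> smooth"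
proof -
  have 1: "distr joint \<pi> fst = \<pi>"
  proof (rule measure_eqI)
    fix A assume "A \<in> sets (distr joint \<pi> fst)"
    then have [measurable]: "A \<in> sets \<pi>" by simp
    have "emeasure (distr joint \<pi> fst) A = (\<integral>\<^sup>+ w. indicator A (fst w) \<partial>joint)"
      by (rule emeasure_distr_nn_integral) measurable
    also have "\<dots> = (\<integral>\<^sup>+ z. \<integral>\<^sup>+ x. K (fst z) x * indicator A z \<partial>\<mu> \<partial>\<pi>)"
      using nn_integral_joint_fst[of "\<lambda>w. indicator A (fst w)"] by simp
    also have "\<dots> = (\<integral>\<^sup>+ z. indicator A z \<partial>\<pi>)"
    proof (rule nn_integral_cong_AE)
      show "AE z in \<pi>. (\<integral>\<^sup>+ x. K (fst z) x * indicator A z \<partial>\<mu>) = indicator A z"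
        using AE_kernels(1) by eventually_elim (simp add: indicator_def)
    qed
    finally show "emeasure (distr joint \<pi> fst) A = emeasure \<pi> A"
      by simp
  qed simp
  have 2: "distr joint smooth snd = smooth"
  proof (rule measure_eqI)
    fix A assume "A \<in> sets (distr joint smooth snd)"
    then have [measurable]: "A \<in> sets (\<mu> \<Otimes>\<^sub>M \<nu>)" by simp
    have "emeasure (distr joint smooth snd) A = (\<integral>\<^sup>+ w. indicator A (snd w) \<partial>joint)"
      by (rule emeasure_distr_nn_integral) measurable
    then show "emeasure (distr joint smooth snd) A = emeasure smooth A"
      by (simp add: nn_integral_smooth[symmetric])
  qed simp
  have "prob_space (distr joint \<pi> fst)"
    unfolding 1 by (rule prob_space_axioms)
  then have "prob_space joint"
    by (rule prob_space_distrD[rotated]) measurable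
  moreover have "sets joint = sets (\<pi> \<Otimes>\<^sub>M smooth)"
    by (simp cong: sets_pair_measure_cong)
  ultimately show ?thesis
    using 1 2 by (simp add: couplings_def)
qed

lemma causal_smooth:
  assumes "causal N X coord Y coord \<pi>"
  shows "causal N X coord Y coord smooth"
  unfolding causal_def
proof
  fix t assume "t \<in> {1..<N}"
  show "cond_indep_var smooth (borel_of (X (t + 1))) (\<lambda>w. coord (t + 1) (fst w))
      (past_space Y t) (\<lambda>w. past coord t (snd w)) (past_space X t) (\<lambda>w. past coord t (fst w))"
  proof (rule cond_indep_kernel_smoothing[OF X.bicausal_kernel_axioms Y.bicausal_kernel_axioms
        prob_space_axioms _ _ _ _ couplingsD(1)[OF smooth_in_couplings]])
    show "(\<integral>\<^sup>+ z. f (fst z) * g (snd z) \<partial>smooth) =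
        (\<integral>\<^sup>+ z. (\<integral>\<^sup>+ x. K (fst z) x * f x \<partial>\<mu>) * (\<integral>\<^sup>+ y. L (snd z) y * g y \<partial>\<nu>) \<partial>\<pi>)"
      if "f \<in> borel_measurable \<mu>" "g \<in> borel_measurable \<nu>" for f g
      using nn_integral_smooth_prod[OF that] by (simp only: mult.commute)
    show "distr \<pi> \<mu> fst = \<mu>" "distr \<pi> \<nu> snd = \<nu>"
      using coupling by (auto simp: couplings_def)
    show "cond_indep_var \<pi> (borel_of (X (s + 1))) (\<lambda>w. coord (s + 1) (fst w))
      (past_space Y s) (\<lambda>w. past coord s (snd w)) (past_space X s) (\<lambda>w. past coord s (fst w))"
      if "s \<in> {1..<N}" for s
      using assms that by (simp add: causal_def)
  qed (use \<open>t \<in> {1..<N}\<close> smooth_marginals in auto)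
qed

text \<open>The argument of \<open>causal_smooth\<close> with \<open>L\<close> and
  \<open>snd\<close> in the roles of \<open>K\<close> and \<open>fst\<close>.\<close>

lemma anticausal_smooth:
  assumes "anticausal N X coord Y coord \<pi>"
  shows "anticausal N X coord Y coord smooth"
  unfolding anticausal_def
proof
  fix t assume "t \<in> {1..<N}"
  show "cond_indep_var smooth (borel_of (Y (t + 1))) (\<lambda>w. coord (t + 1) (snd w))
      (past_space X t) (\<lambda>w. past coord t (fst w)) (past_space Y t) (\<lambda>w. past coord t (snd w))"
  proof (rule cond_indep_kernel_smoothing[OF Y.bicausal_kernel_axioms X.bicausal_kernel_axioms
        prob_space_axioms _ _ _ _ couplingsD(1)[OF smooth_in_couplings]])
    show "(\<integral>\<^sup>+ z. f (snd z) * g (fst z) \<partial>smooth) =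
        (\<integral>\<^sup>+ z. (\<integral>\<^sup>+ x. L (snd z) x * f x \<partial>\<nu>) * (\<integral>\<^sup>+ y. K (fst z) y * g y \<partial>\<mu>) \<partial>\<pi>)"
      if "f \<in> borel_measurable \<nu>" "g \<in> borel_measurable \<mu>" for f g
      using nn_integral_smooth_prod[OF that(2,1)] by (simp only: mult.commute)
    show "distr \<pi> \<nu> snd = \<nu>" "distr \<pi> \<mu> fst = \<mu>"
      using coupling by (auto simp: couplings_def)
    show "cond_indep_var \<pi> (borel_of (Y (s + 1))) (\<lambda>w. coord (s + 1) (snd w))
      (past_space X s) (\<lambda>w. past coord s (fst w)) (past_space Y s) (\<lambda>w. past coord s (snd w))"
      if "s \<in> {1..<N}" for s
      using assms that by (simp add: anticausal_def)
  qed (use \<open>t \<in> {1..<N}\<close> smooth_marginals in auto)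
qed

end

section \<open>Causality and cost of the joint law on the product path space\<close>

context kernel_smoothing
begin

abbreviation XY :: "nat \<Rightarrow> ('a \<times> 'b) topology" where
  "XY t \<equiv> prod_topology (X t) (Y t)"

lemma sets_XY: "t \<in> {1..N} \<Longrightarrow> sets (borel_of (XY t)) = sets (borel_of (X t) \<Otimes>\<^sub>M borel_of (Y t))"
  by (intro sets_borel_of_prod_topology polish_topology_imp_second_countable X.polish Y.polish)

lemma coord_pair_measurable: "t \<in> {1..N} \<Longrightarrow> coord_pair t \<in> \<mu> \<Otimes>\<^sub>M \<nu> \<rightarrow>\<^sub>M borel_of (XY t)"
  unfolding measurable_cong_sets[OF refl sets_XY] coord_pair_def[abs_def]
  using X.coord_measurable_\<mu>[of t] Y.coord_measurable_\<mu>[of t] by (simp add: coord_def[abs_def])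

lemma past_coord_pair_measurable: "t \<le> N \<Longrightarrow> past coord_pair t \<in> \<mu> \<Otimes>\<^sub>M \<nu> \<rightarrow>\<^sub>M past_space XY t"
  unfolding past_def[abs_def] past_space_def by (intro measurable_restrict coord_pair_measurable) auto

text \<open>Reassembles a past of the product path from its two component pasts. This lets events in
  \<open>past_space XY t\<close> be tested on rectangles, where the kernels \<open>K\<close> and
  \<open>L\<close> act separately.\<close>

definition pair_past :: "nat \<Rightarrow> (nat \<Rightarrow> 'a) \<Rightarrow> (nat \<Rightarrow> 'b) \<Rightarrow> nat \<Rightarrow> 'a \<times> 'b" where
  "pair_past t p q = (\<lambda>s\<in>{1..t}. (p s, q s))"

lemma past_coord_pair: "past coord_pair t z = pair_past t (past coord t (fst z)) (past coord t (snd z))"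
  by (auto simp: past_def pair_past_def coord_pair_def coord_def)

lemma pair_past_measurable:
  assumes "t \<le> N"
  shows "(\<lambda>z. pair_past t (fst z) (snd z)) \<in> past_space X t \<Otimes>\<^sub>M past_space Y t \<rightarrow>\<^sub>M past_space XY t"
  unfolding pair_past_def past_space_def
proof (rule measurable_restrict)
  fix s assume s: "s \<in> {1..t}"
  then have N: "s \<in> {1..N}" using assms by auto
  have [measurable]: "(\<lambda>p. p s) \<in> PiM {1..t} (\<lambda>s. borel_of (X s)) \<rightarrow>\<^sub>M borel_of (X s)"
    "(\<lambda>p. p s) \<in> PiM {1..t} (\<lambda>s. borel_of (Y s)) \<rightarrow>\<^sub>M borel_of (Y s)"
    using s by (auto intro: measurable_component_singleton)
  show "(\<lambda>z. (fst z s, snd z s)) \<in> PiM {1..t} (\<lambda>s. borel_of (X s)) \<Otimes>\<^sub>M PiM {1..t} (\<lambda>s. borel_of (Y s)) \<rightarrow>\<^sub>M borel_of (XY s)"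
    unfolding measurable_cong_sets[OF refl sets_XY[OF N]] by measurable
qed

lemma past_fst_snd:
  "past coord t (fst z) = (\<lambda>s\<in>{1..t}. fst (past coord_pair t z s))"
  "past coord t (snd z) = (\<lambda>s\<in>{1..t}. snd (past coord_pair t z s))"
  by (auto simp: past_def coord_pair_def coord_def)

lemma past_fst_snd_measurable:
  assumes "t \<le> N"
  shows "(\<lambda>r. \<lambda>s\<in>{1..t}. fst (r s)) \<in> past_space XY t \<rightarrow>\<^sub>M past_space X t"
    and "(\<lambda>r. \<lambda>s\<in>{1..t}. snd (r s)) \<in> past_space XY t \<rightarrow>\<^sub>M past_space Y t"
  unfolding past_space_def
proof (safe intro!: measurable_restrict)
  fix s assume s: "s \<in> {1..t}"
  then have N: "s \<in> {1..N}" using assms by auto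
  have "(\<lambda>r. r s) \<in> PiM {1..t} (\<lambda>s. borel_of (XY s)) \<rightarrow>\<^sub>M borel_of (XY s)"
    using s by (rule measurable_component_singleton)
  then have [measurable]: "(\<lambda>r. r s) \<in> PiM {1..t} (\<lambda>s. borel_of (XY s)) \<rightarrow>\<^sub>M borel_of (X s) \<Otimes>\<^sub>M borel_of (Y s)"
    unfolding measurable_cong_sets[OF refl sets_XY[OF N]] .
  show "(\<lambda>r. fst (r s)) \<in> PiM {1..t} (\<lambda>s. borel_of (XY s)) \<rightarrow>\<^sub>M borel_of (X s)"
    "(\<lambda>r. snd (r s)) \<in> PiM {1..t} (\<lambda>s. borel_of (XY s)) \<rightarrow>\<^sub>M borel_of (Y s)"
    by measurable
qed

text \<open>Given the entire starting pair, the probability that the component pasts of the moved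
  pair lie in \<open>a1\<close> and \<open>a2\<close> is \<open>u\<close> of the past of x times
  \<open>v\<close> of the past of y. It thus depends on the past of the starting pair only, so that
  past screens off the next starting component from the moved past.\<close>

lemma causal_joint: "causal N XY coord_pair XY coord_pair joint"
  unfolding causal_def
proof
  fix t assume t: "t \<in> {1..<N}"
  let ?P = "past coord_pair t"
  have cp [measurable]: "coord_pair (t + 1) \<in> \<mu> \<Otimes>\<^sub>M \<nu> \<rightarrow>\<^sub>M borel_of (XY (t + 1))"
    using t by (intro coord_pair_measurable) auto
  have P [measurable]: "?P \<in> \<mu> \<Otimes>\<^sub>M \<nu> \<rightarrow>\<^sub>M past_space XY t"
    using t by (intro past_coord_pair_measurable) auto
  have pt [measurable]: "past coord t \<in> \<mu> \<rightarrow>\<^sub>M past_space X t" "past coord t \<in> \<nu> \<rightarrow>\<^sub>M past_space Y t"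
    using t by auto
  have fs [measurable]: "(\<lambda>r. \<lambda>s\<in>{1..t}. fst (r s)) \<in> past_space XY t \<rightarrow>\<^sub>M past_space X t"
    "(\<lambda>r. \<lambda>s\<in>{1..t}. snd (r s)) \<in> past_space XY t \<rightarrow>\<^sub>M past_space Y t"
    using t past_fst_snd_measurable[of t] by simp_all
  have joint: "prob_space joint"
    by (rule couplingsD[OF joint_in_couplings])
  have ind_fin: "(\<integral>\<^sup>+ w. indicator A (f w) \<partial>M) < \<infinity>" if "prob_space M" for M :: "'z measure" and A and f :: "'z \<Rightarrow> 'y"
  proof -
    have "(\<integral>\<^sup>+ w. indicator A (f w) \<partial>M) \<le> (\<integral>\<^sup>+ w. 1 \<partial>M)"
      by (intro nn_integral_mono) (auto simp: indicator_def)
    then show ?thesis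
      using prob_space.emeasure_space_1[OF that] by (simp add: le_less_trans)
  qed
  \<comment> \<open>Proved with the two variables exchanged: the function required by
    \<open>cond_indep_varI\<close> is then the conditional expectation of an event in the next
    starting component, which can be taken under \<pi> alone.\<close>
  have "cond_indep_var joint (past_space XY t) (\<lambda>w. ?P (snd w)) (borel_of (XY (t + 1))) (\<lambda>w. coord_pair (t + 1) (fst w))
      (past_space XY t) (\<lambda>w. ?P (fst w))"
  proof (rule cond_indep_varI[OF joint])
    fix b assume [measurable]: "b \<in> sets (borel_of (XY (t + 1)))"
    obtain r where r [measurable]: "r \<in> borel_measurable (past_space XY t)"
      and r_eq: "\<And>k. k \<in> borel_measurable (past_space XY t) \<Longrightarrow>
        (\<integral>\<^sup>+ z. indicator b (coord_pair (t + 1) z) * k (?P z) \<partial>\<pi>) = (\<integral>\<^sup>+ z. r (?P z) * k (?P z) \<partial>\<pi>)"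
    proof (rule nn_cond_exp_given_map[OF finite_measure_axioms])
      show "?P \<in> \<pi> \<rightarrow>\<^sub>M past_space XY t" "(\<lambda>z. indicator b (coord_pair (t + 1) z)) \<in> borel_measurable \<pi>"
        by measurable
    qed blast
    show "\<exists>h\<in>borel_measurable (past_space XY t). \<forall>a\<in>sets (past_space XY t). \<forall>c\<in>sets (past_space XY t).
      (\<integral>\<^sup>+ w. indicator a (?P (snd w)) * indicator b (coord_pair (t + 1) (fst w)) * indicator c (?P (fst w)) \<partial>joint) =
      (\<integral>\<^sup>+ w. indicator a (?P (snd w)) * h (?P (fst w)) * indicator c (?P (fst w)) \<partial>joint)"
    proof (intro bexI[OF _ r] ballI)
      fix a c assume [measurable]: "a \<in> sets (past_space XY t)" "c \<in> sets (past_space XY t)"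
      define f1 :: "_ \<Rightarrow> ennreal" where "f1 z = indicator b (coord_pair (t + 1) z) * indicator c (?P z)" for z
      define f2 :: "_ \<Rightarrow> ennreal" where "f2 z = r (?P z) * indicator c (?P z)" for z
      have f_meas [measurable]: "f1 \<in> borel_measurable (\<mu> \<Otimes>\<^sub>M \<nu>)" "f2 \<in> borel_measurable (\<mu> \<Otimes>\<^sub>M \<nu>)"
        unfolding f1_def f2_def by measurable
      \<comment> \<open>\<open>f1\<close> and \<open>f2\<close> have the same conditional
        expectation given the past of the starting pair, so they are interchangeable against any
        function of that past.\<close>
      have f_eq: "(\<integral>\<^sup>+ z. f1 z * k (?P z) \<partial>\<pi>) = (\<integral>\<^sup>+ z. f2 z * k (?P z) \<partial>\<pi>)"
        if [measurable]: "k \<in> borel_measurable (past_space XY t)" for k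
        using r_eq[of "\<lambda>p. indicator c p * k p"] by (simp add: f1_def f2_def mult_ac)
      have "(\<integral>\<^sup>+ w. f1 (fst w) * indicator a (pair_past t (past coord t (fst (snd w))) (past coord t (snd (snd w)))) \<partial>joint) =
          (\<integral>\<^sup>+ w. f2 (fst w) * indicator a (pair_past t (past coord t (fst (snd w))) (past coord t (snd (snd w)))) \<partial>joint)"
      \<comment> \<open>A general event \<open>a\<close> in the pair past is reduced to rectangles
        of component pasts.\<close>
      proof (rule nn_integral_eq_of_rectangles[where T="past_space X t" and R="past_space Y t"
            and k="\<lambda>z. indicator a (pair_past t (fst z) (snd z))", simplified fst_conv snd_conv])
        fix a1 a2 assume [measurable]: "a1 \<in> sets (past_space X t)" "a2 \<in> sets (past_space Y t)"
        obtain u where u [measurable]: "u \<in> borel_measurable (past_space X t)"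
          and u_eq: "AE x in \<mu>. (\<integral>\<^sup>+ x'. K x x' * indicator a1 (past coord t x') \<partial>\<mu>) = u (past coord t x)"
          using X.kernel_causal[OF t, of "indicator a1"] ind_fin[OF X.prob_space_axioms] by auto
        obtain v where v [measurable]: "v \<in> borel_measurable (past_space Y t)"
          and v_eq: "AE y in \<nu>. (\<integral>\<^sup>+ y'. L y y' * indicator a2 (past coord t y') \<partial>\<nu>) = v (past coord t y)"
          using Y.kernel_causal[OF t, of "indicator a2"] ind_fin[OF Y.prob_space_axioms] by auto
        \<comment> \<open>The conditional probability of the rectangle as a function of the product
          past, obtained by splitting that past into its components.\<close>
        define k where "k p = u (\<lambda>s\<in>{1..t}. fst (p s)) * v (\<lambda>s\<in>{1..t}. snd (p s))" for p :: "nat \<Rightarrow> 'a \<times> 'b"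
        have k [measurable]: "k \<in> borel_measurable (past_space XY t)"
          unfolding k_def by measurable
        have int: "(\<integral>\<^sup>+ w. f (fst w) * indicator a1 (past coord t (fst (snd w))) * indicator a2 (past coord t (snd (snd w))) \<partial>joint) =
            (\<integral>\<^sup>+ z. f z * k (?P z) \<partial>\<pi>)" if [measurable]: "f \<in> borel_measurable (\<mu> \<Otimes>\<^sub>M \<nu>)" for f
        proof -
          have "(\<integral>\<^sup>+ w. f (fst w) * indicator a1 (past coord t (fst (snd w))) * indicator a2 (past coord t (snd (snd w))) \<partial>joint) =
            (\<integral>\<^sup>+ z. (\<integral>\<^sup>+ x. K (fst z) x * (f z * indicator a1 (past coord t x)) \<partial>\<mu>) *
              (\<integral>\<^sup>+ y. L (snd z) y * indicator a2 (past coord t y) \<partial>\<nu>) \<partial>\<pi>)"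
            using nn_integral_joint_prod[of "\<lambda>w. f (fst w) * indicator a1 (past coord t (snd w))"
              "\<lambda>w. indicator a2 (past coord t (snd w))"] by simp
          also have "\<dots> = (\<integral>\<^sup>+ z. f z * (\<integral>\<^sup>+ x. K (fst z) x * indicator a1 (past coord t x) \<partial>\<mu>) *
              (\<integral>\<^sup>+ y. L (snd z) y * indicator a2 (past coord t y) \<partial>\<nu>) \<partial>\<pi>)"
          proof (rule nn_integral_cong)
            fix z assume "z \<in> space \<pi>"
            then have [measurable]: "fst z \<in> space \<mu>"
              by (rule measurable_space[OF proj_measurable(1)])
            have "(\<integral>\<^sup>+ x. K (fst z) x * (f z * indicator a1 (past coord t x)) \<partial>\<mu>) =
                (\<integral>\<^sup>+ x. f z * (K (fst z) x * indicator a1 (past coord t x)) \<partial>\<mu>)"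
              by (simp add: mult_ac)
            also have "\<dots> = f z * (\<integral>\<^sup>+ x. K (fst z) x * indicator a1 (past coord t x) \<partial>\<mu>)"
              by (rule nn_integral_cmult) measurable
            finally show "(\<integral>\<^sup>+ x. K (fst z) x * (f z * indicator a1 (past coord t x)) \<partial>\<mu>) *
                (\<integral>\<^sup>+ y. L (snd z) y * indicator a2 (past coord t y) \<partial>\<nu>) =
              f z * (\<integral>\<^sup>+ x. K (fst z) x * indicator a1 (past coord t x) \<partial>\<mu>) *
                (\<integral>\<^sup>+ y. L (snd z) y * indicator a2 (past coord t y) \<partial>\<nu>)"
              by simp
          qed
          also have "\<dots> = (\<integral>\<^sup>+ z. f z * k (?P z) \<partial>\<pi>)"
          proof (rule nn_integral_cong_AE)
            show "AE z in \<pi>. f z * (\<integral>\<^sup>+ x. K (fst z) x * indicator a1 (past coord t x) \<partial>\<mu>) *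
                (\<integral>\<^sup>+ y. L (snd z) y * indicator a2 (past coord t y) \<partial>\<nu>) = f z * k (?P z)"
              using couplingsD(5)[OF coupling u_eq] couplingsD(6)[OF coupling v_eq]
              by eventually_elim (simp only: k_def past_fst_snd[symmetric] mult.assoc)
          qed
          finally show ?thesis .
        qed
        show "(\<integral>\<^sup>+ w. f1 (fst w) * indicator a1 (past coord t (fst (snd w))) * indicator a2 (past coord t (snd (snd w))) \<partial>joint) =
          (\<integral>\<^sup>+ w. f2 (fst w) * indicator a1 (past coord t (fst (snd w))) * indicator a2 (past coord t (snd (snd w))) \<partial>joint)"
          by (simp only: int[OF f_meas(1)] int[OF f_meas(2)] f_eq[OF k])
      next
        have "f1 z = indicator (coord_pair (t + 1) -` b \<inter> ?P -` c) z" for z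
          by (auto simp: f1_def indicator_def)
        then show "(\<integral>\<^sup>+ w. f1 (fst w) \<partial>joint) < \<infinity>"
          using ind_fin[OF joint, of "coord_pair (t + 1) -` b \<inter> ?P -` c" fst] by simp
        show "(\<lambda>z. indicator a (pair_past t (fst z) (snd z))) \<in> borel_measurable (past_space X t \<Otimes>\<^sub>M past_space Y t)"
          by (rule measurable_compose[OF pair_past_measurable]) (use t in auto)
      qed measurable
      then show "(\<integral>\<^sup>+ w. indicator a (?P (snd w)) * indicator b (coord_pair (t + 1) (fst w)) * indicator c (?P (fst w)) \<partial>joint) =
        (\<integral>\<^sup>+ w. indicator a (?P (snd w)) * r (?P (fst w)) * indicator c (?P (fst w)) \<partial>joint)"
        by (simp only: past_coord_pair[symmetric]) (simp add: f1_def f2_def mult_ac)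
    qed
  qed measurable
  then show "cond_indep_var joint (borel_of (XY (t + 1))) (\<lambda>w. coord_pair (t + 1) (fst w))
      (past_space XY t) (\<lambda>w. ?P (snd w)) (past_space XY t) (\<lambda>w. ?P (fst w))"
    by (rule cond_indep_var_sym)
qed

lemma version_constraint_smooth:
  assumes "version_constraint v N X coord Y coord \<pi>"
  shows "version_constraint v N X coord Y coord smooth"
  using assms by (cases v) (auto intro: causal_smooth anticausal_smooth)

lemma joint_in_pair_path_couplings: "joint \<in> pair_path_couplings Causal N X Y \<pi> smooth"
  using joint_in_couplings causal_joint by (simp add: pair_path_couplings_def couplings_version_def)

lemma joint_cost:
  assumes [measurable]: "(\<lambda>z. dX (fst z) (snd z)) \<in> borel_measurable (\<mu> \<Otimes>\<^sub>M \<mu>)"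
    "(\<lambda>z. dY (fst z) (snd z)) \<in> borel_measurable (\<nu> \<Otimes>\<^sub>M \<nu>)"
  shows "(\<integral>\<^sup>+ w. ennreal (dX (fst (fst w)) (fst (snd w)) powr p + dY (snd (fst w)) (snd (snd w)) powr p) \<partial>joint) =
    (\<integral>\<^sup>+ x. \<integral>\<^sup>+ x'. K x x' * ennreal (dX x x' powr p) \<partial>\<mu> \<partial>\<mu>) +
    (\<integral>\<^sup>+ y. \<integral>\<^sup>+ y'. L y y' * ennreal (dY y y' powr p) \<partial>\<nu> \<partial>\<nu>)"
proof -
  have dX' [measurable (raw)]: "(\<lambda>w. dX (f w) (g w)) \<in> borel_measurable M" if "f \<in> M \<rightarrow>\<^sub>M \<mu>" "g \<in> M \<rightarrow>\<^sub>M \<mu>"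
    for f g and M :: "'z measure"
    using measurable_compose[OF measurable_Pair[OF that] assms(1)] by simp
  have dY' [measurable (raw)]: "(\<lambda>w. dY (f w) (g w)) \<in> borel_measurable M" if "f \<in> M \<rightarrow>\<^sub>M \<nu>" "g \<in> M \<rightarrow>\<^sub>M \<nu>"
    for f g and M :: "'z measure"
    using measurable_compose[OF measurable_Pair[OF that] assms(2)] by simp
  have "(\<integral>\<^sup>+ w. ennreal (dX (fst (fst w)) (fst (snd w)) powr p + dY (snd (fst w)) (snd (snd w)) powr p) \<partial>joint) =
      (\<integral>\<^sup>+ w. ennreal (dX (fst (fst w)) (fst (snd w)) powr p) \<partial>joint) +
      (\<integral>\<^sup>+ w. ennreal (dY (snd (fst w)) (snd (snd w)) powr p) \<partial>joint)"
    by (simp add: nn_integral_add)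
  also have "(\<integral>\<^sup>+ w. ennreal (dX (fst (fst w)) (fst (snd w)) powr p) \<partial>joint) =
      (\<integral>\<^sup>+ z. \<integral>\<^sup>+ x'. K (fst z) x' * ennreal (dX (fst z) x' powr p) \<partial>\<mu> \<partial>\<pi>)"
    using nn_integral_joint_fst[of "\<lambda>w. ennreal (dX (fst (fst w)) (snd w) powr p)"] by simp
  also have "\<dots> = (\<integral>\<^sup>+ x. \<integral>\<^sup>+ x'. K x x' * ennreal (dX x x' powr p) \<partial>\<mu> \<partial>\<mu>)"
    by (rule couplingsD(3)[OF coupling]) measurable
  also have "(\<integral>\<^sup>+ w. ennreal (dY (snd (fst w)) (snd (snd w)) powr p) \<partial>joint) =
      (\<integral>\<^sup>+ z. \<integral>\<^sup>+ y'. L (snd z) y' * ennreal (dY (snd z) y' powr p) \<partial>\<nu> \<partial>\<pi>)"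
    using nn_integral_joint_snd[of "\<lambda>w. ennreal (dY (snd (fst w)) (snd w) powr p)"] by simp
  also have "\<dots> = (\<integral>\<^sup>+ y. \<integral>\<^sup>+ y'. L y y' * ennreal (dY y y' powr p) \<partial>\<nu> \<partial>\<nu>)"
    by (rule couplingsD(4)[OF coupling]) measurable
  finally show ?thesis .
qed

text \<open>\<open>smooth_density\<close> is bounded everywhere, but \<open>RN_deriv\<close> agrees
  with it only almost everywhere, so the bound carries over in that sense.\<close>

lemma smooth_bounded_density:
  "absolutely_continuous (\<mu> \<Otimes>\<^sub>M \<nu>) smooth"
  "AE w in \<mu> \<Otimes>\<^sub>M \<nu>. RN_deriv (\<mu> \<Otimes>\<^sub>M \<nu>) smooth w \<le> c * c'"
proof -
  show "absolutely_continuous (\<mu> \<Otimes>\<^sub>M \<nu>) smooth"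
    unfolding smooth_def by (rule absolutely_continuousI_density) measurable
  have "AE w in \<mu> \<Otimes>\<^sub>M \<nu>. smooth_density w = RN_deriv (\<mu> \<Otimes>\<^sub>M \<nu>) smooth w"
    by (rule XY.RN_deriv_unique) (simp_all add: smooth_def)
  then show "AE w in \<mu> \<Otimes>\<^sub>M \<nu>. RN_deriv (\<mu> \<Otimes>\<^sub>M \<nu>) smooth w \<le> c * c'"
    by eventually_elim (metis smooth_density_le)
qed

end

section \<open>From transport costs to distances and limits\<close>

lemma tendsto_ennreal_root_0D:
  fixes a :: "nat \<Rightarrow> ennreal"
  assumes "0 < p" "(\<lambda>n. ennreal_root p (a n)) \<longlonglongrightarrow> 0" "0 < e"
  shows "\<forall>\<^sub>F n in sequentially. a n < ennreal e"
proof -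
  have "\<forall>\<^sub>F n in sequentially. ennreal_root p (a n) < ennreal (e powr (1 / p))"
    using assms by (intro order_tendstoD) auto
  then show ?thesis
  proof eventually_elim
    case (elim n)
    \<comment> \<open>An infinite cost has infinite root, so smallness of the root already makes the
      cost finite and the rest is an inequality of reals.\<close>
    then have fin: "a n \<noteq> \<infinity>" by (auto simp: ennreal_root_def)
    then have "enn2real (a n) powr (1 / p) < e powr (1 / p)"
      using elim by (simp add: ennreal_root_def ennreal_less_iff)
    then have "enn2real (a n) < e"
      using powr_mono2[of "1 / p" e "enn2real (a n)"] assms(1,3) by fastforce
    then have "ennreal (enn2real (a n)) < ennreal e"
      using assms(3) by (intro ennreal_lessI)
    moreover have "a n < top"
      using fin less_top[of "a n"] by simp
    ultimately show ?case
      by (simp only: ennreal_enn2real)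
  qed
qed

lemma ennreal_root_mono:
  assumes "0 < p" "a \<le> b"
  shows "ennreal_root p a \<le> ennreal_root p b"
proof (cases "b = \<infinity>")
  case False
  then have "a \<noteq> \<infinity>" "b < top"
    using assms(2) less_top[of b] by (auto simp: top_unique)
  then show ?thesis
    using False assms
    by (simp add: ennreal_root_def) (intro ennreal_leI powr_mono2 enn2real_mono, auto)
qed (simp add: ennreal_root_def)

section \<open>Approximation by couplings with bounded density\<close>

theorem lemma4p1:
  fixes v :: version
    and N :: nat
    and p :: real
    and X :: "nat \<Rightarrow> 'a topology"
    and Y :: "nat \<Rightarrow> 'b topology"
    and dX :: "(nat \<Rightarrow> 'a) \<Rightarrow> (nat \<Rightarrow> 'a) \<Rightarrow> real"
    and dY :: "(nat \<Rightarrow> 'b) \<Rightarrow> (nat \<Rightarrow> 'b) \<Rightarrow> real"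
    and \<mu> :: "(nat \<Rightarrow> 'a) measure"
    and \<nu> :: "(nat \<Rightarrow> 'b) measure"
    and \<pi> :: "((nat \<Rightarrow> 'a) \<times> (nat \<Rightarrow> 'b)) measure"
  assumes "1 \<le> N"
    and "\<And>t. t \<in> {1..N} \<Longrightarrow> polish_topology (X t)"
    and "\<And>t. t \<in> {1..N} \<Longrightarrow> polish_topology (Y t)"
    and "metrizes (path_topology N X) dX"
    and "metrizes (path_topology N Y) dY"
    and "1 \<le> p"
    and "\<mu> \<in> borel_probs_moment p (path_topology N X) dX"
    and "\<nu> \<in> borel_probs_moment p (path_topology N Y) dY"
    and "\<exists>\<mu>n \<nu>n.
           (\<forall>n::nat. \<mu>n n \<in> borel_probs (path_topology N X) \<and> finitely_supported (\<mu>n n)) \<and>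
           (\<forall>n::nat. \<nu>n n \<in> borel_probs (path_topology N Y) \<and> finitely_supported (\<nu>n n)) \<and>
           (\<lambda>n. W_bc p N X dX (\<mu>n n) \<mu>) \<longlonglongrightarrow> 0 \<and>
           (\<lambda>n. W_bc p N Y dY (\<nu>n n) \<nu>) \<longlonglongrightarrow> 0"
    and "\<pi> \<in> path_couplings v N X Y \<mu> \<nu>"
  shows "\<exists>(\<pi>n :: nat \<Rightarrow> ((nat \<Rightarrow> 'a) \<times> (nat \<Rightarrow> 'b)) measure) (C :: nat \<Rightarrow> real).
           (\<forall>n. \<pi>n n \<in> path_couplings v N X Y \<mu> \<nu>) \<and>
           (\<lambda>n. W_c p N X dX Y dY \<pi> (\<pi>n n)) \<longlonglongrightarrow> 0 \<and>
           (\<forall>n. C n > 0 \<and>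
                absolutely_continuous (\<mu> \<Otimes>\<^sub>M \<nu>) (\<pi>n n) \<and>
                (AE w in \<mu> \<Otimes>\<^sub>M \<nu>. RN_deriv (\<mu> \<Otimes>\<^sub>M \<nu>) (\<pi>n n) w \<le> ennreal (C n)))"
proof -
  interpret X: polish_path_space N X
    by unfold_locales fact
  interpret Y: polish_path_space N Y
    by unfold_locales fact
  obtain \<mu>n \<nu>n where \<mu>n: "\<And>n::nat. \<mu>n n \<in> borel_probs (path_topology N X)" "\<And>n. finitely_supported (\<mu>n n)"
    and \<nu>n: "\<And>n::nat. \<nu>n n \<in> borel_probs (path_topology N Y)" "\<And>n. finitely_supported (\<nu>n n)"
    and limX: "(\<lambda>n. W_bc p N X dX (\<mu>n n) \<mu>) \<longlonglongrightarrow> 0" and limY: "(\<lambda>n. W_bc p N Y dY (\<nu>n n) \<nu>) \<longlonglongrightarrow> 0"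
    using assms(9) by blast
  have p: "0 < p" "0 \<le> p" using assms(6) by auto
  have \<mu>: "\<mu> \<in> borel_probs (path_topology N X)" and \<nu>: "\<nu> \<in> borel_probs (path_topology N Y)"
    using assms(7,8) by (auto simp: borel_probs_moment_def)
  have coupling: "\<pi> \<in> couplings \<mu> \<nu>" and constraint: "version_constraint v N X coord Y coord \<pi>"
    using assms(10) by (auto simp: path_couplings_def couplings_version_def)
  have "\<exists>\<pi>' C. \<pi>' \<in> path_couplings v N X Y \<mu> \<nu> \<and>
      W_c p N X dX Y dY \<pi> \<pi>' \<le> ennreal_root p (ennreal (inverse (Suc k))) \<and> C > 0 \<and>
      absolutely_continuous (\<mu> \<Otimes>\<^sub>M \<nu>) \<pi>' \<and>
      (AE w in \<mu> \<Otimes>\<^sub>M \<nu>. RN_deriv (\<mu> \<Otimes>\<^sub>M \<nu>) \<pi>' w \<le> ennreal C)" for k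
  proof -
    \<comment> \<open>Each coordinate contributes at most \<open>2 * 2 powr p * e\<close> to the
      cost of the joint law; the two together make exactly \<open>inverse (Suc k)\<close>.\<close>
    define e where "e = inverse (real (Suc k)) / (4 * 2 powr p)"
    have e: "0 < e" by (simp add: e_def)
    have "\<forall>\<^sub>F n in sequentially. (INF \<alpha>\<in>path_couplings Bicausal N X X (\<mu>n n) \<mu>.
        \<integral>\<^sup>+ w. ennreal (dX (fst w) (snd w) powr p) \<partial>\<alpha>) < ennreal e"
      using tendsto_ennreal_root_0D[OF p(1) limX[unfolded W_bc_def] e] .
    moreover have "\<forall>\<^sub>F n in sequentially. (INF \<beta>\<in>path_couplings Bicausal N Y Y (\<nu>n n) \<nu>.
        \<integral>\<^sup>+ w. ennreal (dY (fst w) (snd w) powr p) \<partial>\<beta>) < ennreal e"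
      using tendsto_ennreal_root_0D[OF p(1) limY[unfolded W_bc_def] e] .
    ultimately obtain n where
      "(INF \<alpha>\<in>path_couplings Bicausal N X X (\<mu>n n) \<mu>. \<integral>\<^sup>+ w. ennreal (dX (fst w) (snd w) powr p) \<partial>\<alpha>) < ennreal e"
      "(INF \<beta>\<in>path_couplings Bicausal N Y Y (\<nu>n n) \<nu>. \<integral>\<^sup>+ w. ennreal (dY (fst w) (snd w) powr p) \<partial>\<beta>) < ennreal e"
      using eventually_happens'[OF sequentially_bot eventually_conj] by blast
    \<comment> \<open>An infimum below \<open>e\<close> is undercut by some member of the set. In
      particular bicausal couplings exist, as an empty infimum would be infinite.\<close>
    then obtain \<alpha> \<beta> where \<alpha>: "\<alpha> \<in> path_couplings Bicausal N X X (\<mu>n n) \<mu>"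
        "(\<integral>\<^sup>+ w. ennreal (dX (fst w) (snd w) powr p) \<partial>\<alpha>) < ennreal e"
      and \<beta>: "\<beta> \<in> path_couplings Bicausal N Y Y (\<nu>n n) \<nu>"
        "(\<integral>\<^sup>+ w. ennreal (dY (fst w) (snd w) powr p) \<partial>\<beta>) < ennreal e"
      by (auto simp: INF_less_iff)
    obtain K c where K: "bicausal_kernel N X \<mu> K c"
      and costX: "(\<integral>\<^sup>+ x. \<integral>\<^sup>+ y. K x y * ennreal (dX x y powr p) \<partial>\<mu> \<partial>\<mu>) \<le>
        ennreal (2 * 2 powr p) * (\<integral>\<^sup>+ w. ennreal (dX (fst w) (snd w) powr p) \<partial>\<alpha>)"
      by (rule X.ex_bicausal_kernel[OF \<alpha>(1) \<mu>n(1) \<mu>n(2) \<mu> assms(4) p(2)])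
    obtain L c' where L: "bicausal_kernel N Y \<nu> L c'"
      and costY: "(\<integral>\<^sup>+ x. \<integral>\<^sup>+ y. L x y * ennreal (dY x y powr p) \<partial>\<nu> \<partial>\<nu>) \<le>
        ennreal (2 * 2 powr p) * (\<integral>\<^sup>+ w. ennreal (dY (fst w) (snd w) powr p) \<partial>\<beta>)"
      by (rule Y.ex_bicausal_kernel[OF \<beta>(1) \<nu>n(1) \<nu>n(2) \<nu> assms(5) p(2)])
    interpret K: bicausal_kernel N X \<mu> K c by (rule K)
    interpret L: bicausal_kernel N Y \<nu> L c' by (rule L)
    interpret kernel_smoothing N X \<mu> K c Y \<nu> L c' \<pi>
      by unfold_locales (rule coupling)
    have dX: "(\<lambda>z. dX (fst z) (snd z)) \<in> borel_measurable (\<mu> \<Otimes>\<^sub>M \<mu>)"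
      using metrizes_borel_measurable[OF assms(4) X.second_countable_paths]
      by (simp add: measurable_cong_sets[OF sets_pair_measure_cong[OF K.sets_eq K.sets_eq] refl])
    have dY: "(\<lambda>z. dY (fst z) (snd z)) \<in> borel_measurable (\<nu> \<Otimes>\<^sub>M \<nu>)"
      using metrizes_borel_measurable[OF assms(5) Y.second_countable_paths]
      by (simp add: measurable_cong_sets[OF sets_pair_measure_cong[OF L.sets_eq L.sets_eq] refl])
    have "W_c p N X dX Y dY \<pi> smooth \<le> ennreal_root p
        (\<integral>\<^sup>+ w. ennreal (dX (fst (fst w)) (fst (snd w)) powr p + dY (snd (fst w)) (snd (snd w)) powr p) \<partial>joint)"
      unfolding W_c_def
      by (rule ennreal_root_mono[OF p(1) INF_lower[OF joint_in_pair_path_couplings]])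
    also have "\<dots> \<le> ennreal_root p (ennreal (inverse (Suc k)))"
    proof (rule ennreal_root_mono[OF p(1)])
      have "(\<integral>\<^sup>+ w. ennreal (dX (fst (fst w)) (fst (snd w)) powr p + dY (snd (fst w)) (snd (snd w)) powr p) \<partial>joint) \<le>
          ennreal (2 * 2 powr p) * ennreal e + ennreal (2 * 2 powr p) * ennreal e"
        unfolding joint_cost[OF dX dY] using \<alpha>(2) \<beta>(2)
        by (intro add_mono order_trans[OF costX] order_trans[OF costY] mult_left_mono) auto
      also have "\<dots> = ennreal (2 * 2 powr p * e + 2 * 2 powr p * e)"
        using e by (simp add: ennreal_mult[symmetric] ennreal_plus[symmetric] del: ennreal_plus)
      also have "2 * 2 powr p * e + 2 * 2 powr p * e = inverse (real (Suc k))"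
        unfolding e_def by simp
      finally show "(\<integral>\<^sup>+ w. ennreal (dX (fst (fst w)) (fst (snd w)) powr p + dY (snd (fst w)) (snd (snd w)) powr p) \<partial>joint) \<le>
          ennreal (inverse (Suc k))" .
    qed
    finally have cost: "W_c p N X dX Y dY \<pi> smooth \<le> ennreal_root p (ennreal (inverse (Suc k)))" .
    have "c * c' < top"
      using K.bound_finite L.bound_finite by (simp add: ennreal_mult_less_top)
    \<comment> \<open>Adding 1 makes the real constant strictly positive.\<close>
    then have "c * c' \<le> ennreal (enn2real (c * c') + 1)"
      by (subst ennreal_enn2real[symmetric]) (auto intro!: ennreal_leI)
    then have "AE w in \<mu> \<Otimes>\<^sub>M \<nu>. RN_deriv (\<mu> \<Otimes>\<^sub>M \<nu>) smooth w \<le> ennreal (enn2real (c * c') + 1)"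
      using smooth_bounded_density(2) by (auto elim!: eventually_mono)
    moreover have "smooth \<in> path_couplings v N X Y \<mu> \<nu>"
      using smooth_in_couplings version_constraint_smooth[OF constraint]
      by (simp add: path_couplings_def couplings_version_def)
    ultimately show ?thesis
      using cost smooth_bounded_density(1)
      by (intro exI[of _ smooth] exI[of _ "enn2real (c * c') + 1"]) (simp add: add_nonneg_pos)
  qed
  then obtain \<pi>n C where \<pi>n: "\<And>k. \<pi>n k \<in> path_couplings v N X Y \<mu> \<nu>"
    and W: "\<And>k. W_c p N X dX Y dY \<pi> (\<pi>n k) \<le> ennreal_root p (ennreal (inverse (Suc k)))"
    and C: "\<And>k. (C k :: real) > 0" "\<And>k. absolutely_continuous (\<mu> \<Otimes>\<^sub>M \<nu>) (\<pi>n k)"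
      "\<And>k. AE w in \<mu> \<Otimes>\<^sub>M \<nu>. RN_deriv (\<mu> \<Otimes>\<^sub>M \<nu>) (\<pi>n k) w \<le> ennreal (C k)"
    by metis
  have lim: "(\<lambda>k. ennreal_root p (ennreal (inverse (real (Suc k))))) \<longlonglongrightarrow> 0"
  proof -
    have "(\<lambda>k. inverse (real (Suc k)) powr (1 / p)) \<longlonglongrightarrow> 0"
      using LIMSEQ_inverse_real_of_nat p(1) by (intro tendsto_zero_powrI[of _ _ _ "1 / p"]) auto
    from tendsto_ennrealI[OF this] show ?thesis
      by (simp add: ennreal_root_def)
  qed
  have "(\<lambda>k. W_c p N X dX Y dY \<pi> (\<pi>n k)) \<longlonglongrightarrow> 0"
    by (rule tendsto_sandwich[OF _ always_eventually[OF allI[OF W]] tendsto_const lim]) simp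
  with \<pi>n C show ?thesis
    by blast
qed

end
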